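(* For every $k\ge1$, the ring of Laurent polynomials $\mathbb Z[x_1,x_1^{-1},\ldots,x_k,x_k^{-1}]$ is regularly bi-interpretable with the ring $\mathbb Z$.
   Context: A regular interpretation $(\Gamma,\phi)$ of $\mathbb A$ in $\mathbb B$ is a code of $L(\mathbb B)$-formulas with parameters $\bar y$ defining a subset of $B^n$, an equivalence relation on it and the operations of $\mathbb A$ on the quotient, together with a formula $\phi(\bar y)$ with $\phi(\mathbb B)\ne\emptyset$, such that the resulting structure $\Gamma(\mathbb B,\bar p)\cong\mathbb A$ for every $\bar p\in\phi(\mathbb B)$; a coordinate map is a surjection from the defined subset onto $A$ inducing such an isomorphism. $\mathbb A$ and $\mathbb B$ are regularly bi-interpretable if there are regular interpretations $(\Gamma,\phi)$ of $\mathbb A$ in $\mathbb B$ and $(\Delta,\psi)$ of $\mathbb B$ in $\mathbb A$ and formulas $\theta_{\mathbb A},\theta_{\mathbb B}$ such that for every admissible parameter tuple $\bar r_0$ of the composite interpretation $\Gamma\circ\Delta$ of $\mathbb A$ in $\mathbb A$, $\theta_{\mathbb A}(\bar u,x,\bar r_0)$ defines a coordinate map $\Gamma\circ\Delta(\mathbb A,\bar r_0)\to\mathbb A$, and symmetrically for $\Delta\circ\Gamma$ and $\theta_{\mathbb B}$. *)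

theory Defs
  imports "HOL-Algebra.IntRing" "HOL-Library.Poly_Mapping"
begin

section \<open>First-order formulas in the language of rings\<close>

text \<open>
  All structures below are rings, so the only language needed is \<open>{+, \<cdot>, 0, 1}\<close>.
  Variables are de Bruijn indices into an environment, which is a list:
  a formula in \<open>d\<close> variables is evaluated in environments of length \<open>d\<close>, and a
  quantifier prepends the quantified element to the environment.
\<close>

datatype rterm = TVar nat | TZero | TOne | TAdd rterm rterm | TMul rterm rterm

datatype rform = FEq rterm rterm | FNot rform | FAnd rform rform | FEx rform

primrec tval :: "('a, 'm) ring_scheme \<Rightarrow> 'a list \<Rightarrow> rterm \<Rightarrow> 'a" where
  "tval R e (TVar i) = e ! i"
| "tval R e TZero = \<zero>\<^bsub>R\<^esub>"
| "tval R e TOne = \<one>\<^bsub>R\<^esub>"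
| "tval R e (TAdd s t) = tval R e s \<oplus>\<^bsub>R\<^esub> tval R e t"
| "tval R e (TMul s t) = tval R e s \<otimes>\<^bsub>R\<^esub> tval R e t"

primrec sat :: "('a, 'm) ring_scheme \<Rightarrow> 'a list \<Rightarrow> rform \<Rightarrow> bool" where
  "sat R e (FEq s t) \<longleftrightarrow> tval R e s = tval R e t"
| "sat R e (FNot \<phi>) \<longleftrightarrow> \<not> sat R e \<phi>"
| "sat R e (FAnd \<phi> \<psi>) \<longleftrightarrow> sat R e \<phi> \<and> sat R e \<psi>"
| "sat R e (FEx \<phi>) \<longleftrightarrow> (\<exists>x\<in>carrier R. sat R (x # e) \<phi>)"

primrec tvars_below :: "nat \<Rightarrow> rterm \<Rightarrow> bool" where
  "tvars_below d (TVar i) \<longleftrightarrow> i < d"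
| "tvars_below d TZero \<longleftrightarrow> True"
| "tvars_below d TOne \<longleftrightarrow> True"
| "tvars_below d (TAdd s t) \<longleftrightarrow> tvars_below d s \<and> tvars_below d t"
| "tvars_below d (TMul s t) \<longleftrightarrow> tvars_below d s \<and> tvars_below d t"

text \<open>\<open>vars_below d \<phi>\<close>: \<open>\<phi>\<close> is a formula in \<open>d\<close> variables.\<close>

primrec vars_below :: "nat \<Rightarrow> rform \<Rightarrow> bool" where
  "vars_below d (FEq s t) \<longleftrightarrow> tvars_below d s \<and> tvars_below d t"
| "vars_below d (FNot \<phi>) \<longleftrightarrow> vars_below d \<phi>"
| "vars_below d (FAnd \<phi> \<psi>) \<longleftrightarrow> vars_below d \<phi> \<and> vars_below d \<psi>"
| "vars_below d (FEx \<phi>) \<longleftrightarrow> vars_below (Suc d) \<phi>"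

primrec trename :: "(nat \<Rightarrow> nat) \<Rightarrow> rterm \<Rightarrow> rterm" where
  "trename f (TVar i) = TVar (f i)"
| "trename f TZero = TZero"
| "trename f TOne = TOne"
| "trename f (TAdd s t) = TAdd (trename f s) (trename f t)"
| "trename f (TMul s t) = TMul (trename f s) (trename f t)"

primrec rename :: "(nat \<Rightarrow> nat) \<Rightarrow> rform \<Rightarrow> rform" where
  "rename f (FEq s t) = FEq (trename f s) (trename f t)"
| "rename f (FNot \<phi>) = FNot (rename f \<phi>)"
| "rename f (FAnd \<phi> \<psi>) = FAnd (rename f \<phi>) (rename f \<psi>)"
| "rename f (FEx \<phi>) = FEx (rename (case_nat 0 (\<lambda>i. Suc (f i))) \<phi>)"

definition tuples :: "('a, 'm) ring_scheme \<Rightarrow> nat \<Rightarrow> 'a list set" where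
  "tuples R n = {xs. set xs \<subseteq> carrier R \<and> length xs = n}"

definition solutions :: "('a, 'm) ring_scheme \<Rightarrow> nat \<Rightarrow> rform \<Rightarrow> 'a list set" where
  "solutions R n \<phi> = {xs \<in> tuples R n. sat R xs \<phi>}"


section \<open>Codes and interpretations\<close>

text \<open>
  A code of dimension \<open>cdim\<close> with \<open>cpar\<close> parameters. The environment of each formula
  consists of the coordinate tuples of its arguments (for an operation: the operands,
  then the value), followed by the parameters.
\<close>

record rcode =
  cdim :: nat
  cpar :: nat
  cdom :: rform
  ceq :: rform
  czero :: rform
  cone :: rform
  cadd :: rform
  cmul :: rform

definition wf_rcode :: "rcode \<Rightarrow> bool" where
  "wf_rcode \<Gamma> \<longleftrightarrow>
     vars_below (cdim \<Gamma> + cpar \<Gamma>) (cdom \<Gamma>) \<and>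
     vars_below (2 * cdim \<Gamma> + cpar \<Gamma>) (ceq \<Gamma>) \<and>
     vars_below (cdim \<Gamma> + cpar \<Gamma>) (czero \<Gamma>) \<and>
     vars_below (cdim \<Gamma> + cpar \<Gamma>) (cone \<Gamma>) \<and>
     vars_below (3 * cdim \<Gamma> + cpar \<Gamma>) (cadd \<Gamma>) \<and>
     vars_below (3 * cdim \<Gamma> + cpar \<Gamma>) (cmul \<Gamma>)"

definition code_dom :: "rcode \<Rightarrow> ('b, 'm) ring_scheme \<Rightarrow> 'b list \<Rightarrow> 'b list set" where
  "code_dom \<Gamma> B p = {a \<in> tuples B (cdim \<Gamma>). sat B (a @ p) (cdom \<Gamma>)}"

definition code_rel :: "rcode \<Rightarrow> ('b, 'm) ring_scheme \<Rightarrow> 'b list \<Rightarrow> ('b list \<times> 'b list) set" where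
  "code_rel \<Gamma> B p =
     {(a, b). a \<in> code_dom \<Gamma> B p \<and> b \<in> code_dom \<Gamma> B p \<and> sat B (a @ b @ p) (ceq \<Gamma>)}"

definition code_quot :: "rcode \<Rightarrow> ('b, 'm) ring_scheme \<Rightarrow> 'b list \<Rightarrow> 'b list set set" where
  "code_quot \<Gamma> B p = code_dom \<Gamma> B p // code_rel \<Gamma> B p"

text \<open>
  The code defines a structure at \<open>p\<close>: an equivalence relation, and formulas that
  define (modulo it, within the domain) graphs of operations on the quotient.
\<close>

definition defines_const :: "rcode \<Rightarrow> ('b, 'm) ring_scheme \<Rightarrow> 'b list \<Rightarrow> rform \<Rightarrow> bool" where
  "defines_const \<Gamma> B p \<phi> \<longleftrightarrow>
     (\<exists>Z\<in>code_quot \<Gamma> B p. \<forall>c\<in>code_dom \<Gamma> B p. sat B (c @ p) \<phi> \<longleftrightarrow> c \<in> Z)"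

definition defines_binop :: "rcode \<Rightarrow> ('b, 'm) ring_scheme \<Rightarrow> 'b list \<Rightarrow> rform \<Rightarrow> bool" where
  "defines_binop \<Gamma> B p \<phi> \<longleftrightarrow>
     (\<forall>X\<in>code_quot \<Gamma> B p. \<forall>Y\<in>code_quot \<Gamma> B p. \<exists>Z\<in>code_quot \<Gamma> B p.
        \<forall>a\<in>X. \<forall>b\<in>Y. \<forall>c\<in>code_dom \<Gamma> B p. sat B (a @ b @ c @ p) \<phi> \<longleftrightarrow> c \<in> Z)"

definition code_defined :: "rcode \<Rightarrow> ('b, 'm) ring_scheme \<Rightarrow> 'b list \<Rightarrow> bool" where
  "code_defined \<Gamma> B p \<longleftrightarrow>
     equiv (code_dom \<Gamma> B p) (code_rel \<Gamma> B p) \<and>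
     defines_const \<Gamma> B p (czero \<Gamma>) \<and> defines_const \<Gamma> B p (cone \<Gamma>) \<and>
     defines_binop \<Gamma> B p (cadd \<Gamma>) \<and> defines_binop \<Gamma> B p (cmul \<Gamma>)"

definition quot_const :: "rcode \<Rightarrow> ('b, 'm) ring_scheme \<Rightarrow> 'b list \<Rightarrow> rform \<Rightarrow> 'b list set" where
  "quot_const \<Gamma> B p \<phi> = (THE Z. Z \<in> code_quot \<Gamma> B p \<and> (\<exists>c\<in>Z. sat B (c @ p) \<phi>))"

definition quot_binop ::
  "rcode \<Rightarrow> ('b, 'm) ring_scheme \<Rightarrow> 'b list \<Rightarrow> rform \<Rightarrow> 'b list set \<Rightarrow> 'b list set \<Rightarrow> 'b list set" where
  "quot_binop \<Gamma> B p \<phi> X Y =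
     (THE Z. Z \<in> code_quot \<Gamma> B p \<and> (\<exists>a\<in>X. \<exists>b\<in>Y. \<exists>c\<in>Z. sat B (a @ b @ c @ p) \<phi>))"

text \<open>The structure \<open>\<Gamma>(B, p)\<close>.\<close>

definition interp :: "rcode \<Rightarrow> ('b, 'm) ring_scheme \<Rightarrow> 'b list \<Rightarrow> 'b list set ring" where
  "interp \<Gamma> B p =
     \<lparr>carrier = code_quot \<Gamma> B p,
      mult = quot_binop \<Gamma> B p (cmul \<Gamma>),
      one = quot_const \<Gamma> B p (cone \<Gamma>),
      zero = quot_const \<Gamma> B p (czero \<Gamma>),
      add = quot_binop \<Gamma> B p (cadd \<Gamma>)\<rparr>"

text \<open>
  \<^const>\<open>ring_iso\<close> does not mention zero, because between rings its preservation is
  automatic; \<open>\<Gamma>(B, p)\<close> is not a ring a priori, so it has to be demanded.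
\<close>

definition struct_iso :: "('a, 'm) ring_scheme \<Rightarrow> ('b, 'n) ring_scheme \<Rightarrow> ('a \<Rightarrow> 'b) set" where
  "struct_iso R S = {h \<in> ring_iso R S. h \<zero>\<^bsub>R\<^esub> = \<zero>\<^bsub>S\<^esub>}"

definition regular_interpretation ::
  "rcode \<Rightarrow> rform \<Rightarrow> ('a, 'm) ring_scheme \<Rightarrow> ('b, 'n) ring_scheme \<Rightarrow> bool" where
  "regular_interpretation \<Gamma> \<phi> A B \<longleftrightarrow>
     wf_rcode \<Gamma> \<and> vars_below (cpar \<Gamma>) \<phi> \<and> solutions B (cpar \<Gamma>) \<phi> \<noteq> {} \<and>
     (\<forall>p\<in>solutions B (cpar \<Gamma>) \<phi>. code_defined \<Gamma> B p \<and> struct_iso (interp \<Gamma> B p) A \<noteq> {})"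

definition coordinate_map ::
  "rcode \<Rightarrow> ('b, 'm) ring_scheme \<Rightarrow> 'b list \<Rightarrow> ('a, 'n) ring_scheme \<Rightarrow> ('b list \<Rightarrow> 'a) \<Rightarrow> bool" where
  "coordinate_map \<Gamma> B p A \<mu> \<longleftrightarrow>
     code_defined \<Gamma> B p \<and> \<mu> ` code_dom \<Gamma> B p = carrier A \<and>
     (\<exists>h\<in>struct_iso (interp \<Gamma> B p) A. \<forall>a\<in>code_dom \<Gamma> B p. \<mu> a = h (code_rel \<Gamma> B p `` {a}))"


section \<open>Composition of codes\<close>

text \<open>
  Translation along a code \<open>\<Delta>\<close> of \<open>B\<close> in \<open>A\<close>: a formula about \<open>\<Delta>(A, p)\<close> in
  \<open>d\<close> variables becomes a formula about \<open>A\<close> whose environment consists of \<open>d\<close> blocks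
  of \<open>cdim \<Delta>\<close> variables, one for each variable, followed by the parameters \<open>p\<close>.
  \<open>at_blocks n d ks \<phi>\<close> evaluates a formula \<open>\<phi>\<close> of the code at the blocks with numbers
  \<open>ks\<close> (and at the parameters) when there are \<open>d\<close> blocks in scope.
\<close>

definition at_blocks :: "nat \<Rightarrow> nat \<Rightarrow> nat list \<Rightarrow> rform \<Rightarrow> rform" where
  "at_blocks n d ks \<phi> =
     rename (\<lambda>i. if i < n * length ks then n * (ks ! (i div n)) + i mod n
                 else n * d + (i - n * length ks)) \<phi>"

text \<open>
  The new block is number 0 and is counted by \<open>d\<close>.
\<close>

definition ex_block :: "rcode \<Rightarrow> nat \<Rightarrow> rform \<Rightarrow> rform" where
  "ex_block \<Delta> d \<phi> =
     (FEx ^^ cdim \<Delta>) (FAnd (at_blocks (cdim \<Delta>) d [0] (cdom \<Delta>)) \<phi>)"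

text \<open>
  \<open>translate_val \<Delta> d j t k\<close>: the value of \<open>t\<close> is the class of block \<open>k\<close>. Here variable
  \<open>i\<close> of \<open>t\<close> is block \<open>i + j\<close>, since \<open>j\<close> auxiliary blocks have been quantified in front.
\<close>

primrec translate_val :: "rcode \<Rightarrow> nat \<Rightarrow> nat \<Rightarrow> rterm \<Rightarrow> nat \<Rightarrow> rform" where
  "translate_val \<Delta> d j (TVar i) k = at_blocks (cdim \<Delta>) d [i + j, k] (ceq \<Delta>)"
| "translate_val \<Delta> d j TZero k = at_blocks (cdim \<Delta>) d [k] (czero \<Delta>)"
| "translate_val \<Delta> d j TOne k = at_blocks (cdim \<Delta>) d [k] (cone \<Delta>)"
| "translate_val \<Delta> d j (TAdd s t) k =
     ex_block \<Delta> (d + 1) (ex_block \<Delta> (d + 2)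
       (FAnd (translate_val \<Delta> (d + 2) (j + 2) s 0)
         (FAnd (translate_val \<Delta> (d + 2) (j + 2) t 1)
           (at_blocks (cdim \<Delta>) (d + 2) [0, 1, k + 2] (cadd \<Delta>)))))"
| "translate_val \<Delta> d j (TMul s t) k =
     ex_block \<Delta> (d + 1) (ex_block \<Delta> (d + 2)
       (FAnd (translate_val \<Delta> (d + 2) (j + 2) s 0)
         (FAnd (translate_val \<Delta> (d + 2) (j + 2) t 1)
           (at_blocks (cdim \<Delta>) (d + 2) [0, 1, k + 2] (cmul \<Delta>)))))"

primrec translate :: "rcode \<Rightarrow> nat \<Rightarrow> rform \<Rightarrow> rform" where
  "translate \<Delta> d (FEq s t) =
     ex_block \<Delta> (d + 1)
       (FAnd (translate_val \<Delta> (d + 1) 1 s 0) (translate_val \<Delta> (d + 1) 1 t 0))"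
| "translate \<Delta> d (FNot \<phi>) = FNot (translate \<Delta> d \<phi>)"
| "translate \<Delta> d (FAnd \<phi> \<psi>) = FAnd (translate \<Delta> d \<phi>) (translate \<Delta> d \<psi>)"
| "translate \<Delta> d (FEx \<phi>) = ex_block \<Delta> (d + 1) (translate \<Delta> (d + 1) \<phi>)"

text \<open>The first \<open>m\<close> of \<open>d\<close> blocks lie in the domain, and \<open>\<phi>\<close>.\<close>

definition blocks_in_dom :: "rcode \<Rightarrow> nat \<Rightarrow> nat \<Rightarrow> rform \<Rightarrow> rform" where
  "blocks_in_dom \<Delta> d m \<phi> =
     foldr FAnd (map (\<lambda>k. at_blocks (cdim \<Delta>) d [k] (cdom \<Delta>)) [0..<m]) \<phi>"

text \<open>
  The composite \<open>\<Gamma> \<circ> \<Delta>\<close>, for \<open>\<Gamma>\<close> of \<open>A\<close> in \<open>B\<close> and \<open>\<Delta>\<close> of \<open>B\<close> in \<open>C\<close>. Its parameters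
  are \<open>cpar \<Gamma>\<close> blocks, coding parameters of \<open>\<Gamma>\<close>, followed by parameters of \<open>\<Delta>\<close>.
\<close>

definition code_comp :: "rcode \<Rightarrow> rcode \<Rightarrow> rcode" where
  "code_comp \<Gamma> \<Delta> =
     (let n = cdim \<Gamma>; l = cpar \<Gamma> in
      \<lparr>cdim = n * cdim \<Delta>,
       cpar = l * cdim \<Delta> + cpar \<Delta>,
       cdom = blocks_in_dom \<Delta> (n + l) n (translate \<Delta> (n + l) (cdom \<Gamma>)),
       ceq = translate \<Delta> (2 * n + l) (ceq \<Gamma>),
       czero = translate \<Delta> (n + l) (czero \<Gamma>),
       cone = translate \<Delta> (n + l) (cone \<Gamma>),
       cadd = translate \<Delta> (3 * n + l) (cadd \<Gamma>),
       cmul = translate \<Delta> (3 * n + l) (cmul \<Gamma>)\<rparr>)"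

text \<open>
  The admissibility formula of \<open>(\<Gamma>, \<phi>) \<circ> (\<Delta>, \<psi>)\<close>: the last parameters satisfy \<open>\<psi>\<close>, and
  the blocks represent a tuple that satisfies \<open>\<phi>\<close>.
\<close>

definition par_comp :: "rcode \<Rightarrow> rform \<Rightarrow> rcode \<Rightarrow> rform \<Rightarrow> rform" where
  "par_comp \<Gamma> \<phi> \<Delta> \<psi> =
     blocks_in_dom \<Delta> (cpar \<Gamma>) (cpar \<Gamma>)
       (FAnd (translate \<Delta> (cpar \<Gamma>) \<phi>) (at_blocks (cdim \<Delta>) (cpar \<Gamma>) [] \<psi>))"


section \<open>Regular bi-interpretability\<close>

text \<open>\<open>\<theta>(u, x, r)\<close> defines the graph of a coordinate map \<open>\<Gamma>(B, r) \<rightarrow> B\<close>.\<close>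

definition defines_coordinate_map ::
  "rform \<Rightarrow> rcode \<Rightarrow> ('a, 'm) ring_scheme \<Rightarrow> 'a list \<Rightarrow> bool" where
  "defines_coordinate_map \<theta> \<Gamma> A r \<longleftrightarrow>
     (\<exists>\<mu>. coordinate_map \<Gamma> A r A \<mu> \<and>
       (\<forall>u\<in>tuples A (cdim \<Gamma>). \<forall>x\<in>carrier A.
          sat A (u @ [x] @ r) \<theta> \<longleftrightarrow> u \<in> code_dom \<Gamma> A r \<and> x = \<mu> u))"

definition regularly_bi_interpretable ::
  "('a, 'm) ring_scheme \<Rightarrow> ('b, 'n) ring_scheme \<Rightarrow> bool" where
  "regularly_bi_interpretable A B \<longleftrightarrow>
     (\<exists>\<Gamma> \<phi> \<Delta> \<psi> \<theta>\<^sub>A \<theta>\<^sub>B.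
       regular_interpretation \<Gamma> \<phi> A B \<and> regular_interpretation \<Delta> \<psi> B A \<and>
       vars_below (cdim (code_comp \<Gamma> \<Delta>) + 1 + cpar (code_comp \<Gamma> \<Delta>)) \<theta>\<^sub>A \<and>
       (\<forall>r\<in>solutions A (cpar (code_comp \<Gamma> \<Delta>)) (par_comp \<Gamma> \<phi> \<Delta> \<psi>).
          defines_coordinate_map \<theta>\<^sub>A (code_comp \<Gamma> \<Delta>) A r) \<and>
       vars_below (cdim (code_comp \<Delta> \<Gamma>) + 1 + cpar (code_comp \<Delta> \<Gamma>)) \<theta>\<^sub>B \<and>
       (\<forall>r\<in>solutions B (cpar (code_comp \<Delta> \<Gamma>)) (par_comp \<Delta> \<psi> \<Gamma> \<phi>).
          defines_coordinate_map \<theta>\<^sub>B (code_comp \<Delta> \<Gamma>) B r))"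


section \<open>Laurent polynomials\<close>

text \<open>
  The ring of integer Laurent polynomials in the variables with numbers \<open>0, \<dots>, k - 1\<close>:
  an exponent vector is a finitely supported function from variables to integers, and a
  polynomial maps exponent vectors to coefficients.
\<close>

definition laurent_ring :: "nat \<Rightarrow> ((nat \<Rightarrow>\<^sub>0 int) \<Rightarrow>\<^sub>0 int) ring" where
  "laurent_ring k =
     \<lparr>carrier = {p. \<forall>m\<in>Poly_Mapping.keys p. Poly_Mapping.keys m \<subseteq> {..<k}},
      mult = (*), one = 1, zero = 0, add = (+)\<rparr>"

end

(* The Laurent ring L is coded in the integers by Horner schemes: a code is a beta-function
   sequence of operations "multiply by a variable or its inverse, add or subtract 1". Everything
   about such codes is arithmetical in the values of the scheme at integer points s, scaled by a
   common denominator C so that they are integers; these values determine the polynomial by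
   Dedekind's independence of characters.

   Conversely the integers form a subset of L definable without parameters: r is an integer iff
   for every unit v there is a unit w with (v - 1)^2 | w - 1 - r (v - 1). For integers w = v^r
   works; in general one takes for v a large power of the first variable.

   In L, the polynomial f with a given code is singled out by the congruences C f = b modulo
   (x_1 - s_1, ..., x_k - s_k), where b is the predicted integer. The variables enter as
   parameters p. It is a first-order property of p that these congruences define a coordinate
   map, and this property is taken as the admissibility formula, so it need not be known which
   tuples have it, only that the tuple of variables does. *)

theory Submission
  imports Defs Complex_Main "HOL-Number_Theory.Cong"
begin

section \<open>Composition of codes\<close>

text \<open>Inverting a variable is an automorphism of L that fixes every integer, so a map from
  tuples of integers onto L cannot be definable without parameters; this is why the variables have
  to be named. Regularity then demands one formula that works at every admissible tuple, not only at
  the variables. Values at integer points are chosen because both rings can speak of them. Over the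
  integers, sums and products of polynomials become sums and products of values, which avoids coding
  exponent vectors and convolutions. Inside L, the value at s is the residue modulo x_i - s_i, and
  membership in that ideal takes only k witnesses. The factor C is forced by the inverse variables,
  whose values are fractions. In the definition of the integers, the unit condition alone yields
  that r is congruent to some integer t modulo v - 1. For v = x_1^j with j beyond the spread of the
  exponents of r, a polynomial supported like r - t can be a multiple of v - 1 only if it is zero.
  The beta function needs the order of the integers, which the ring language expresses by sums of
  four rational squares.\<close>

lemma tuples_length: "xs \<in> tuples R n \<Longrightarrow> length xs = n"
  by (simp add: tuples_def)

lemma tuples_nth: "xs \<in> tuples R n \<Longrightarrow> i < n \<Longrightarrow> xs ! i \<in> carrier R"
  by (auto simp: tuples_def)

lemma tuples_append: "xs \<in> tuples R m \<Longrightarrow> ys \<in> tuples R n \<Longrightarrow> xs @ ys \<in> tuples R (m + n)"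
  by (auto simp: tuples_def)

lemma tuples_Suc: "xs \<in> tuples R (Suc n) \<longleftrightarrow> (\<exists>y ys. xs = y # ys \<and> y \<in> carrier R \<and> ys \<in> tuples R n)"
  by (cases xs) (auto simp: tuples_def)

lemma tuples_0 [simp]: "tuples R 0 = {[]}"
  by (auto simp: tuples_def)

section \<open>Renaming of variables and blocks of coordinates\<close>

lemma tval_trename:
  "tvars_below n t \<Longrightarrow> \<forall>i<n. e ! f i = e' ! i \<Longrightarrow> tval R e (trename f t) = tval R e' t"
  by (induction t) auto

lemma sat_rename:
  "vars_below n \<phi> \<Longrightarrow> \<forall>i<n. e ! f i = e' ! i \<Longrightarrow> sat R e (rename f \<phi>) = sat R e' \<phi>"
proof (induction \<phi> arbitrary: n f e e')
  case (FEx \<phi>)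
  have "sat R (x # e) (rename (case_nat 0 (\<lambda>i. Suc (f i))) \<phi>) = sat R (x # e') \<phi>" for x
    using FEx.prems by (intro FEx.IH[of "Suc n"]) (auto split: nat.splits)
  then show ?case by simp
next
  case (FEq s t)
  then show ?case using tval_trename[of n _ e f e' R] by simp
next
  case (FAnd \<phi> \<chi>)
  show ?case using FAnd.prems FAnd.IH(1)[of n e f e'] FAnd.IH(2)[of n e f e'] by simp
qed auto

lemma tvars_below_trename:
  "tvars_below n t \<Longrightarrow> \<forall>i<n. f i < m \<Longrightarrow> tvars_below m (trename f t)"
  by (induction t) auto

lemma vars_below_rename:
  "vars_below n \<phi> \<Longrightarrow> \<forall>i<n. f i < m \<Longrightarrow> vars_below m (rename f \<phi>)"
proof (induction \<phi> arbitrary: n f m)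
  case (FEx \<phi>)
  show ?case
    using FEx.prems by (auto intro!: FEx.IH[of "Suc n"] split: nat.splits)
qed (auto intro: tvars_below_trename)

lemma trename_id: "trename (\<lambda>i. i) t = t"
  by (induction t) auto

lemma rename_id: "rename (\<lambda>i. i) \<phi> = \<phi>"
proof (induction \<phi>)
  case (FEx \<phi>)
  have "case_nat 0 (\<lambda>i. Suc i) = (\<lambda>i. i)" by (auto split: nat.splits)
  then show ?case using FEx by simp
qed (auto simp: trename_id)

lemma length_concat_blocks:
  "\<forall>b\<in>set bs. length b = n \<Longrightarrow> length (concat bs) = n * length bs"
  by (induction bs) auto

lemma nth_concat_blocks:
  "\<forall>b\<in>set bs. length b = n \<Longrightarrow> k < length bs \<Longrightarrow> j < n \<Longrightarrow> concat bs ! (n * k + j) = bs ! k ! j"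
proof (induction bs arbitrary: k)
  case (Cons b bs)
  then show ?case by (cases k) (auto simp: nth_append)
qed simp

lemma block_index: "i < n * m \<Longrightarrow> i div n < m \<and> i mod n < (n::nat)"
  by (metis gr_zeroI less_mult_imp_div_less mod_less_divisor mult.commute mult_0 not_less_zero)

lemma nth_concat_div_mod:
  assumes "\<forall>b\<in>set bs. length b = n" "i < n * length bs"
  shows "concat bs ! i = bs ! (i div n) ! (i mod n)"
  using nth_concat_blocks[OF assms(1), of "i div n" "i mod n"] block_index[OF assms(2)] by simp

text \<open>The renaming sends place \<open>j\<close> of argument \<open>a\<close> to place
  \<open>j\<close> of block \<open>ks ! a\<close>, and moves the parameters behind the last of all
  \<open>d\<close> blocks.\<close>

lemma sat_at_blocks:
  assumes "vars_below (n * length ks + length p) \<phi>" "\<forall>b\<in>set bs. length b = n"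
    "\<forall>k\<in>set ks. k < length bs" "length bs = d"
  shows "sat C (concat bs @ p) (at_blocks n d ks \<phi>) = sat C (concat (map ((!) bs) ks) @ p) \<phi>"
  unfolding at_blocks_def
proof (rule sat_rename[OF assms(1)], intro allI impI)
  fix i assume i: "i < n * length ks + length p"
  have len: "length (concat bs) = n * d" "length (concat (map ((!) bs) ks)) = n * length ks"
    using assms length_concat_blocks[of bs n] length_concat_blocks[of "map ((!) bs) ks" n] by auto
  show "(concat bs @ p) ! (if i < n * length ks then n * ks ! (i div n) + i mod n
          else n * d + (i - n * length ks)) = (concat (map ((!) bs) ks) @ p) ! i"
  proof (cases "i < n * length ks")
    case True
    note b = block_index[OF True]
    have k: "ks ! (i div n) < d" using b assms by auto
    have "n * ks ! (i div n) + i mod n < n * Suc (ks ! (i div n))" using b by simp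
    also have "\<dots> \<le> n * d" using k by (intro mult_le_mono2) simp
    finally have lt: "n * ks ! (i div n) + i mod n < n * d" .
    have "concat (map ((!) bs) ks) ! i = bs ! (ks ! (i div n)) ! (i mod n)"
      using nth_concat_div_mod[of "map ((!) bs) ks" n i] True b assms by auto
    moreover have "concat bs ! (n * ks ! (i div n) + i mod n) = bs ! (ks ! (i div n)) ! (i mod n)"
      using b assms k by (intro nth_concat_blocks) auto
    ultimately show ?thesis using True lt len by (simp add: nth_append)
  qed (use i len in \<open>auto simp: nth_append\<close>)
qed

lemma vars_below_at_blocks:
  assumes "vars_below (n * length ks + l) \<phi>" "\<forall>k\<in>set ks. k < d"
  shows "vars_below (n * d + l) (at_blocks n d ks \<phi>)"
  unfolding at_blocks_def
proof (rule vars_below_rename[OF assms(1)], intro allI impI)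
  fix i assume i: "i < n * length ks + l"
  show "(if i < n * length ks then n * ks ! (i div n) + i mod n
          else n * d + (i - n * length ks)) < n * d + l"
  proof (cases "i < n * length ks")
    case True
    note b = block_index[OF True]
    have k: "ks ! (i div n) < d" using b assms by auto
    have "n * ks ! (i div n) + i mod n < n * Suc (ks ! (i div n))" using b by simp
    also have "\<dots> \<le> n * d" using k by (intro mult_le_mono2) simp
    finally show ?thesis using True by simp
  qed (use i in auto)
qed

lemma sat_FEx_funpow:
  "sat R e ((FEx ^^ n) \<phi>) \<longleftrightarrow> (\<exists>xs\<in>tuples R n. sat R (xs @ e) \<phi>)"
proof (induction n arbitrary: \<phi>)
  case (Suc n)
  have "sat R e ((FEx ^^ Suc n) \<phi>) \<longleftrightarrow> sat R e ((FEx ^^ n) (FEx \<phi>))"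
    by (simp add: funpow_swap1)
  also have "\<dots> \<longleftrightarrow> (\<exists>xs\<in>tuples R n. \<exists>x\<in>carrier R. sat R ((x # xs) @ e) \<phi>)"
    unfolding Suc by simp
  also have "\<dots> \<longleftrightarrow> (\<exists>xs\<in>tuples R (Suc n). sat R (xs @ e) \<phi>)"
    unfolding Bex_def tuples_Suc by blast
  finally show ?case .
qed simp

lemma vars_below_FEx_funpow: "vars_below d ((FEx ^^ n) \<phi>) \<longleftrightarrow> vars_below (n + d) \<phi>"
  by (induction n arbitrary: d) auto

lemma sat_foldr_FAnd: "sat R e (foldr FAnd \<phi>s \<phi>) \<longleftrightarrow> (\<forall>\<chi>\<in>set \<phi>s. sat R e \<chi>) \<and> sat R e \<phi>"
  by (induction \<phi>s) auto

lemma vars_below_foldr_FAnd: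
  "vars_below d (foldr FAnd \<phi>s \<phi>) \<longleftrightarrow> (\<forall>\<chi>\<in>set \<phi>s. vars_below d \<chi>) \<and> vars_below d \<phi>"
  by (induction \<phi>s) auto

text \<open>Closure keeps every value of a term in the carrier, where a coordinate map provides a
  code for it.\<close>

definition closed_struct :: "('a, 'm) ring_scheme \<Rightarrow> bool" where
  "closed_struct R \<longleftrightarrow> \<zero>\<^bsub>R\<^esub> \<in> carrier R \<and> \<one>\<^bsub>R\<^esub> \<in> carrier R \<and>
     (\<forall>x\<in>carrier R. \<forall>y\<in>carrier R. x \<oplus>\<^bsub>R\<^esub> y \<in> carrier R \<and> x \<otimes>\<^bsub>R\<^esub> y \<in> carrier R)"

lemma tval_closed:
  "closed_struct R \<Longrightarrow> set e \<subseteq> carrier R \<Longrightarrow> tvars_below (length e) t \<Longrightarrow> tval R e t \<in> carrier R"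
  by (induction t) (auto simp: closed_struct_def)

text \<open>\<open>codes \<Gamma> B p A \<mu>\<close> is the working form of \<^const>\<open>coordinate_map\<close>: no quotients.\<close>

definition codes ::
  "rcode \<Rightarrow> ('b, 'm) ring_scheme \<Rightarrow> 'b list \<Rightarrow> ('a, 'n) ring_scheme \<Rightarrow> ('b list \<Rightarrow> 'a) \<Rightarrow> bool" where
  "codes \<Gamma> B p A \<mu> \<longleftrightarrow>
     \<mu> ` code_dom \<Gamma> B p = carrier A \<and>
     (\<forall>a\<in>code_dom \<Gamma> B p. sat B (a @ p) (czero \<Gamma>) \<longleftrightarrow> \<mu> a = \<zero>\<^bsub>A\<^esub>) \<and>
     (\<forall>a\<in>code_dom \<Gamma> B p. sat B (a @ p) (cone \<Gamma>) \<longleftrightarrow> \<mu> a = \<one>\<^bsub>A\<^esub>) \<and>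
     (\<forall>a\<in>code_dom \<Gamma> B p. \<forall>b\<in>code_dom \<Gamma> B p.
        sat B (a @ b @ p) (ceq \<Gamma>) \<longleftrightarrow> \<mu> a = \<mu> b) \<and>
     (\<forall>a\<in>code_dom \<Gamma> B p. \<forall>b\<in>code_dom \<Gamma> B p. \<forall>c\<in>code_dom \<Gamma> B p.
        sat B (a @ b @ c @ p) (cadd \<Gamma>) \<longleftrightarrow> \<mu> a \<oplus>\<^bsub>A\<^esub> \<mu> b = \<mu> c) \<and>
     (\<forall>a\<in>code_dom \<Gamma> B p. \<forall>b\<in>code_dom \<Gamma> B p. \<forall>c\<in>code_dom \<Gamma> B p.
        sat B (a @ b @ c @ p) (cmul \<Gamma>) \<longleftrightarrow> \<mu> a \<otimes>\<^bsub>A\<^esub> \<mu> b = \<mu> c)"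

lemma codesD:
  assumes "codes \<Gamma> B p A \<mu>"
  shows "\<mu> ` code_dom \<Gamma> B p = carrier A"
    and "a \<in> code_dom \<Gamma> B p \<Longrightarrow> sat B (a @ p) (czero \<Gamma>) \<longleftrightarrow> \<mu> a = \<zero>\<^bsub>A\<^esub>"
    and "a \<in> code_dom \<Gamma> B p \<Longrightarrow> sat B (a @ p) (cone \<Gamma>) \<longleftrightarrow> \<mu> a = \<one>\<^bsub>A\<^esub>"
    and "a \<in> code_dom \<Gamma> B p \<Longrightarrow> b \<in> code_dom \<Gamma> B p \<Longrightarrow>
          sat B (a @ b @ p) (ceq \<Gamma>) \<longleftrightarrow> \<mu> a = \<mu> b"
    and "a \<in> code_dom \<Gamma> B p \<Longrightarrow> b \<in> code_dom \<Gamma> B p \<Longrightarrow> c \<in> code_dom \<Gamma> B p \<Longrightarrow>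
          sat B (a @ b @ c @ p) (cadd \<Gamma>) \<longleftrightarrow> \<mu> a \<oplus>\<^bsub>A\<^esub> \<mu> b = \<mu> c"
    and "a \<in> code_dom \<Gamma> B p \<Longrightarrow> b \<in> code_dom \<Gamma> B p \<Longrightarrow> c \<in> code_dom \<Gamma> B p \<Longrightarrow>
          sat B (a @ b @ c @ p) (cmul \<Gamma>) \<longleftrightarrow> \<mu> a \<otimes>\<^bsub>A\<^esub> \<mu> b = \<mu> c"
  using assms unfolding codes_def by simp_all

lemma codes_mem: "codes \<Gamma> B p A \<mu> \<Longrightarrow> a \<in> code_dom \<Gamma> B p \<Longrightarrow> \<mu> a \<in> carrier A"
  using codesD(1) by blast

text \<open>The classes of \<open>code_rel\<close> are the fibres of \<mu>, so the quotient is the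
  family of fibres over \<open>carrier A\<close>, and \<open>h\<close> sends a fibre to the single
  value that \<mu> takes on it. Each formula of the code thus defines the corresponding operation of
  \<open>A\<close> on fibres.\<close>

lemma codes_coordinate_map:
  assumes c: "codes \<Gamma> B p A \<mu>" and A: "closed_struct A"
  shows "coordinate_map \<Gamma> B p A \<mu>"
proof -
  let ?D = "code_dom \<Gamma> B p" and ?R = "code_rel \<Gamma> B p" and ?Q = "code_quot \<Gamma> B p"
  define fib where "fib y = {a \<in> ?D. \<mu> a = y}" for y
  define h where "h X = (THE y. \<mu> ` X = {y})" for X
  note [simp] = codesD(2-6)[OF c]
  have rel: "?R = {(a, b). a \<in> ?D \<and> b \<in> ?D \<and> \<mu> a = \<mu> b}"
    by (auto simp: code_rel_def)
  have cls: "?R `` {a} = fib (\<mu> a)" if "a \<in> ?D" for a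
    using that by (auto simp: rel fib_def)
  have quot: "?Q = fib ` carrier A"
  proof -
    have "?Q = (\<lambda>a. ?R `` {a}) ` ?D" by (auto simp: code_quot_def quotient_def)
    also have "\<dots> = fib ` \<mu> ` ?D" unfolding image_image by (intro image_cong) (simp_all add: cls)
    finally show ?thesis by (simp add: codesD(1)[OF c])
  qed
  have ne: "\<exists>a\<in>?D. \<mu> a = y" if "y \<in> carrier A" for y
    using that codesD(1)[OF c] by (metis imageE)
  have h: "h (fib y) = y" if "y \<in> carrier A" for y
  proof -
    have "\<mu> ` fib y = {y}" using ne[OF that] by (auto simp: fib_def)
    then show ?thesis by (simp add: h_def)
  qed
  have fib_eq: "fib y = fib z \<longleftrightarrow> y = z" if "y \<in> carrier A" "z \<in> carrier A" for y z
    using h that by metis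
  have eq: "equiv ?D ?R"
    by (rule equivI) (auto simp: rel refl_on_def sym_def trans_def)
  have dc: "defines_const \<Gamma> B p \<phi>" "quot_const \<Gamma> B p \<phi> = fib y"
    if y: "y \<in> carrier A" and \<phi>: "\<And>a. a \<in> ?D \<Longrightarrow> sat B (a @ p) \<phi> \<longleftrightarrow> \<mu> a = y" for \<phi> y
  proof -
    show "defines_const \<Gamma> B p \<phi>"
      unfolding defines_const_def quot using y \<phi> by (auto simp: fib_def)
    show "quot_const \<Gamma> B p \<phi> = fib y" unfolding quot_const_def quot
    proof (rule the_equality)
      show "fib y \<in> fib ` carrier A \<and> (\<exists>c\<in>fib y. sat B (c @ p) \<phi>)"
        using y \<phi> ne[OF y] by (auto simp: fib_def)
    qed (auto simp: fib_def \<phi>)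
  qed
  have db: "defines_binop \<Gamma> B p \<phi>"
      "\<And>x y. x \<in> carrier A \<Longrightarrow> y \<in> carrier A \<Longrightarrow> quot_binop \<Gamma> B p \<phi> (fib x) (fib y) = fib (op x y)"
    if op: "\<And>x y. x \<in> carrier A \<Longrightarrow> y \<in> carrier A \<Longrightarrow> op x y \<in> carrier A"
      and \<phi>: "\<And>a b c. a \<in> ?D \<Longrightarrow> b \<in> ?D \<Longrightarrow> c \<in> ?D \<Longrightarrow>
            sat B (a @ b @ c @ p) \<phi> \<longleftrightarrow> op (\<mu> a) (\<mu> b) = \<mu> c" for \<phi> op
  proof -
    show "defines_binop \<Gamma> B p \<phi>"
      unfolding defines_binop_def quot
    proof (intro ballI, elim imageE)
      fix X Y x y assume xy: "X = fib x" "x \<in> carrier A" "Y = fib y" "y \<in> carrier A"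
      show "\<exists>Z\<in>fib ` carrier A. \<forall>a\<in>X. \<forall>b\<in>Y. \<forall>c\<in>?D. sat B (a @ b @ c @ p) \<phi> = (c \<in> Z)"
        by (rule bexI[of _ "fib (op x y)"]) (use xy op \<phi> in \<open>auto simp: fib_def\<close>)
    qed
    fix x y assume xy: "x \<in> carrier A" "y \<in> carrier A"
    show "quot_binop \<Gamma> B p \<phi> (fib x) (fib y) = fib (op x y)"
      unfolding quot_binop_def quot
    proof (rule the_equality)
      obtain a b c where "a \<in> ?D" "b \<in> ?D" "c \<in> ?D" "\<mu> a = x" "\<mu> b = y" "\<mu> c = op x y"
        using ne xy op by metis
      then show "fib (op x y) \<in> fib ` carrier A \<and>
          (\<exists>a\<in>fib x. \<exists>b\<in>fib y. \<exists>c\<in>fib (op x y). sat B (a @ b @ c @ p) \<phi>)"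
        using xy op \<phi> by (auto simp: fib_def)
    qed (auto simp: fib_def \<phi>)
  qed
  have zc: "\<zero>\<^bsub>A\<^esub> \<in> carrier A" "\<one>\<^bsub>A\<^esub> \<in> carrier A"
    and opc: "\<And>x y. x \<in> carrier A \<Longrightarrow> y \<in> carrier A \<Longrightarrow> x \<oplus>\<^bsub>A\<^esub> y \<in> carrier A"
      "\<And>x y. x \<in> carrier A \<Longrightarrow> y \<in> carrier A \<Longrightarrow> x \<otimes>\<^bsub>A\<^esub> y \<in> carrier A"
    using A by (auto simp: closed_struct_def)
  have "code_defined \<Gamma> B p"
    unfolding code_defined_def
    using eq dc(1)[OF zc(1), of "czero \<Gamma>"] dc(1)[OF zc(2), of "cone \<Gamma>"]
      db(1)[of "add A" "cadd \<Gamma>"] db(1)[of "mult A" "cmul \<Gamma>"] opc by simp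
  moreover have "h \<in> struct_iso (interp \<Gamma> B p) A"
  proof -
    have "bij_betw h (fib ` carrier A) (carrier A)"
      unfolding bij_betw_def
      by (auto simp: inj_on_def h image_image)
    moreover have "h (quot_const \<Gamma> B p (czero \<Gamma>)) = \<zero>\<^bsub>A\<^esub>" "h (quot_const \<Gamma> B p (cone \<Gamma>)) = \<one>\<^bsub>A\<^esub>"
      using dc(2)[OF zc(1), of "czero \<Gamma>"] dc(2)[OF zc(2), of "cone \<Gamma>"] h zc by simp_all
    moreover have "h (quot_binop \<Gamma> B p (cadd \<Gamma>) (fib x) (fib y)) = x \<oplus>\<^bsub>A\<^esub> y"
      "h (quot_binop \<Gamma> B p (cmul \<Gamma>) (fib x) (fib y)) = x \<otimes>\<^bsub>A\<^esub> y"
      if "x \<in> carrier A" "y \<in> carrier A" for x y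
      using db(2)[of "add A" "cadd \<Gamma>"] db(2)[of "mult A" "cmul \<Gamma>"] opc h that by simp_all
    ultimately show ?thesis
      by (auto simp: struct_iso_def ring_iso_def ring_hom_def interp_def quot h)
  qed
  ultimately show ?thesis
    unfolding coordinate_map_def using codesD(1)[OF c]
    by (auto intro!: bexI[of _ h] simp: cls h codes_mem[OF c])
qed

text \<open>With a coordinate map \<nu> of a code of \<open>B\<close> in \<open>C\<close> fixed, a
  list of elements of \<open>B\<close> is represented by a list \<open>bs\<close> of blocks from
  \<open>elems\<close>, in the environment \<open>concat bs @ p\<close>.\<close>

locale coded =
  fixes \<Delta> :: rcode and C :: "('c, 'm) ring_scheme" and p :: "'c list"
    and B :: "('b, 'n) ring_scheme" and \<nu> :: "'c list \<Rightarrow> 'b"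
  assumes codes: "codes \<Delta> C p B \<nu>" and wf: "wf_rcode \<Delta>" and lp: "length p = cpar \<Delta>"
    and closed: "closed_struct B"
begin

abbreviation "elems \<equiv> code_dom \<Delta> C p"

lemma dom_length: "b \<in> elems \<Longrightarrow> length b = cdim \<Delta>"
  by (auto simp: code_dom_def tuples_def)

lemma dom_length_all: "set bs \<subseteq> elems \<Longrightarrow> \<forall>b\<in>set bs. length b = cdim \<Delta>"
  using dom_length by auto

lemma sat_at_block:
  assumes "set bs \<subseteq> elems" "length bs = d" "k < d" "vars_below (cdim \<Delta> + cpar \<Delta>) \<phi>"
  shows "sat C (concat bs @ p) (at_blocks (cdim \<Delta>) d [k] \<phi>) = sat C (bs ! k @ p) \<phi>"
  using sat_at_blocks[of "cdim \<Delta>" "[k]" p \<phi> bs d C] assms lp dom_length_all by simp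

lemma sat_at_block2:
  assumes "set bs \<subseteq> elems" "length bs = d" "k < d" "l < d" "vars_below (2 * cdim \<Delta> + cpar \<Delta>) \<phi>"
  shows "sat C (concat bs @ p) (at_blocks (cdim \<Delta>) d [k, l] \<phi>) = sat C (bs ! k @ bs ! l @ p) \<phi>"
  using sat_at_blocks[of "cdim \<Delta>" "[k, l]" p \<phi> bs d C] assms lp dom_length_all
  by (simp add: mult_2)

lemma sat_at_block3:
  assumes "set bs \<subseteq> elems" "length bs = d" "k < d" "l < d" "m < d"
    "vars_below (3 * cdim \<Delta> + cpar \<Delta>) \<phi>"
  shows "sat C (concat bs @ p) (at_blocks (cdim \<Delta>) d [k, l, m] \<phi>) =
    sat C (bs ! k @ bs ! l @ bs ! m @ p) \<phi>"
  using sat_at_blocks[of "cdim \<Delta>" "[k, l, m]" p \<phi> bs d C] assms lp dom_length_all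
  by (simp add: numeral_3_eq_3 add.assoc)

lemma nth_dom: "set bs \<subseteq> elems \<Longrightarrow> k < length bs \<Longrightarrow> bs ! k \<in> elems"
  by auto

lemma sat_ex_block:
  assumes bs: "set bs \<subseteq> elems" "Suc (length bs) = d"
  shows "sat C (concat bs @ p) (ex_block \<Delta> d \<phi>) \<longleftrightarrow> (\<exists>b\<in>elems. sat C (concat (b # bs) @ p) \<phi>)"
proof -
  have "sat C (concat (b # bs) @ p) (at_blocks (cdim \<Delta>) d [0] (cdom \<Delta>)) \<longleftrightarrow> b \<in> elems"
    if b: "b \<in> tuples C (cdim \<Delta>)" for b
    using sat_at_blocks[of "cdim \<Delta>" "[0]" p "cdom \<Delta>" "b # bs" d C] bs b wf lp
      dom_length_all[OF bs(1)]
    by (simp add: wf_rcode_def code_dom_def tuples_length)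
  moreover have "b \<in> tuples C (cdim \<Delta>)" if "b \<in> elems" for b
    using that by (simp add: code_dom_def)
  ultimately show ?thesis
    unfolding ex_block_def sat_FEx_funpow by auto
qed

lemma ex_code: "y \<in> carrier B \<Longrightarrow> \<exists>b\<in>elems. \<nu> b = y"
  using codesD(1)[OF codes] by (metis imageE)

lemma map_carrier: "set bs \<subseteq> elems \<Longrightarrow> set (map \<nu> bs) \<subseteq> carrier B"
  using codes_mem[OF codes] by auto

text \<open>A compound term quantifies two blocks for the values of its arguments. Closure of
  \<open>B\<close> and surjectivity of \<nu> supply such blocks, and the formula depends on them
  only through \<nu>.\<close>

lemma sat_translate_val:
  assumes "set bs \<subseteq> elems" "length bs = d" "j \<le> d" "k < d" "tvars_below (d - j) t"
  shows "sat C (concat bs @ p) (translate_val \<Delta> d j t k) \<longleftrightarrow> tval B (map \<nu> (drop j bs)) t = \<nu> (bs ! k)"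
  using assms
proof (induction t arbitrary: bs d j k)
  case (TVar i)
  then show ?case
    using wf by (simp add: sat_at_block2 wf_rcode_def codesD(4)[OF codes] nth_dom add.commute)
next
  case TZero
  then show ?case using wf by (simp add: sat_at_block wf_rcode_def codesD(2)[OF codes] nth_dom) metis
next
  case TOne
  then show ?case using wf by (simp add: sat_at_block wf_rcode_def codesD(3)[OF codes] nth_dom) metis
next
  case (TAdd s t)
  let ?e = "map \<nu> (drop j bs)"
  have e: "set ?e \<subseteq> carrier B"
    using TAdd.prems(1) set_drop_subset[of j bs] by (intro map_carrier) blast
  have "length ?e = d - j" using TAdd.prems(2) by simp
  then have c: "tval B ?e s \<in> carrier B" "tval B ?e t \<in> carrier B"
    using tval_closed[OF closed e] TAdd.prems(5) by (metis tvars_below.simps(4))+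
  have "sat C (concat bs @ p) (translate_val \<Delta> d j (TAdd s t) k) \<longleftrightarrow>
     (\<exists>b\<in>elems. \<exists>a\<in>elems. tval B ?e s = \<nu> a \<and> tval B ?e t = \<nu> b \<and> \<nu> a \<oplus>\<^bsub>B\<^esub> \<nu> b = \<nu> (bs ! k))"
    using TAdd.prems wf
    by (simp del: concat.simps add: sat_ex_block TAdd.IH sat_at_block3 wf_rcode_def codesD(5)[OF codes] nth_dom
        cong: bex_cong)
  also have "\<dots> \<longleftrightarrow> tval B ?e (TAdd s t) = \<nu> (bs ! k)"
    unfolding tval.simps using ex_code[OF c(1)] ex_code[OF c(2)] by metis
  finally show ?case .
next
  case (TMul s t)
  let ?e = "map \<nu> (drop j bs)"
  have e: "set ?e \<subseteq> carrier B"
    using TMul.prems(1) set_drop_subset[of j bs] by (intro map_carrier) blast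
  have "length ?e = d - j" using TMul.prems(2) by simp
  then have c: "tval B ?e s \<in> carrier B" "tval B ?e t \<in> carrier B"
    using tval_closed[OF closed e] TMul.prems(5) by (metis tvars_below.simps(5))+
  have "sat C (concat bs @ p) (translate_val \<Delta> d j (TMul s t) k) \<longleftrightarrow>
     (\<exists>b\<in>elems. \<exists>a\<in>elems. tval B ?e s = \<nu> a \<and> tval B ?e t = \<nu> b \<and> \<nu> a \<otimes>\<^bsub>B\<^esub> \<nu> b = \<nu> (bs ! k))"
    using TMul.prems wf
    by (simp del: concat.simps add: sat_ex_block TMul.IH sat_at_block3 wf_rcode_def codesD(6)[OF codes] nth_dom
        cong: bex_cong)
  also have "\<dots> \<longleftrightarrow> tval B ?e (TMul s t) = \<nu> (bs ! k)"
    unfolding tval.simps using ex_code[OF c(1)] ex_code[OF c(2)] by metis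
  finally show ?case .
qed

text \<open>As \<nu> is onto \<open>B\<close>, a quantifier over \<open>B\<close> amounts to one
  over blocks in \<open>elems\<close>; an equation asks for a block that codes the common value of
  its two sides.\<close>

lemma sat_translate:
  assumes "set bs \<subseteq> elems" "length bs = d" "vars_below d \<phi>"
  shows "sat C (concat bs @ p) (translate \<Delta> d \<phi>) \<longleftrightarrow> sat B (map \<nu> bs) \<phi>"
  using assms
proof (induction \<phi> arbitrary: bs d)
  case (FEq s t)
  have c: "tval B (map \<nu> bs) s \<in> carrier B"
    using FEq.prems closed by (intro tval_closed map_carrier) auto
  have "sat C (concat bs @ p) (translate \<Delta> d (FEq s t)) \<longleftrightarrow>
    (\<exists>b\<in>elems. tval B (map \<nu> bs) s = \<nu> b \<and> tval B (map \<nu> bs) t = \<nu> b)"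
    using FEq.prems by (simp del: concat.simps add: sat_ex_block sat_translate_val cong: bex_cong)
  also have "\<dots> \<longleftrightarrow> sat B (map \<nu> bs) (FEq s t)" using ex_code[OF c] by simp metis
  finally show ?case .
next
  case (FEx \<phi>)
  have "sat C (concat bs @ p) (translate \<Delta> d (FEx \<phi>)) \<longleftrightarrow> (\<exists>b\<in>elems. sat B (\<nu> b # map \<nu> bs) \<phi>)"
    using FEx.prems by (simp del: concat.simps add: sat_ex_block FEx.IH cong: bex_cong)
  also have "\<dots> \<longleftrightarrow> sat B (map \<nu> bs) (FEx \<phi>)"
    using codesD(1)[OF codes] by (auto simp flip: codesD(1)[OF codes])
  finally show ?case .
qed auto

end

lemma vars_below_ex_block:
  assumes "wf_rcode \<Delta>" "vars_below (cdim \<Delta> * Suc d + cpar \<Delta>) \<phi>" "d' = Suc d"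
  shows "vars_below (cdim \<Delta> * d + cpar \<Delta>) (ex_block \<Delta> d' \<phi>)"
  using assms vars_below_at_blocks[of "cdim \<Delta>" "[0]" "cpar \<Delta>" "cdom \<Delta>" "Suc d"]
  by (simp add: ex_block_def vars_below_FEx_funpow wf_rcode_def algebra_simps)

lemma vars_below_translate_val:
  assumes "wf_rcode \<Delta>"
  shows "tvars_below (d - j) t \<Longrightarrow> j \<le> d \<Longrightarrow> k < d \<Longrightarrow>
    vars_below (cdim \<Delta> * d + cpar \<Delta>) (translate_val \<Delta> d j t k)"
proof (induction t arbitrary: d j k)
  case (TAdd s t)
  have *: "vars_below (cdim \<Delta> * Suc (Suc d) + cpar \<Delta>)
      (at_blocks (cdim \<Delta>) (Suc (Suc d)) [0, 1, Suc (Suc k)] (cadd \<Delta>))"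
    using TAdd.prems assms by (intro vars_below_at_blocks) (auto simp: wf_rcode_def numeral_3_eq_3 add.assoc)
  have **: "vars_below (cdim \<Delta> * Suc (Suc d) + cpar \<Delta>) (translate_val \<Delta> (Suc (Suc d)) (Suc (Suc j)) s 0)"
    "vars_below (cdim \<Delta> * Suc (Suc d) + cpar \<Delta>) (translate_val \<Delta> (Suc (Suc d)) (Suc (Suc j)) t 1)"
    using TAdd.prems by (auto intro!: TAdd.IH simp del: mult_Suc_right)
  show ?case
    using * ** assms by (simp del: mult_Suc_right add: vars_below_ex_block)
next
  case (TMul s t)
  have *: "vars_below (cdim \<Delta> * Suc (Suc d) + cpar \<Delta>)
      (at_blocks (cdim \<Delta>) (Suc (Suc d)) [0, 1, Suc (Suc k)] (cmul \<Delta>))"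
    using TMul.prems assms by (intro vars_below_at_blocks) (auto simp: wf_rcode_def numeral_3_eq_3 add.assoc)
  have **: "vars_below (cdim \<Delta> * Suc (Suc d) + cpar \<Delta>) (translate_val \<Delta> (Suc (Suc d)) (Suc (Suc j)) s 0)"
    "vars_below (cdim \<Delta> * Suc (Suc d) + cpar \<Delta>) (translate_val \<Delta> (Suc (Suc d)) (Suc (Suc j)) t 1)"
    using TMul.prems by (auto intro!: TMul.IH simp del: mult_Suc_right)
  show ?case
    using * ** assms by (simp del: mult_Suc_right add: vars_below_ex_block)
qed (use assms in \<open>auto intro!: vars_below_at_blocks simp: wf_rcode_def mult_2\<close>)

lemma vars_below_translate:
  assumes "wf_rcode \<Delta>"
  shows "vars_below d \<phi> \<Longrightarrow> vars_below (cdim \<Delta> * d + cpar \<Delta>) (translate \<Delta> d \<phi>)"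
  by (induction \<phi> arbitrary: d)
    (use assms in \<open>auto simp del: mult_Suc_right intro!: vars_below_ex_block vars_below_translate_val\<close>)

section \<open>Composite codes and their coordinate maps\<close>

lemma wf_code_comp:
  assumes \<Gamma>: "wf_rcode \<Gamma>" and \<Delta>: "wf_rcode \<Delta>"
  shows "wf_rcode (code_comp \<Gamma> \<Delta>)"
proof -
  let ?n = "cdim \<Gamma>" and ?l = "cpar \<Gamma>"
  note t = vars_below_translate[OF \<Delta>]
  have "vars_below (cdim \<Delta> * (?n + ?l) + cpar \<Delta>)
      (blocks_in_dom \<Delta> (?n + ?l) ?n (translate \<Delta> (?n + ?l) (cdom \<Gamma>)))"
    unfolding blocks_in_dom_def vars_below_foldr_FAnd
    using \<Gamma> \<Delta> by (auto intro!: t vars_below_at_blocks simp: wf_rcode_def)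
  moreover have e: "m * (?n * cdim \<Delta>) + (?l * cdim \<Delta> + cpar \<Delta>) = cdim \<Delta> * (m * ?n + ?l) + cpar \<Delta>"
    "?n * cdim \<Delta> + (?l * cdim \<Delta> + cpar \<Delta>) = cdim \<Delta> * (?n + ?l) + cpar \<Delta>" for m
    by (simp_all add: algebra_simps)
  ultimately show ?thesis
    using \<Gamma> t[of "?n + ?l" "czero \<Gamma>"] t[of "?n + ?l" "cone \<Gamma>"] t[of "2 * ?n + ?l" "ceq \<Gamma>"]
      t[of "3 * ?n + ?l" "cadd \<Gamma>"] t[of "3 * ?n + ?l" "cmul \<Gamma>"]
    by (simp add: wf_rcode_def code_comp_def Let_def e)
qed

text \<open>Inverse to \<open>concat\<close> on lists of \<open>m\<close> blocks of length
  \<open>n\<close>: it recovers the blocks from an element of a composite domain.\<close>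

definition chunks :: "nat \<Rightarrow> nat \<Rightarrow> 'a list \<Rightarrow> 'a list list" where
  "chunks n m a = map (\<lambda>i. take n (drop (n * i) a)) [0..<m]"

lemma chunks_0 [simp]: "chunks n 0 a = []"
  by (simp add: chunks_def)

lemma chunks_Suc: "chunks n (Suc m) a = take n a # chunks n m (drop n a)"
  unfolding chunks_def upt_conv_Cons[OF zero_less_Suc] map_Suc_upt[symmetric]
  by (simp add: comp_def add.commute)

lemma length_chunks [simp]: "length (chunks n m a) = m"
  by (simp add: chunks_def)

lemma concat_chunks: "length a = n * m \<Longrightarrow> concat (chunks n m a) = a"
  by (induction m arbitrary: a) (simp_all add: chunks_Suc)

lemma chunks_concat: "\<forall>b\<in>set bs. length b = n \<Longrightarrow> length bs = m \<Longrightarrow> chunks n m (concat bs) = bs"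
  by (induction bs arbitrary: m) (auto simp: chunks_Suc)

lemma set_chunks:
  "a \<in> tuples R (n * m) \<Longrightarrow> set (chunks n m a) \<subseteq> tuples R n"
proof (induction m arbitrary: a)
  case (Suc m)
  have "take n a \<in> tuples R n" "drop n a \<in> tuples R (n * m)"
    using Suc.prems by (auto simp: tuples_def dest: in_set_takeD in_set_dropD)
  then show ?case using Suc.IH by (simp add: chunks_Suc)
qed simp

lemma concat_tuples: "set bs \<subseteq> tuples R n \<Longrightarrow> length bs = m \<Longrightarrow> concat bs \<in> tuples R (m * n)"
  by (induction bs arbitrary: m) (auto simp: tuples_append)

context coded
begin

text \<open>The blocks are arbitrary tuples here rather than members of \<open>elems\<close>, since
  membership is what the formula tests.\<close>

lemma sat_blocks_in_dom:
  assumes bs: "set bs \<subseteq> tuples C (cdim \<Delta>)" "length bs = d" "m \<le> d"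
  shows "sat C (concat bs @ p) (blocks_in_dom \<Delta> d m \<phi>) \<longleftrightarrow>
    (\<forall>k<m. bs ! k \<in> elems) \<and> sat C (concat bs @ p) \<phi>"
proof -
  have len: "\<forall>b\<in>set bs. length b = cdim \<Delta>"
    using bs by (auto simp: tuples_length)
  have "sat C (concat bs @ p) (at_blocks (cdim \<Delta>) d [k] (cdom \<Delta>)) \<longleftrightarrow> bs ! k \<in> elems"
    if "k < m" for k
  proof -
    have "bs ! k \<in> tuples C (cdim \<Delta>)" using that bs by auto
    then show ?thesis
      using sat_at_blocks[of "cdim \<Delta>" "[k]" p "cdom \<Delta>" bs d C] that len bs wf lp
      by (simp add: wf_rcode_def code_dom_def)
  qed
  then show ?thesis by (auto simp: blocks_in_dom_def sat_foldr_FAnd)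
qed

text \<open>Every tuple of the right length splits into blocks by \<open>chunks\<close>; once the
  blocks are known to be in \<open>elems\<close>, \<open>sat_translate\<close> turns the translated
  domain formula back into that of \<Gamma>.\<close>

lemma code_dom_code_comp:
  assumes \<Gamma>: "wf_rcode \<Gamma>"
    and rs: "set rs \<subseteq> elems" "length rs = cpar \<Gamma>" "q = map \<nu> rs"
  shows "code_dom (code_comp \<Gamma> \<Delta>) C (concat rs @ p) =
    concat ` {bs. set bs \<subseteq> elems \<and> map \<nu> bs \<in> code_dom \<Gamma> B q}"
proof -
  let ?n = "cdim \<Gamma>" and ?l = "cpar \<Gamma>"
  let ?D = "code_dom (code_comp \<Gamma> \<Delta>) C (concat rs @ p)"
  let ?BS = "{bs. set bs \<subseteq> elems \<and> map \<nu> bs \<in> code_dom \<Gamma> B q}"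
  have dom_tuples: "elems \<subseteq> tuples C (cdim \<Delta>)" by (auto simp: code_dom_def)
  have sat_dom: "concat bs \<in> ?D \<longleftrightarrow> bs \<in> ?BS"
    if bs: "set bs \<subseteq> tuples C (cdim \<Delta>)" "length bs = ?n" for bs
  proof -
    have "(\<forall>k<?n. (bs @ rs) ! k \<in> elems) \<longleftrightarrow> set bs \<subseteq> elems"
      using bs(2) by (simp add: subset_eq all_set_conv_all_nth nth_append)
    then have "concat bs \<in> ?D \<longleftrightarrow> set bs \<subseteq> elems \<and> sat C (concat (bs @ rs) @ p) (translate \<Delta> (?n + ?l) (cdom \<Gamma>))"
      using sat_blocks_in_dom[of "bs @ rs" "?n + ?l" ?n] rs bs dom_tuples concat_tuples[OF bs(1)]
      by (auto simp: code_dom_def code_comp_def Let_def)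
    also have "\<dots> \<longleftrightarrow> bs \<in> ?BS"
    proof -
      have "map \<nu> bs \<in> tuples B ?n" if "set bs \<subseteq> elems"
        using that bs(2) map_carrier[OF that] by (simp add: tuples_def)
      then show ?thesis
        using sat_translate[of "bs @ rs" "?n + ?l" "cdom \<Gamma>"] rs bs \<Gamma>
        by (auto simp: code_dom_def wf_rcode_def)
    qed
    finally show ?thesis .
  qed
  show ?thesis
  proof (intro equalityI subsetI)
    fix a assume a: "a \<in> ?D"
    then have t: "a \<in> tuples C (cdim \<Delta> * ?n)"
      by (simp add: code_dom_def code_comp_def Let_def mult.commute)
    then have c: "concat (chunks (cdim \<Delta>) ?n a) = a" by (simp add: concat_chunks tuples_length)
    have "chunks (cdim \<Delta>) ?n a \<in> ?BS"
      using sat_dom[of "chunks (cdim \<Delta>) ?n a"] set_chunks[OF t] a unfolding c by simp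
    then show "a \<in> concat ` ?BS" using c by (intro image_eqI) simp_all
  next
    fix a assume "a \<in> concat ` ?BS"
    then obtain bs where bs: "bs \<in> ?BS" "a = concat bs" by auto
    then have "set bs \<subseteq> tuples C (cdim \<Delta>)" "map \<nu> bs \<in> tuples B ?n"
      using dom_tuples by (auto simp: code_dom_def)
    moreover from this(2) have "length bs = ?n" using tuples_length by fastforce
    ultimately show "a \<in> ?D" using sat_dom[of bs] bs by simp
  qed
qed

text \<open>Coordinate maps compose: \<nu> decodes the blocks, and \<mu> the tuple obtained. The
  formulas of the composite are translations, so \<open>sat_translate\<close> reduces each condition
  to the one for \<Gamma>.\<close>

lemma codes_code_comp:
  fixes A :: "('a, 'k) ring_scheme"
  assumes \<Gamma>: "codes \<Gamma> B q A \<mu>" "wf_rcode \<Gamma>"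
    and rs: "set rs \<subseteq> elems" "length rs = cpar \<Gamma>" "q = map \<nu> rs"
  shows "codes (code_comp \<Gamma> \<Delta>) C (concat rs @ p) A (\<lambda>a. \<mu> (map \<nu> (chunks (cdim \<Delta>) (cdim \<Gamma>) a)))"
proof -
  let ?n = "cdim \<Gamma>" and ?l = "cpar \<Gamma>" and ?G = "code_comp \<Gamma> \<Delta>"
  let ?D = "code_dom ?G C (concat rs @ p)" and ?E = "code_dom \<Gamma> B q"
  define BS where "BS = {bs. set bs \<subseteq> elems \<and> map \<nu> bs \<in> ?E}"
  define w where "w a = map \<nu> (chunks (cdim \<Delta>) (cdim \<Gamma>) a)" for a
  have E_len: "length a = ?n" if "a \<in> ?E" for a
    using that by (auto simp: code_dom_def tuples_def)
  have BS_len: "length bs = ?n" if "bs \<in> BS" for bs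
    using that E_len[of "map \<nu> bs"] by (simp add: BS_def)
  have D: "?D = concat ` BS"
    unfolding BS_def by (rule code_dom_code_comp[OF \<Gamma>(2) rs])
  have w: "w (concat bs) = map \<nu> bs" if "bs \<in> BS" for bs
    using chunks_concat[of bs "cdim \<Delta>" ?n] dom_length_all[of bs] BS_len[OF that] that
    by (simp add: w_def BS_def)
  have wE: "w ` ?D = ?E"
  proof -
    have "?E \<subseteq> map \<nu> ` BS"
    proof
      fix e assume e: "e \<in> ?E"
      then have "set e \<subseteq> \<nu> ` elems"
        unfolding codesD(1)[OF codes] by (auto simp: code_dom_def tuples_def)
      then have "\<exists>bs. set bs \<subseteq> elems \<and> e = map \<nu> bs"
      proof (induction e)
        case (Cons x e)
        then obtain bs b where "set bs \<subseteq> elems" "e = map \<nu> bs" "b \<in> elems" "x = \<nu> b" by auto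
        then show ?case by (intro exI[of _ "b # bs"]) auto
      qed auto
      then show "e \<in> map \<nu> ` BS" using e by (auto simp: BS_def)
    qed
    moreover have "w ` ?D = map \<nu> ` BS" unfolding D image_image by (intro image_cong) (auto simp: w)
    ultimately show ?thesis by (auto simp: BS_def)
  qed
  have surj: "(\<lambda>a. \<mu> (w a)) ` ?D = carrier A"
    using codesD(1)[OF \<Gamma>(1)] by (simp flip: wE add: image_image)
  have tr1: "sat C (concat a @ concat rs @ p) (translate \<Delta> (?n + ?l) \<phi>) \<longleftrightarrow> sat B (map \<nu> a @ q) \<phi>"
    if "a \<in> BS" "vars_below (?n + ?l) \<phi>" for a \<phi>
    using sat_translate[of "a @ rs" "?n + ?l" \<phi>] that rs BS_len by (simp add: BS_def)
  have tr2: "sat C (concat a @ concat b @ concat rs @ p) (translate \<Delta> (2 * ?n + ?l) \<phi>) \<longleftrightarrow>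
      sat B (map \<nu> a @ map \<nu> b @ q) \<phi>"
    if "a \<in> BS" "b \<in> BS" "vars_below (2 * ?n + ?l) \<phi>" for a b \<phi>
    using sat_translate[of "a @ b @ rs" "2 * ?n + ?l" \<phi>] that rs BS_len by (simp add: BS_def)
  have tr3: "sat C (concat a @ concat b @ concat c @ concat rs @ p) (translate \<Delta> (3 * ?n + ?l) \<phi>) \<longleftrightarrow>
      sat B (map \<nu> a @ map \<nu> b @ map \<nu> c @ q) \<phi>"
    if "a \<in> BS" "b \<in> BS" "c \<in> BS" "vars_below (3 * ?n + ?l) \<phi>" for a b c \<phi>
    using sat_translate[of "a @ b @ c @ rs" "3 * ?n + ?l" \<phi>] that rs BS_len by (simp add: BS_def)
  have BE: "map \<nu> a \<in> ?E" if "a \<in> BS" for a using that by (simp add: BS_def)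
  note \<Gamma>wf = \<Gamma>(2)[unfolded wf_rcode_def]
  have "codes ?G C (concat rs @ p) A (\<lambda>a. \<mu> (w a))"
    unfolding codes_def surj unfolding D
    by (simp add: w tr1 tr2 tr3 \<Gamma>wf code_comp_def Let_def codesD[OF \<Gamma>(1)] BE)
  then show ?thesis by (simp add: w_def)
qed

end

section \<open>Definable relations\<close>

primrec tsubst :: "(nat \<Rightarrow> rterm) \<Rightarrow> rterm \<Rightarrow> rterm" where
  "tsubst \<sigma> (TVar i) = \<sigma> i"
| "tsubst \<sigma> TZero = TZero"
| "tsubst \<sigma> TOne = TOne"
| "tsubst \<sigma> (TAdd s t) = TAdd (tsubst \<sigma> s) (tsubst \<sigma> t)"
| "tsubst \<sigma> (TMul s t) = TMul (tsubst \<sigma> s) (tsubst \<sigma> t)"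

primrec fsubst :: "(nat \<Rightarrow> rterm) \<Rightarrow> rform \<Rightarrow> rform" where
  "fsubst \<sigma> (FEq s t) = FEq (tsubst \<sigma> s) (tsubst \<sigma> t)"
| "fsubst \<sigma> (FNot \<phi>) = FNot (fsubst \<sigma> \<phi>)"
| "fsubst \<sigma> (FAnd \<phi> \<psi>) = FAnd (fsubst \<sigma> \<phi>) (fsubst \<sigma> \<psi>)"
| "fsubst \<sigma> (FEx \<phi>) = FEx (fsubst (case_nat (TVar 0) (\<lambda>i. trename Suc (\<sigma> i))) \<phi>)"

lemma tval_Cons_trename_Suc: "tval R (x # e) (trename Suc t) = tval R e t"
  by (induction t) auto

lemma tvars_below_trename_Suc: "tvars_below n t \<Longrightarrow> tvars_below (Suc n) (trename Suc t)"
  by (induction t) auto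

lemma tval_tsubst:
  "tvars_below n t \<Longrightarrow> \<forall>i<n. tval R e (\<sigma> i) = e' ! i \<Longrightarrow> tval R e (tsubst \<sigma> t) = tval R e' t"
  by (induction t) auto

lemma sat_fsubst:
  "vars_below n \<phi> \<Longrightarrow> \<forall>i<n. tval R e (\<sigma> i) = e' ! i \<Longrightarrow> sat R e (fsubst \<sigma> \<phi>) = sat R e' \<phi>"
proof (induction \<phi> arbitrary: n \<sigma> e e')
  case (FEx \<phi>)
  have "sat R (x # e) (fsubst (case_nat (TVar 0) (\<lambda>i. trename Suc (\<sigma> i))) \<phi>) = sat R (x # e') \<phi>" for x
    using FEx.prems
    by (intro FEx.IH[of "Suc n"]) (auto simp: tval_Cons_trename_Suc split: nat.splits)
  then show ?case by simp
next
  case (FEq s t)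
  then show ?case using tval_tsubst[of n _ R e \<sigma> e'] by simp
next
  case (FAnd \<phi> \<chi>)
  show ?case using FAnd.prems FAnd.IH(1)[of n e \<sigma> e'] FAnd.IH(2)[of n e \<sigma> e'] by simp
next
  case (FNot \<phi>)
  show ?case using FNot.prems FNot.IH[of n e \<sigma> e'] by simp
qed

lemma tvars_below_tsubst:
  "tvars_below n t \<Longrightarrow> \<forall>i<n. tvars_below m (\<sigma> i) \<Longrightarrow> tvars_below m (tsubst \<sigma> t)"
  by (induction t) auto

lemma vars_below_fsubst:
  "vars_below n \<phi> \<Longrightarrow> \<forall>i<n. tvars_below m (\<sigma> i) \<Longrightarrow> vars_below m (fsubst \<sigma> \<phi>)"
proof (induction \<phi> arbitrary: n m \<sigma>)
  case (FEx \<phi>)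
  show ?case using FEx.prems
    by (auto intro!: FEx.IH[of "Suc n"] tvars_below_trename_Suc split: nat.splits)
next
  case (FNot \<phi>)
  show ?case using FNot.prems FNot.IH[of n m \<sigma>] by simp
next
  case (FAnd \<phi> \<chi>)
  show ?case using FAnd.prems FAnd.IH(1)[of n m \<sigma>] FAnd.IH(2)[of n m \<sigma>] by simp
next
  case (FEq s t)
  show ?case using FEq.prems tvars_below_tsubst[of n _ m \<sigma>] by simp
qed

text \<open>Definability is treated semantically: \<open>tdef\<close>, \<open>vdef\<close> and
  \<open>rdef\<close> assert a term, a tuple of terms or a formula that agrees with the given
  function or relation on all environments of length \<open>n\<close>. Formulas are then never
  written out; the closure rules follow the shape of the predicate.\<close>

definition tdef :: "('a, 'm) ring_scheme \<Rightarrow> nat \<Rightarrow> ('a list \<Rightarrow> 'a) \<Rightarrow> bool" where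
  "tdef R n F \<longleftrightarrow> (\<exists>t. tvars_below n t \<and> (\<forall>e\<in>tuples R n. tval R e t = F e))"

definition vdef :: "('a, 'm) ring_scheme \<Rightarrow> nat \<Rightarrow> nat \<Rightarrow> ('a list \<Rightarrow> 'a list) \<Rightarrow> bool" where
  "vdef R n m V \<longleftrightarrow> (\<forall>e\<in>tuples R n. length (V e) = m) \<and> (\<forall>i<m. tdef R n (\<lambda>e. V e ! i))"

definition rdef :: "('a, 'm) ring_scheme \<Rightarrow> nat \<Rightarrow> ('a list \<Rightarrow> bool) \<Rightarrow> bool" where
  "rdef R n P \<longleftrightarrow> (\<exists>\<phi>. vars_below n \<phi> \<and> (\<forall>e\<in>tuples R n. sat R e \<phi> = P e))"

lemma tdef_cong: "(\<And>e. e \<in> tuples R n \<Longrightarrow> F e = G e) \<Longrightarrow> tdef R n F = tdef R n G"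
  by (simp add: tdef_def)

lemma rdef_cong: "(\<And>e. e \<in> tuples R n \<Longrightarrow> P e = Q e) \<Longrightarrow> rdef R n P = rdef R n Q"
  by (simp add: rdef_def)

lemma tdef_hd: "tdef R (Suc n) (\<lambda>e. hd e)"
  unfolding tdef_def by (rule exI[of _ "TVar 0"]) (auto simp: tuples_Suc)

lemma tdef_tl: "tdef R n F \<Longrightarrow> tdef R (Suc n) (\<lambda>e. F (tl e))"
  unfolding tdef_def
  by (elim exE, rename_tac t, rule_tac x = "trename Suc t" in exI)
    (auto simp: tuples_Suc tval_Cons_trename_Suc tvars_below_trename_Suc)

lemma tdef_drop: "tdef R n F \<Longrightarrow> tdef R (m + n) (\<lambda>e. F (drop m e))"
proof (induction m)
  case (Suc m)
  then show ?case using tdef_tl[of R "m + n" "\<lambda>e. F (drop m e)"] by (simp add: drop_Suc)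
qed simp

lemma tdef_nth: "i < n \<Longrightarrow> tdef R n (\<lambda>e. e ! i)"
  unfolding tdef_def by (rule exI[of _ "TVar i"]) auto

lemma vdef_take: "vdef R (m + n) m (take m)"
  unfolding vdef_def by (auto simp: tuples_length intro: tdef_nth)

lemma vdef_tl: "vdef R n m V \<Longrightarrow> vdef R (Suc n) m (\<lambda>e. V (tl e))"
  unfolding vdef_def by (auto simp: tuples_Suc intro: tdef_tl[of R n "\<lambda>e. V e ! _"])

lemma vdef_drop: "vdef R n m V \<Longrightarrow> vdef R (l + n) m (\<lambda>e. V (drop l e))"
proof (induction l)
  case (Suc l)
  then show ?case using vdef_tl[of R "l + n" m "\<lambda>e. V (drop l e)"] by (simp add: drop_Suc)
qed simp

lemma vdef_id: "vdef R n n (\<lambda>e. e)"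
  unfolding vdef_def by (auto simp: tuples_length intro: tdef_nth)

lemma vdef_nth: "vdef R n m V \<Longrightarrow> i < m \<Longrightarrow> tdef R n (\<lambda>e. V e ! i)"
  by (simp add: vdef_def)

lemma vdef_Cons: "tdef R n F \<Longrightarrow> vdef R n m V \<Longrightarrow> vdef R n (Suc m) (\<lambda>e. F e # V e)"
  unfolding vdef_def
proof (intro conjI ballI allI impI)
  fix i assume F: "tdef R n F" "(\<forall>e\<in>tuples R n. length (V e) = m) \<and> (\<forall>i<m. tdef R n (\<lambda>e. V e ! i))"
    and "i < Suc m"
  then show "tdef R n (\<lambda>e. (F e # V e) ! i)" by (cases i) auto
qed auto

lemma vdef_append:
  assumes "vdef R n l V" "vdef R n m W"
  shows "vdef R n (l + m) (\<lambda>e. V e @ W e)"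
  unfolding vdef_def
proof (intro conjI ballI allI impI)
  fix i assume i: "i < l + m"
  show "tdef R n (\<lambda>e. (V e @ W e) ! i)"
  proof (cases "i < l")
    case True
    then show ?thesis using assms
      by (subst tdef_cong[where G = "\<lambda>e. V e ! i"]) (auto simp: vdef_def nth_append)
  next
    case False
    then show ?thesis using assms i
      by (subst tdef_cong[where G = "\<lambda>e. W e ! (i - l)"]) (auto simp: vdef_def nth_append)
  qed
qed (use assms in \<open>auto simp: vdef_def\<close>)

lemma tdef_zero: "tdef R n (\<lambda>e. \<zero>\<^bsub>R\<^esub>)"
  unfolding tdef_def by (rule exI[of _ TZero]) auto

lemma tdef_one: "tdef R n (\<lambda>e. \<one>\<^bsub>R\<^esub>)"
  unfolding tdef_def by (rule exI[of _ TOne]) auto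

lemma tdef_add: "tdef R n F \<Longrightarrow> tdef R n G \<Longrightarrow> tdef R n (\<lambda>e. F e \<oplus>\<^bsub>R\<^esub> G e)"
  unfolding tdef_def
  by (elim exE, rename_tac s t, rule_tac x = "TAdd s t" in exI) auto

lemma tdef_mult: "tdef R n F \<Longrightarrow> tdef R n G \<Longrightarrow> tdef R n (\<lambda>e. F e \<otimes>\<^bsub>R\<^esub> G e)"
  unfolding tdef_def
  by (elim exE, rename_tac s t, rule_tac x = "TMul s t" in exI) auto

lemma rdef_eq: "tdef R n F \<Longrightarrow> tdef R n G \<Longrightarrow> rdef R n (\<lambda>e. F e = G e)"
  unfolding tdef_def rdef_def
  by (elim exE, rename_tac s t, rule_tac x = "FEq s t" in exI) auto

lemma rdef_not: "rdef R n P \<Longrightarrow> rdef R n (\<lambda>e. \<not> P e)"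
  unfolding rdef_def
  by (elim exE, rename_tac s, rule_tac x = "FNot s" in exI) auto

lemma rdef_conj: "rdef R n P \<Longrightarrow> rdef R n Q \<Longrightarrow> rdef R n (\<lambda>e. P e \<and> Q e)"
  unfolding rdef_def
  by (elim exE, rename_tac s t, rule_tac x = "FAnd s t" in exI) auto

lemma rdef_imp: "rdef R n P \<Longrightarrow> rdef R n Q \<Longrightarrow> rdef R n (\<lambda>e. P e \<longrightarrow> Q e)"
  using rdef_not[OF rdef_conj[OF _ rdef_not, of R n P Q]] by simp

lemma rdef_iff: "rdef R n P \<Longrightarrow> rdef R n Q \<Longrightarrow> rdef R n (\<lambda>e. P e \<longleftrightarrow> Q e)"
  using rdef_conj[OF rdef_imp[of R n P Q] rdef_imp[of R n Q P]] by (simp add: iff_conv_conj_imp)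

text \<open>The quantified element is variable 0 of the longer environment. Writing it as
  \<open>hd e\<close> next to \<open>tl e\<close> lets the rule be applied by unification under
  nested quantifiers.\<close>

lemma rdef_ex:
  assumes "rdef R (Suc n) (\<lambda>e. P (hd e) (tl e))"
  shows "rdef R n (\<lambda>e. \<exists>x\<in>carrier R. P x e)"
proof -
  from assms obtain \<phi> where \<phi>: "vars_below (Suc n) \<phi>"
    "\<And>x e. x \<in> carrier R \<Longrightarrow> e \<in> tuples R n \<Longrightarrow> sat R (x # e) \<phi> = P x e"
    unfolding rdef_def by (auto simp: tuples_Suc)
  then show ?thesis unfolding rdef_def by (intro exI[of _ "FEx \<phi>"]) auto
qed

lemma rdef_all:
  assumes "rdef R (Suc n) (\<lambda>e. P (hd e) (tl e))"
  shows "rdef R n (\<lambda>e. \<forall>x\<in>carrier R. P x e)"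
  using rdef_not[OF rdef_ex[of R n "\<lambda>x e. \<not> P x e"]] rdef_not[OF assms] by simp

lemma rdef_ex_tuple:
  "rdef R (m + n) (\<lambda>e. P (take m e) (drop m e)) \<Longrightarrow> rdef R n (\<lambda>e. \<exists>s\<in>tuples R m. P s e)"
proof (induction m arbitrary: P)
  case 0
  then show ?case by simp
next
  case (Suc m)
  have "rdef R (Suc (m + n)) (\<lambda>e. P (hd e # take m (tl e)) (drop m (tl e)))"
    using Suc.prems by (subst rdef_cong[where Q = "\<lambda>e. P (take (Suc m) e) (drop (Suc m) e)"])
      (auto simp: tuples_Suc)
  then have "rdef R (m + n) (\<lambda>e. \<exists>x\<in>carrier R. P (x # take m e) (drop m e))"
    by (rule rdef_ex)
  then have "rdef R n (\<lambda>e. \<exists>s\<in>tuples R m. \<exists>x\<in>carrier R. P (x # s) e)"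
    by (rule Suc.IH)
  moreover have "(\<exists>s\<in>tuples R m. \<exists>x\<in>carrier R. P (x # s) e) \<longleftrightarrow> (\<exists>s\<in>tuples R (Suc m). P s e)" for e
    unfolding Bex_def tuples_Suc by blast
  ultimately show ?case by simp
qed

lemma rdef_all_tuple:
  assumes "rdef R (m + n) (\<lambda>e. P (take m e) (drop m e))"
  shows "rdef R n (\<lambda>e. \<forall>s\<in>tuples R m. P s e)"
  using rdef_not[OF rdef_ex_tuple[of R m n "\<lambda>x e. \<not> P x e"]] rdef_not[OF assms] by simp

text \<open>The bound is a fixed number, so this is a finite conjunction and not a quantifier of the
  structure.\<close>

lemma rdef_ball_lessThan:
  fixes k :: nat
  shows "(\<And>i. i < k \<Longrightarrow> rdef R n (P i)) \<Longrightarrow> rdef R n (\<lambda>e. \<forall>i<k. P i e)"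
proof (induction k)
  case 0
  then show ?case using rdef_eq[OF tdef_zero tdef_zero, of R n] by simp
next
  case (Suc k)
  have "rdef R n (\<lambda>e. (\<forall>i<k. P i e) \<and> P k e)" by (rule rdef_conj) (use Suc in auto)
  then show ?case by (simp add: less_Suc_eq all_conj_distrib conj_commute imp_conjL)
qed

text \<open>Terms that compute the entries of \<open>V e\<close> are substituted for the variables
  of \<phi>; this allows a given formula to be used as an atomic relation.\<close>

lemma rdef_sat:
  assumes "vars_below m \<phi>" "vdef R n m V"
  shows "rdef R n (\<lambda>e. sat R (V e) \<phi>)"
proof -
  have "\<forall>i<m. \<exists>t. tvars_below n t \<and> (\<forall>e\<in>tuples R n. tval R e t = V e ! i)"
    using assms(2) by (simp add: vdef_def tdef_def)
  then obtain \<sigma> where \<sigma>: "\<And>i. i < m \<Longrightarrow> tvars_below n (\<sigma> i)"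
    "\<And>i e. i < m \<Longrightarrow> e \<in> tuples R n \<Longrightarrow> tval R e (\<sigma> i) = V e ! i"
    by metis
  show ?thesis unfolding rdef_def
  proof (intro exI[of _ "fsubst \<sigma> \<phi>"] conjI ballI)
    show "vars_below n (fsubst \<sigma> \<phi>)" using vars_below_fsubst[OF assms(1)] \<sigma>(1) by blast
    show "sat R e (fsubst \<sigma> \<phi>) = sat R (V e) \<phi>" if "e \<in> tuples R n" for e
      using sat_fsubst[OF assms(1)] \<sigma>(2) that by blast
  qed
qed

section \<open>Arithmetic relations\<close>

text \<open>With \<open>z\<close> as common denominator, \<open>x\<close> is a sum of four rational
  squares. The condition is expressible in the language of rings and will define the order of the
  integers.\<close>

definition rat_four_squares :: "int \<Rightarrow> bool" where
  "rat_four_squares x \<longleftrightarrow> (\<exists>z a b c d. z \<noteq> 0 \<and> z * z * x = a * a + b * b + c * c + d * d)"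

lemma rat_four_squaresI: "z \<noteq> 0 \<Longrightarrow> z * z * x = a * a + b * b + c * c + d * d \<Longrightarrow> rat_four_squares x"
  unfolding rat_four_squares_def by blast

text \<open>Euler's four-square identity, that is, multiplicativity of the quaternion norm.\<close>

lemma rat_four_squares_mult: "rat_four_squares x \<Longrightarrow> rat_four_squares y \<Longrightarrow> rat_four_squares (x * y)"
proof -
  assume "rat_four_squares x" "rat_four_squares y"
  then obtain z a b c d z' a' b' c' d' where
    *: "z \<noteq> 0" "z * z * x = a * a + b * b + c * c + d * d"
    "z' \<noteq> 0" "z' * z' * y = a' * a' + b' * b' + c' * c' + d' * d'"
    unfolding rat_four_squares_def by blast
  have "(z * z') * (z * z') * (x * y) = (z * z * x) * (z' * z' * y)" by (simp add: algebra_simps)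
  also have "\<dots> = (a*a' + b*b' + c*c' + d*d') * (a*a' + b*b' + c*c' + d*d')
    + (a*b' - b*a' + c*d' - d*c') * (a*b' - b*a' + c*d' - d*c')
    + (a*c' - b*d' - c*a' + d*b') * (a*c' - b*d' - c*a' + d*b')
    + (a*d' + b*c' - c*b' - d*a') * (a*d' + b*c' - c*b' - d*a')"
    unfolding * by (simp add: algebra_simps)
  finally show ?thesis by (rule rat_four_squaresI[rotated]) (simp add: *(1,3))
qed

text \<open>Since x = (x y) y / y^2, the square y^2 can be absorbed into the denominator.\<close>

lemma rat_four_squares_cancel: "rat_four_squares (x * y) \<Longrightarrow> rat_four_squares y \<Longrightarrow> y \<noteq> 0 \<Longrightarrow> rat_four_squares x"
proof -
  assume "rat_four_squares (x * y)" "rat_four_squares y" and y: "y \<noteq> 0"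
  then have "rat_four_squares (x * y * y)" using rat_four_squares_mult[of "x * y" y] by simp
  then obtain z a b c d where z: "z \<noteq> 0" and "z * z * (x * y * y) = a * a + b * b + c * c + d * d"
    unfolding rat_four_squares_def by blast
  then have "(z * y) * (z * y) * x = a * a + b * b + c * c + d * d" by (simp only: ac_simps)
  then show ?thesis by (rule rat_four_squaresI[rotated]) (simp add: y z)
qed

text \<open>The prime divides a - b or a + b, and both have absolute value below p; if a + b = 0,
  then both numbers are 0.\<close>

lemma square_mod_inj:
  fixes p :: int
  assumes "prime p" "0 \<le> a" "2 * a < p" "0 \<le> b" "2 * b < p" "p dvd a * a - b * b"
  shows "a = b"
proof -
  have "p dvd (a - b) * (a + b)" using assms by (simp add: algebra_simps)
  then have "p dvd a - b \<or> p dvd a + b" using assms(1) by (simp add: prime_dvd_mult_iff)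
  then show ?thesis
  proof
    assume "p dvd a - b"
    then have "p dvd a - b" "p dvd b - a" by (simp_all add: dvd_diff_commute)
    then show ?thesis using assms zdvd_imp_le[of p "a - b"] zdvd_imp_le[of p "b - a"] by linarith
  next
    assume "p dvd a + b"
    then show ?thesis using assms zdvd_imp_le[of p "a + b"] by fastforce
  qed
qed

text \<open>Pigeonhole: for a and b between 0 and (p - 1) / 2, the numbers a^2 and likewise the
  numbers -1 - b^2 give (p + 1) / 2 distinct residues, too many for the two sets of residues to be
  disjoint.\<close>

lemma prime_dvd_sum_two_squares_1:
  fixes p :: int
  assumes p: "prime p" "odd p"
  shows "\<exists>a b m. 0 < m \<and> m < p \<and> a * a + b * b + 1 = m * p"
proof -
  define I where "I = {0..(p - 1) div 2}"
  define A where "A = (\<lambda>a. (a * a) mod p) ` I"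
  define B where "B = (\<lambda>b. (- 1 - b * b) mod p) ` I"
  have p2: "p > 2" using p prime_gt_1_int[of p] by (cases "p = 2") auto
  have I: "0 \<le> a" "2 * a < p" if "a \<in> I" for a using that by (auto simp: I_def)
  have inj: "inj_on (\<lambda>a. (a * a) mod p) I"
    using square_mod_inj[OF p(1)] I by (intro inj_onI) (metis mod_eq_dvd_iff)
  have inj': "inj_on (\<lambda>b. (- 1 - b * b) mod p) I"
  proof (rule inj_onI)
    fix a b assume ab: "a \<in> I" "b \<in> I" "(- 1 - a * a) mod p = (- 1 - b * b) mod p"
    then have "p dvd b * b - a * a" by (simp add: mod_eq_dvd_iff)
    then show "a = b" using square_mod_inj[OF p(1), of b a] I ab by metis
  qed
  have cI: "2 * int (card I) = p + 1"
    using p p2 by (auto simp: I_def elim!: oddE)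
  have "A \<inter> B \<noteq> {}"
  proof
    assume "A \<inter> B = {}"
    then have "card (A \<union> B) = card A + card B"
      by (intro card_Un_disjoint) (auto simp: A_def B_def I_def)
    also have "\<dots> = 2 * card I" using inj inj' by (simp add: A_def B_def card_image)
    finally have "int (card (A \<union> B)) = p + 1" using cI by simp
    moreover have "A \<union> B \<subseteq> {0..<p}" using p2 by (auto simp: A_def B_def)
    then have "card (A \<union> B) \<le> card {0..<p}" by (intro card_mono) auto
    ultimately show False using p2 by simp
  qed
  then obtain a b where ab: "a \<in> I" "b \<in> I" "(a * a) mod p = (- 1 - b * b) mod p"
    by (auto simp: A_def B_def)
  then have "p dvd a * a + b * b + 1" by (simp add: mod_eq_dvd_iff algebra_simps)
  then obtain m where m: "a * a + b * b + 1 = m * p" by (metis dvd_def mult.commute)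
  \<comment> \<open>The bound m < p comes from choosing a and b below p / 2: then 4 m p is at most 2
    (p - 1)^2 + 4.\<close>
  have le: "2 * a \<le> p - 1" "2 * b \<le> p - 1" "0 \<le> a" "0 \<le> b" using I[OF ab(1)] I[OF ab(2)] by auto
  have "(2 * a) * (2 * a) \<le> (p - 1) * (p - 1)" "(2 * b) * (2 * b) \<le> (p - 1) * (p - 1)"
    using le by (intro mult_mono; simp)+
  then have "4 * (m * p) \<le> 2 * ((p - 1) * (p - 1)) + 4" unfolding m[symmetric] by simp
  also have "\<dots> < 4 * (p * p)"
  proof -
    have "p * p > 0" using p2 by simp
    moreover have "2 * ((p - 1) * (p - 1)) + 4 = 2 * (p * p) - 4 * p + 6" by (simp add: algebra_simps)
    ultimately show ?thesis using p2 by linarith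
  qed
  finally have "m < p" using p2 by simp
  moreover have "m * p > 0" using m zero_le_square[of a] zero_le_square[of b] by linarith
  then have "m > 0" using p2 by (simp add: zero_less_mult_iff)
  ultimately show ?thesis using m by blast
qed

text \<open>Lagrange's theorem over the rationals, where no descent is needed: the factor \<open>m\<close> can
  be divided out.\<close>

lemma rat_four_squares_of_nat: "rat_four_squares (int n)"
proof (induction n rule: less_induct)
  case (less n)
  consider "n = 0" | "n = 1" | "n = 2" | "prime n" "odd n" | "n > 1" "\<not> prime n"
  proof -
    have "n = 0 \<or> n = 1 \<or> n > 1" "prime n \<Longrightarrow> n = 2 \<or> odd n"
      using prime_odd_nat[of n] prime_ge_2_nat[of n] by force+
    then show ?thesis using that by blast
  qed
  then show ?case
  proof cases
    assume "n = 0" then show ?thesis using rat_four_squaresI[of 1 0 0 0 0 0] by simp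
  next
    assume "n = 1" then show ?thesis using rat_four_squaresI[of 1 1 1 0 0 0] by simp
  next
    assume "n = 2" then show ?thesis using rat_four_squaresI[of 1 2 1 1 0 0] by simp
  next
    assume n: "prime n" "odd n"
    then obtain a b m where m: "0 < m" "m < int n" "a * a + b * b + 1 = m * int n"
      using prime_dvd_sum_two_squares_1[of "int n"] by auto
    have 1: "rat_four_squares m" using less.IH[of "nat m"] m by simp
    have "1 * 1 * (int n * m) = a * a + b * b + 1 * 1 + 0 * 0" using m(3) by simp
    then have 2: "rat_four_squares (int n * m)" by (rule rat_four_squaresI[rotated]) simp
    show ?thesis using rat_four_squares_cancel[OF 2 1] m(1) by simp
  next
    assume n: "n > 1" "\<not> prime n"
    obtain q where q: "prime q" "q dvd n" using n prime_factor_nat[of n] by auto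
    then obtain r where r: "n = q * r" by blast
    have "q \<le> n" "q \<noteq> n" using q n by (auto intro: dvd_imp_le)
    moreover have "1 * r < q * r"
      using r n prime_gt_1_nat[OF q(1)] by (intro mult_strict_right_mono) auto
    then have "r < n" using r by simp
    ultimately have "rat_four_squares (int q)" "rat_four_squares (int r)" using less.IH by auto
    then show ?thesis using rat_four_squares_mult r by simp
  qed
qed

lemma nonneg_iff_rat_four_squares: "0 \<le> x \<longleftrightarrow> rat_four_squares x"
proof
  assume "0 \<le> x" then show "rat_four_squares x" using rat_four_squares_of_nat[of "nat x"] by simp
next
  assume "rat_four_squares x"
  then obtain z a b c d where "z \<noteq> 0" and e: "z * z * x = a * a + b * b + c * c + d * d"
    unfolding rat_four_squares_def by blast
  have "0 \<le> z * z * x" unfolding e by simp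
  moreover have "0 < z * z" using \<open>z \<noteq> 0\<close> by (auto simp: zero_less_mult_iff)
  ultimately show "0 \<le> x" by (simp add: zero_le_mult_iff)
qed

section \<open>Definability of order, remainders and the beta function over the integers\<close>

lemma tdefZ_zero: "tdef \<Z> n (\<lambda>e. 0)"
  using tdef_zero[of \<Z> n] by simp

lemma tdefZ_one: "tdef \<Z> n (\<lambda>e. 1)"
  using tdef_one[of \<Z> n] by simp

lemma tdefZ_add: "tdef \<Z> n F \<Longrightarrow> tdef \<Z> n G \<Longrightarrow> tdef \<Z> n (\<lambda>e. F e + G e)"
  using tdef_add[of \<Z> n F G] by simp

lemma tdefZ_mult: "tdef \<Z> n F \<Longrightarrow> tdef \<Z> n G \<Longrightarrow> tdef \<Z> n (\<lambda>e. F e * G e)"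
  using tdef_mult[of \<Z> n F G] by simp

lemma tdefZ_int: "tdef \<Z> n (\<lambda>e. int m)"
proof (induction m)
  case (Suc m)
  then show ?case using tdefZ_add[OF Suc tdefZ_one] by (simp add: add.commute)
qed (simp add: tdefZ_zero)

lemma rdefZ_ex: "rdef \<Z> (Suc n) (\<lambda>e. P (hd e) (tl e)) \<Longrightarrow> rdef \<Z> n (\<lambda>e. \<exists>x. P x e)"
  using rdef_ex[of \<Z> n P] by simp

lemma rdefZ_all: "rdef \<Z> (Suc n) (\<lambda>e. P (hd e) (tl e)) \<Longrightarrow> rdef \<Z> n (\<lambda>e. \<forall>x. P x e)"
  using rdef_all[of \<Z> n P] by simp

lemmas tdefZ_intros = tdef_hd tdefZ_int tdefZ_zero tdefZ_one tdefZ_add tdefZ_mult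

lemma rdefZ_nonneg:
  assumes "tdef \<Z> n F"
  shows "rdef \<Z> n (\<lambda>e. 0 \<le> F e)"
  unfolding nonneg_iff_rat_four_squares rat_four_squares_def
  by (rule rdefZ_ex rdef_conj rdef_not rdef_eq tdefZ_intros tdef_tl assms)+

lemma rdefZ_le:
  assumes "tdef \<Z> n F" "tdef \<Z> n G"
  shows "rdef \<Z> n (\<lambda>e. F e \<le> G e)"
proof -
  have "F e \<le> G e \<longleftrightarrow> (\<exists>d. 0 \<le> d \<and> G e = F e + d)" for e
    by (auto intro: exI[of _ "G e - F e"])
  then show ?thesis
    by (simp only:) (rule rdefZ_ex rdef_conj rdefZ_nonneg rdef_eq tdefZ_intros tdef_tl assms)+
qed

lemma rdefZ_less:
  assumes "tdef \<Z> n F" "tdef \<Z> n G"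
  shows "rdef \<Z> n (\<lambda>e. F e < G e)"
  unfolding linorder_not_le[symmetric] by (rule rdef_not rdefZ_le assms)+

text \<open>The remainder takes the sign of the modulus, and for m = 0 the first clause alone forces
  r = a. All signs are covered because the arguments of \<open>beta\<close> range over all
  integers.\<close>

lemma mod_eq_iff_int:
  "a mod m = r \<longleftrightarrow> (\<exists>q. a = m * q + r) \<and> (0 < m \<longrightarrow> 0 \<le> r \<and> r < m) \<and> (m < 0 \<longrightarrow> m < r \<and> r \<le> 0)"
  for a m r :: int
proof
  assume r: "a mod m = r"
  have "a = m * (a div m) + r" using r by (metis mult_div_mod_eq)
  then show "(\<exists>q. a = m * q + r) \<and> (0 < m \<longrightarrow> 0 \<le> r \<and> r < m) \<and> (m < 0 \<longrightarrow> m < r \<and> r \<le> 0)"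
    using r pos_mod_bound[of m a] pos_mod_sign[of m a] neg_mod_bound[of m a] neg_mod_sign[of m a] by blast
next
  assume *: "(\<exists>q. a = m * q + r) \<and> (0 < m \<longrightarrow> 0 \<le> r \<and> r < m) \<and> (m < 0 \<longrightarrow> m < r \<and> r \<le> 0)"
  then have "a mod m = r mod m" by auto
  moreover have "r mod m = r"
    using * by (cases m "0 :: int" rule: linorder_cases) (auto simp: mod_pos_pos_trivial mod_neg_neg_trivial)
  ultimately show "a mod m = r" by simp
qed

lemma rdefZ_mod:
  assumes "tdef \<Z> n F" "tdef \<Z> n G" "tdef \<Z> n H"
  shows "rdef \<Z> n (\<lambda>e. F e mod G e = H e)"
  unfolding mod_eq_iff_int
  by (rule rdefZ_ex rdef_conj rdef_imp rdefZ_less rdefZ_le rdef_eq tdefZ_intros tdef_tl assms)+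

text \<open>Goedel's beta function, shifted by \<open>M\<close> so that it reaches sequences of integers.\<close>

definition beta :: "int \<Rightarrow> int \<Rightarrow> int \<Rightarrow> int \<Rightarrow> int" where
  "beta c d M j = c mod (1 + (j + 1) * d) - M"

lemma rdefZ_beta:
  assumes "tdef \<Z> n c" "tdef \<Z> n d" "tdef \<Z> n M" "tdef \<Z> n j" "tdef \<Z> n F"
  shows "rdef \<Z> n (\<lambda>e. beta (c e) (d e) (M e) (j e) = F e)"
proof -
  have "beta (c e) (d e) (M e) (j e) = F e \<longleftrightarrow> c e mod (1 + (j e + 1) * d e) = F e + M e" for e
    by (auto simp: beta_def)
  then show ?thesis by (simp only:) (rule rdefZ_mod tdefZ_intros assms)+
qed

text \<open>A prime dividing the moduli of i < j divides (j - i) d; as j - i divides the factorial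
  d, it divides d and hence 1. So the moduli are pairwise coprime, and the Chinese remainder theorem
  yields \<open>c\<close>. The moduli exceed all values, so the remainders are the values
  themselves.\<close>

lemma beta_surj_nonneg:
  assumes "\<And>j. j \<le> n \<Longrightarrow> 0 \<le> s j"
  shows "\<exists>c d. \<forall>j\<le>n. beta c d 0 (int j) = s j"
proof -
  \<comment> \<open>\<open>N\<close> exceeds \<open>n\<close>, for coprimality of the moduli, and
    bounds every value of the sequence, for the size of the remainders.\<close>
  define N where "N = Suc n + (\<Sum>j\<le>n. nat (s j))"
  define d :: nat where "d = fact N"
  define m where "m j = 1 + Suc j * d" for j :: nat
  have cop: "coprime (m i) (m j)" if "i \<le> n" "j \<le> n" "i < j" for i j
  proof (rule ccontr)
    assume "\<not> coprime (m i) (m j)"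
    then have "gcd (m i) (m j) \<noteq> 1" by (simp add: coprime_iff_gcd_eq_1)
    then obtain p where p: "prime p" "p dvd m i" "p dvd m j"
      using prime_factor_nat[of "gcd (m i) (m j)"] by auto
    have "p dvd m j - m i" using p by (intro dvd_diff_nat)
    also have "m j - m i = (j - i) * d"
      using that by (simp add: m_def algebra_simps diff_mult_distrib)
    finally have "p dvd (j - i) * d" .
    moreover have "j - i dvd d" unfolding d_def using that by (intro dvd_fact) (auto simp: N_def)
    ultimately have "p dvd d" using p(1) prime_dvd_mult_iff dvd_trans by blast
    then have "p dvd Suc i * d" by simp
    then have "p dvd 1" using p(2) dvd_add_left_iff unfolding m_def by blast
    then show False using p(1) by simp
  qed
  have "\<forall>i\<in>{..n}. \<forall>j\<in>{..n}. i \<noteq> j \<longrightarrow> coprime (m i) (m j)"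
    using cop by (metis atMost_iff coprime_commute linorder_neqE_nat)
  then obtain x where x: "\<And>i. i \<le> n \<Longrightarrow> [x = nat (s i)] (mod m i)"
    using chinese_remainder_nat[of "{..n}" m "\<lambda>i. nat (s i)"] by auto
  have "beta (int x) (int d) 0 (int j) = s j" if j: "j \<le> n" for j
  proof -
    have "nat (s j) \<le> (\<Sum>j\<le>n. nat (s j))" using j by (intro member_le_sum) auto
    also have "\<dots> \<le> N" by (simp add: N_def)
    also have "N \<le> d" unfolding d_def by (rule fact_ge_self)
    also have "d < m j" by (simp add: m_def)
    finally have "x mod m j = nat (s j)" using x[OF j] by (simp add: cong_def)
    then have "int (x mod m j) = s j" using assms[OF j] by simp
    then have "int x mod int (m j) = s j" by (simp only: zmod_int)
    then show ?thesis by (simp add: beta_def m_def algebra_simps)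
  qed
  then show ?thesis by blast
qed

text \<open>Shifting by the sum of the absolute values makes all entries nonnegative;
  \<open>M\<close> in \<open>beta\<close> undoes the shift.\<close>

lemma beta_surj: "\<exists>c d M. \<forall>j\<le>n. beta c d M (int j) = s j"
proof -
  define M where "M = (\<Sum>j\<le>n. \<bar>s j\<bar>)"
  have M: "0 \<le> s j + M" if "j \<le> n" for j
  proof -
    have "\<bar>s j\<bar> \<le> M" unfolding M_def using that by (intro member_le_sum) auto
    then show ?thesis by linarith
  qed
  obtain c d where cd: "\<And>j. j \<le> n \<Longrightarrow> beta c d 0 (int j) = s j + M"
    using beta_surj_nonneg[of n "\<lambda>j. s j + M", OF M] by blast
  have "beta c d M (int j) = s j" if "j \<le> n" for j
    using cd[OF that] by (simp add: beta_def)
  then show ?thesis by blast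
qed

section \<open>Laurent polynomials\<close>

type_synonym lpoly = "(nat \<Rightarrow>\<^sub>0 int) \<Rightarrow>\<^sub>0 int"

abbreviation "lookup \<equiv> Poly_Mapping.lookup"
abbreviation "keys \<equiv> Poly_Mapping.keys"
abbreviation "single \<equiv> Poly_Mapping.single"

lemma poly_mapping_eq_sum_single: "(\<Sum>m\<in>keys f. single m (lookup f m)) = f"
proof (rule poly_mapping_eqI)
  fix n
  have "lookup (\<Sum>m\<in>keys f. single m (lookup f m)) n = (\<Sum>m\<in>keys f. if m = n then lookup f m else 0)"
    by (simp add: lookup_sum lookup_single when_def)
  also have "\<dots> = lookup f n" by (simp add: in_keys_iff)
  finally show "lookup (\<Sum>m\<in>keys f. single m (lookup f m)) n = lookup f n" .
qed

lemma poly_mapping_single_induct [case_names zero add]: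
  fixes f :: "'a \<Rightarrow>\<^sub>0 'b::comm_monoid_add"
  assumes "P 0" "\<And>m g. m \<in> keys f \<Longrightarrow> P g \<Longrightarrow> P (single m (lookup f m) + g)"
  shows "P f"
proof -
  have "P (\<Sum>m\<in>A. single m (lookup f m))" if "finite A" "A \<subseteq> keys f" for A
    using that
  proof (induction A)
    case (insert m A)
    then show ?case using assms(2)[of m "\<Sum>m\<in>A. single m (lookup f m)"] by simp
  qed (simp add: assms(1))
  from this[of "keys f"] show ?thesis by (simp add: poly_mapping_eq_sum_single)
qed

text \<open>The additive extension of \<chi> from exponents to polynomials. A multiplicative \<chi>
  gives evaluation at a point, and the indicator function of a set of exponents gives a sum of
  coefficients.\<close>

definition lin :: "('k \<Rightarrow> 'b) \<Rightarrow> ('k \<Rightarrow>\<^sub>0 int) \<Rightarrow> 'b::comm_ring_1" where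
  "lin \<chi> f = (\<Sum>m\<in>keys f. of_int (lookup f m) * \<chi> m)"

lemma lin_superset:
  "finite A \<Longrightarrow> keys f \<subseteq> A \<Longrightarrow> lin \<chi> f = (\<Sum>m\<in>A. of_int (lookup f m) * \<chi> m)"
  unfolding lin_def by (rule sum.mono_neutral_left) (auto simp: in_keys_iff)

lemma lin_0 [simp]: "lin \<chi> 0 = 0"
  by (simp add: lin_def)

lemma lin_single [simp]: "lin \<chi> (single m c) = of_int c * \<chi> m"
  by (simp add: lin_def)

lemma lin_add: "lin \<chi> (f + g) = lin \<chi> f + lin \<chi> g"
  using lin_superset[of "keys f \<union> keys g" f \<chi>] lin_superset[of "keys f \<union> keys g" g \<chi>]
    lin_superset[of "keys f \<union> keys g" "f + g" \<chi>] keys_add[of f g]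
  by (simp add: lookup_add algebra_simps sum.distrib)

lemma lin_diff: "lin \<chi> (f - g) = lin \<chi> f - lin \<chi> g"
  using lin_add[of \<chi> "f - g" g] by simp

lemma lin_shift:
  fixes f :: "'k::monoid_add \<Rightarrow>\<^sub>0 int"
  shows "lin \<chi> (single a c * f) = of_int c * lin (\<lambda>m. \<chi> (a + m)) f"
  by (induction f rule: poly_mapping_single_induct) (auto simp: lin_add algebra_simps mult_single)

lemma lin_mult:
  fixes f :: "'k::monoid_add \<Rightarrow>\<^sub>0 int"
  assumes "\<And>a b. \<chi> (a + b) = \<chi> a * \<chi> b"
  shows "lin \<chi> (f * g) = lin \<chi> f * lin \<chi> g"
proof (induction f rule: poly_mapping_single_induct)
  case (add m f)
  have "lin (\<lambda>n. \<chi> (m + n)) g = \<chi> m * lin \<chi> g"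
    by (simp add: assms lin_def sum_distrib_left algebra_simps)
  then show ?case using add by (simp add: lin_add lin_shift algebra_simps)
qed simp

section \<open>Coefficients of products, and units\<close>

lemma lookup_eq_lin: "lookup f m = lin (\<lambda>n. of_bool (n = m)) f"
  by (simp add: lin_def in_keys_iff of_bool_def if_distrib cong: if_cong)

text \<open>After the monomial of exponent \<open>A\<close> has been removed from \<open>f\<close>,
  no product of monomials has exponent \<open>A + B\<close>; so only the removed monomial
  contributes to this coefficient.\<close>

lemma lookup_mult_unique:
  fixes f g :: "'k::cancel_comm_monoid_add \<Rightarrow>\<^sub>0 int"
  assumes uniq: "\<And>a b. a \<in> keys f \<Longrightarrow> b \<in> keys g \<Longrightarrow> a + b = A + B \<Longrightarrow> a = A"
  shows "lookup (f * g) (A + B) = lookup f A * lookup g B"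
proof -
  define h where "h = f - single A (lookup f A)"
  have h_keys: "keys h \<subseteq> keys f - {A}"
    by (auto simp: h_def in_keys_iff lookup_minus lookup_single when_def split: if_splits)
  have "A + B \<notin> keys (h * g)"
  proof
    assume "A + B \<in> keys (h * g)"
    then obtain a b where "A + B = a + b" "a \<in> keys h" "b \<in> keys g" using keys_mult[of h g] by blast
    then show False using uniq[of a b] h_keys by auto
  qed
  then have "lookup (h * g) (A + B) = 0" by (simp add: in_keys_iff)
  moreover have "f * g = single A (lookup f A) * g + h * g" by (simp add: h_def algebra_simps)
  moreover have "lookup (single A (lookup f A) * g) (A + B) = lookup f A * lookup g B"
    unfolding lookup_eq_lin[of "single A (lookup f A) * g"] lin_shift by (simp add: lookup_eq_lin[of g])
  ultimately show ?thesis by (simp add: lookup_add)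
qed

text \<open>The exponents carry a linear order compatible with addition. The greatest exponents of
  the factors add up to an exponent of the product 1, and so do the least ones; both sums are
  therefore 0, and each factor has a single exponent.\<close>

lemma lpoly_unit:
  fixes f g :: lpoly
  assumes fg: "f * g = 1"
  obtains a c where "f = single a c" "c = 1 \<or> c = -1"
proof -
  have "f \<noteq> 0" "g \<noteq> 0" using fg by auto
  then have ne: "keys f \<noteq> {}" "keys g \<noteq> {}" by auto
  define M M' m m' where "M = Max (keys f)" "M' = Max (keys g)" "m = Min (keys f)" "m' = Min (keys g)"
  have mem: "M \<in> keys f" "M' \<in> keys g" "m \<in> keys f" "m' \<in> keys g"
    using ne by (auto simp: M_M'_m_m'_def)
  have bd: "a \<in> keys f \<Longrightarrow> a \<le> M" "b \<in> keys g \<Longrightarrow> b \<le> M'"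
    "a \<in> keys f \<Longrightarrow> m \<le> a" "b \<in> keys g \<Longrightarrow> m' \<le> b" for a b
    by (auto simp: M_M'_m_m'_def)
  have less: "a + b < c + d" if "a \<le> c" "b \<le> d" "a \<noteq> c" for a b c d :: "nat \<Rightarrow>\<^sub>0 int"
    using that by (intro add_less_le_mono) auto
  have fM: "lookup (f * g) (M + M') = lookup f M * lookup g M'"
  proof (rule lookup_mult_unique, rule ccontr)
    fix a b assume "a \<in> keys f" "b \<in> keys g" "a + b = M + M'" "a \<noteq> M"
    then show False using less[of a M b M'] bd by simp
  qed
  have "lookup (1 :: lpoly) (M + M') \<noteq> 0" using fM mem unfolding fg by (simp add: in_keys_iff)
  then have 1: "M + M' = 0" by (simp add: lookup_one when_def split: if_splits)
  have "lookup (f * g) (m + m') = lookup f m * lookup g m'"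
  proof (rule lookup_mult_unique, rule ccontr)
    fix a b assume "a \<in> keys f" "b \<in> keys g" "a + b = m + m'" "a \<noteq> m"
    then show False using less[of m a m' b] bd by simp
  qed
  then have "lookup (1 :: lpoly) (m + m') \<noteq> 0" using mem unfolding fg by (simp add: in_keys_iff)
  then have 2: "m + m' = 0" by (simp add: lookup_one when_def split: if_splits)
  have le: "m \<le> M" "m' \<le> M'" using bd mem by auto
  \<comment> \<open>If \<open>m\<close> were strictly below \<open>M\<close>, then m + m' = 0 would
    be strictly below M + M' = 0.\<close>
  have mM: "m = M" using less[OF le] 1 2 by force
  moreover have "m' = M'" using 1 2 unfolding mM by (metis add_left_cancel)
  ultimately have kf: "keys f = {M}" "keys g = {M'}" using bd mem by (auto intro: antisym)
  have f: "f = single M (lookup f M)"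
    using poly_mapping_eq_sum_single[of f] unfolding kf by simp
  have "lookup f M * lookup g M' = 1"
    using fM unfolding fg 1 by simp
  then have "lookup f M = 1 \<or> lookup f M = -1" by (auto simp: zmult_eq_1_iff)
  then show ?thesis using f that by blast
qed

section \<open>The Laurent ring, and the definition of the integers by powers of units\<close>

locale laurent =
  fixes k :: nat
begin

abbreviation "L \<equiv> laurent_ring k"

lemma ring_ops [simp]: "\<zero>\<^bsub>L\<^esub> = 0" "\<one>\<^bsub>L\<^esub> = 1" "x \<oplus>\<^bsub>L\<^esub> y = x + y" "x \<otimes>\<^bsub>L\<^esub> y = x * y"
  by (simp_all add: laurent_ring_def)

lemma carrier_iff: "f \<in> carrier L \<longleftrightarrow> (\<forall>m\<in>keys f. keys m \<subseteq> {..<k})"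
  by (simp add: laurent_ring_def)

lemma carrier_add: "f \<in> carrier L \<Longrightarrow> g \<in> carrier L \<Longrightarrow> f + g \<in> carrier L"
  using keys_add[of f g] unfolding carrier_iff by blast

lemma carrier_uminus: "f \<in> carrier L \<Longrightarrow> - f \<in> carrier L"
  unfolding carrier_iff by (simp add: in_keys_iff)

lemma carrier_diff: "f \<in> carrier L \<Longrightarrow> g \<in> carrier L \<Longrightarrow> f - g \<in> carrier L"
  using carrier_add[OF _ carrier_uminus, of f g] by simp

lemma carrier_mult: "f \<in> carrier L \<Longrightarrow> g \<in> carrier L \<Longrightarrow> f * g \<in> carrier L"
  unfolding carrier_iff
proof
  fix m assume fg: "\<forall>m\<in>keys f. keys m \<subseteq> {..<k}" "\<forall>m\<in>keys g. keys m \<subseteq> {..<k}" "m \<in> keys (f * g)"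
  then obtain a b where "m = a + b" "a \<in> keys f" "b \<in> keys g" using keys_mult[of f g] by blast
  then show "keys m \<subseteq> {..<k}" using fg keys_add[of a b] by blast
qed

lemma carrier_single: "keys m \<subseteq> {..<k} \<Longrightarrow> single m c \<in> carrier L"
  by (simp add: carrier_iff)

lemma carrier_of_int [simp]: "of_int n \<in> carrier L"
  by (metis carrier_single empty_subsetI keys_zero single_of_int)

lemma carrier_0_1 [simp]: "0 \<in> carrier L" "1 \<in> carrier L"
  using carrier_of_int[of 0] carrier_of_int[of 1] by simp_all

lemma carrier_power: "f \<in> carrier L \<Longrightarrow> f ^ n \<in> carrier L"
  by (induction n) (auto intro: carrier_mult)

lemma closed_L: "closed_struct L"
  by (simp add: closed_struct_def carrier_add carrier_mult)

text \<open>The binomial expansion v^n = 1 + n (v - 1) modulo (v - 1)^2. The powers are given by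
  their recursion only, so that the lemma serves both powers of an arbitrary unit and explicit
  monomials; the inverse of v is cancelled against v in the step to n - 1.\<close>

lemma unit_power_expansion:
  assumes v: "v * v' = 1" "v \<in> carrier L" "v' \<in> carrier L"
    and W: "W 0 = 1" "\<And>n. W (n + 1) = W n * v"
  shows "\<exists>g\<in>carrier L. W n - 1 - of_int n * (v - 1) = g * ((v - 1) * (v - 1))"
proof (induction n rule: int_induct[where k = 0])
  case base
  then show ?case by (intro bexI[of _ 0]) (simp_all add: W)
next
  case (step1 n)
  then obtain g where g: "g \<in> carrier L" "W n - 1 - of_int n * (v - 1) = g * ((v - 1) * (v - 1))" by blast
  have "W (n + 1) - 1 - of_int (n + 1) * (v - 1) =
      v * (W n - 1 - of_int n * (v - 1)) + of_int n * ((v - 1) * (v - 1))"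
    unfolding W(2) by (simp add: algebra_simps)
  also have "\<dots> = (v * g + of_int n) * ((v - 1) * (v - 1))" unfolding g by (simp add: algebra_simps)
  finally show ?case using g v by (intro bexI[of _ "v * g + of_int n"] carrier_add carrier_mult) auto
next
  case (step2 n)
  then obtain g where g: "g \<in> carrier L" "W n - 1 - of_int n * (v - 1) = g * ((v - 1) * (v - 1))" by blast
  have Wn: "W n = W (n - 1) * v" using W(2)[of "n - 1"] by simp
  have "v * (W (n - 1) - 1 - of_int (n - 1) * (v - 1)) =
      (W n - 1 - of_int n * (v - 1)) - of_int (n - 1) * ((v - 1) * (v - 1))"
    by (simp add: Wn algebra_simps)
  also have "\<dots> = (g - of_int (n - 1)) * ((v - 1) * (v - 1))" unfolding g by (simp add: algebra_simps)
  finally have "v' * (v * (W (n - 1) - 1 - of_int (n - 1) * (v - 1))) =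
      v' * ((g - of_int (n - 1)) * ((v - 1) * (v - 1)))" by simp
  moreover have "v' * (v * x) = x" for x using v(1) by (metis mult.assoc mult.commute mult_1)
  ultimately have "W (n - 1) - 1 - of_int (n - 1) * (v - 1) =
      (v' * (g - of_int (n - 1))) * ((v - 1) * (v - 1))" by (simp add: mult.assoc)
  moreover have "v' * (g - of_int (n - 1)) \<in> carrier L"
    using g(1) v(3) by (intro carrier_diff carrier_mult carrier_of_int)
  ultimately show ?case by blast
qed

lemma unit_powers:
  fixes v v' :: lpoly
  assumes v: "v * v' = 1" "v \<in> carrier L" "v' \<in> carrier L"
  shows "\<exists>w\<in>carrier L. \<exists>w'\<in>carrier L. \<exists>g\<in>carrier L.
    w * w' = 1 \<and> w - 1 - of_int n * (v - 1) = g * ((v - 1) * (v - 1))"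
proof -
  define W where "W z = (if 0 \<le> z then v ^ nat z else v' ^ nat (- z))" for z :: int
  have W1: "W (z + 1) = W z * v" for z
  proof (cases "0 \<le> z")
    case True
    then show ?thesis by (simp add: W_def nat_add_distrib)
  next
    case False
    then obtain n where n: "z = - int (Suc n)" using negD[of z] by auto
    have Suc: "nat (int m + 1) = Suc m" for m by simp
    have "W (z + 1) = v' ^ n" by (cases n) (simp_all add: W_def n Suc)
    moreover have "W z * v = v' ^ n * (v * v')" by (simp add: W_def n Suc mult_ac)
    ultimately show ?thesis by (simp add: v(1))
  qed
  have W0: "W 0 = 1" by (simp add: W_def)
  have "v ^ m * v' ^ m = 1" for m by (simp add: v(1) flip: power_mult_distrib)
  then have inv: "W z * W (- z) = 1" for z
    by (cases "z = 0") (simp_all add: W_def mult.commute[of "v' ^ _"])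
  have WL: "W z \<in> carrier L" for z using v carrier_power by (simp add: W_def)
  obtain g where "g \<in> carrier L" "W n - 1 - of_int n * (v - 1) = g * ((v - 1) * (v - 1))"
    using unit_power_expansion[OF v, of W, OF W0 W1] by blast
  then show ?thesis using inv WL by blast
qed

text \<open>Used for the indicator functions of the cosets of the multiples of \<open>a\<close>.\<close>

lemma lin_coset_eq_0:
  fixes g :: lpoly
  assumes "\<And>m. \<chi> (a + m) = \<chi> m"
  shows "lin \<chi> (g * (single a 1 - 1)) = 0"
proof -
  have "g * (single a 1 - 1) = single a 1 * g - g" by (simp add: algebra_simps)
  then show ?thesis by (simp add: lin_diff lin_shift assms)
qed

text \<open>Take v = x^j for the first variable x. The unit w is congruent to 1 modulo v - 1, which
  forces w = v^t for some t. Comparing the given congruence with the expansion of v^t shows that r -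
  t is a multiple of v - 1. Then its coefficients sum to 0 over each coset of exponents modulo that
  of v; as j is large, a coset contains at most one exponent of r - t, so r = t.\<close>

lemma integer_if_unit_condition:
  fixes r :: lpoly
  assumes k: "k \<ge> 1" and r: "r \<in> carrier L"
    and D: "\<And>v v'. v \<in> carrier L \<Longrightarrow> v' \<in> carrier L \<Longrightarrow> v * v' = 1 \<Longrightarrow>
      \<exists>w\<in>carrier L. \<exists>w'\<in>carrier L. \<exists>g\<in>carrier L.
        w * w' = 1 \<and> w - 1 - r * (v - 1) = g * ((v - 1) * (v - 1))"
  shows "\<exists>n. r = of_int n"
proof -
  \<comment> \<open>Two exponents of the first variable in \<open>r\<close> differ by less than
    \<open>j\<close>. The summand 1 keeps \<open>j\<close> positive, which also covers the exponent
    0 that subtracting an integer can introduce.\<close>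
  define j where "j = 1 + 2 * (\<Sum>m\<in>keys r. \<bar>lookup m 0\<bar>)"
  have j: "2 * \<bar>lookup m 0\<bar> < j" if "m \<in> keys r" for m
    using member_le_sum[OF that, of "\<lambda>m. \<bar>lookup m 0\<bar>"] by (simp add: j_def)
  have j0: "j > 0" unfolding j_def by (simp add: sum_nonneg add_pos_nonneg)
  define a :: "nat \<Rightarrow>\<^sub>0 int" where "a = single 0 j"
  define v :: lpoly where "v = single a 1"
  \<comment> \<open>The coset of \<open>m0\<close> modulo the multiples of the exponent of
    \<open>v\<close>. It is invariant under multiplication by \<open>v\<close>, so multiples of
    \<open>v - 1\<close> have coefficient sum 0 on it.\<close>
  define C where "C m0 = {m. \<exists>z. m = m0 + single 0 (j * z)}" for m0 :: "nat \<Rightarrow>\<^sub>0 int"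
  have C_shift: "a + m \<in> C m0 \<longleftrightarrow> m \<in> C m0" for m m0
  proof
    assume "a + m \<in> C m0"
    then obtain z where "a + m = m0 + single 0 (j * z)" by (auto simp: C_def)
    then have "m = m0 + single 0 (j * z) - a" by (metis add_diff_cancel_left')
    then have "m = m0 + single 0 (j * (z - 1))"
      by (simp add: a_def algebra_simps single_diff)
    then show "m \<in> C m0" by (auto simp: C_def)
  next
    assume "m \<in> C m0"
    then obtain z where "m = m0 + single 0 (j * z)" by (auto simp: C_def)
    then have "a + m = m0 + single 0 (j * (z + 1))" by (simp add: a_def algebra_simps single_add)
    then show "a + m \<in> C m0" by (auto simp: C_def)
  qed
  have van: "lin (\<lambda>m. of_bool (m \<in> C m0) :: int) (g * (v - 1)) = 0" for g m0
    unfolding v_def by (rule lin_coset_eq_0) (simp add: C_shift)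
  have vL: "v \<in> carrier L" "single (- a) 1 \<in> carrier L"
    unfolding v_def using k by (auto intro!: carrier_single simp: a_def single_uminus[symmetric] split: if_splits)
  have vv: "v * single (- a) 1 = 1" by (simp add: v_def mult_single)
  obtain w w' g where w: "w \<in> carrier L" "w * w' = 1" "g \<in> carrier L"
    and e: "w - 1 - r * (v - 1) = g * ((v - 1) * (v - 1))"
    using D[OF vL vv] by blast
  obtain b c where bc: "w = single b c" using lpoly_unit[OF w(2)] by metis
  have "w - 1 = (r + g * (v - 1)) * (v - 1)" using e by (simp add: algebra_simps)
  \<comment> \<open>By \<open>lpoly_unit\<close>, w is a monomial of exponent \<open>b\<close> and
    coefficient \<open>c\<close>. The coefficient sum of w - 1 over the coset of 0 is
    \<open>c\<close> or 0, less 1; that it vanishes means c = 1 and w a power of v.\<close>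
  then have "lin (\<lambda>m. of_bool (m \<in> C 0) :: int) (w - 1) = 0" using van by simp
  moreover have "0 \<in> C 0" by (auto simp: C_def intro: exI[of _ 0])
  moreover have "lin \<chi> (1 :: lpoly) = \<chi> 0" for \<chi> :: "_ \<Rightarrow> int"
    using lin_single[of \<chi> 0 1] by simp
  ultimately have "c * of_bool (b \<in> C 0) = 1" by (simp add: lin_diff bc)
  then have "b \<in> C 0" "c = 1" by (auto simp: of_bool_def split: if_splits)
  then obtain t where t: "w = single (single 0 (j * t)) 1" using bc by (auto simp: C_def)
  define W :: "int \<Rightarrow> lpoly" where "W z = single (single 0 (j * z)) 1" for z
  have W: "W 0 = 1" "W (z + 1) = W z * v" for z
    by (simp_all add: W_def v_def a_def mult_single algebra_simps single_add)
  obtain g' where g': "W t - 1 - of_int t * (v - 1) = g' * ((v - 1) * (v - 1))"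
    using unit_power_expansion[OF vv vL, of W t, OF W] by blast
  \<comment> \<open>The two congruences modulo (v - 1)^2 concern the same unit v^t, so their
    difference eliminates it.\<close>
  have "(r - of_int t) * (v - 1) = (W t - 1 - of_int t * (v - 1)) - (w - 1 - r * (v - 1))"
    by (simp add: W_def t algebra_simps)
  also have "\<dots> = (g' - g) * (v - 1) * (v - 1)" unfolding g' e by (simp add: algebra_simps)
  finally have "(r - of_int t) * (v - 1) = (g' - g) * (v - 1) * (v - 1)" .
  moreover have "v - 1 \<noteq> 0"
  proof
    assume "v - 1 = 0"
    then have "lookup v 0 = lookup (1 :: lpoly) 0" by simp
    moreover have "a \<noteq> 0" using j0 by (simp add: a_def flip: keys_eq_empty)
    ultimately show False by (simp add: v_def lookup_single)
  qed
  ultimately have h: "r - of_int t = (g' - g) * (v - 1)" by simp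
  have "r - of_int t = 0"
  proof (rule ccontr)
    assume "r - of_int t \<noteq> 0"
    then have "keys (r - of_int t) \<noteq> {}" by simp
    then obtain m0 where m0: "m0 \<in> keys (r - of_int t)" by blast
    have sub: "keys (r - of_int t) \<subseteq> insert 0 (keys r)"
      by (auto simp: in_keys_iff lookup_minus lookup_of_int when_def split: if_splits)
    have small: "2 * \<bar>lookup m 0\<bar> < j" if "m \<in> keys (r - of_int t)" for m
      using sub that j j0 by auto
    have "m = m0" if m: "m \<in> keys (r - of_int t)" "m \<in> C m0" for m
    proof -
      obtain z where z: "m = m0 + single 0 (j * z)" using m(2) by (auto simp: C_def)
      then have "lookup m 0 - lookup m0 0 = j * z" by (simp add: lookup_add)
      moreover have "\<bar>lookup m 0 - lookup m0 0\<bar> < j" using small[OF m(1)] small[OF m0] by linarith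
      ultimately have "\<bar>j * z\<bar> < j * 1" by simp
      then have "z = 0" using j0 by (simp add: abs_mult)
      then show ?thesis using z by simp
    qed
    moreover have "m0 \<in> C m0" by (auto simp: C_def intro: exI[of _ 0])
    ultimately have "lin (\<lambda>m. of_bool (m \<in> C m0) :: int) (r - of_int t) =
        (\<Sum>m\<in>keys (r - of_int t). if m = m0 then lookup (r - of_int t) m0 else 0)"
      unfolding lin_def by (intro sum.cong) auto
    then have "lin (\<lambda>m. of_bool (m \<in> C m0) :: int) (r - of_int t) = lookup (r - of_int t) m0"
      using m0 by simp
    then show False using van[of m0 "g' - g"] m0 unfolding h by (simp add: in_keys_iff)
  qed
  then show ?thesis by auto
qed

end

section \<open>Evaluation\<close>

lemma int_induct_0:
  assumes "P 0" "\<And>i. P i \<Longrightarrow> P (i + 1)" "\<And>i. P i \<Longrightarrow> P (i - 1)"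
  shows "P (i :: int)"
  by (induction i rule: int_induct[where k = 0]) (use assms in auto)

text \<open>Multiplicative in \<open>m\<close> for points without zero coordinates, and
  multiplicative in \<open>s\<close> for each \<open>m\<close>; the latter makes these functions
  characters in Dedekind's sense.\<close>

definition mon_val :: "nat \<Rightarrow> int list \<Rightarrow> (nat \<Rightarrow>\<^sub>0 int) \<Rightarrow> rat" where
  "mon_val k s m = (\<Prod>i<k. of_int (s ! i) powi lookup m i)"

definition nonzero :: "nat \<Rightarrow> int list \<Rightarrow> bool" where
  "nonzero k s \<longleftrightarrow> (\<forall>i<k. s ! i \<noteq> 0)"

lemma mon_val_add: "nonzero k s \<Longrightarrow> mon_val k s (m + n) = mon_val k s m * mon_val k s n"
  by (simp add: mon_val_def nonzero_def lookup_add power_int_add prod.distrib)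

lemma mon_val_0 [simp]: "mon_val k s 0 = 1"
  by (simp add: mon_val_def)

lemma mon_val_single: "i < k \<Longrightarrow> mon_val k s (single i z) = of_int (s ! i) powi z"
proof -
  assume i: "i < k"
  have "mon_val k s (single i z) = (\<Prod>j<k. if j = i then of_int (s ! i) powi z else 1)"
    unfolding mon_val_def by (rule prod.cong) (auto simp: lookup_single)
  then show ?thesis using i by simp
qed

text \<open>Dedekind's argument for the linear independence of the characters \<open>s \<mapsto> mon_val k s m\<close>.\<close>

lemma mon_val_independent:
  assumes "finite A" "\<forall>m\<in>A. keys m \<subseteq> {..<k}"
    and "\<And>s. s \<in> tuples \<Z> k \<Longrightarrow> nonzero k s \<Longrightarrow> (\<Sum>m\<in>A. c m * mon_val k s m) = 0"
  shows "\<forall>m\<in>A. c m = 0"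
  using assms
proof (induction A arbitrary: c)
  case (insert a A)
  have zero: "c b = 0" if b: "b \<in> A" for b
  proof -
    have "a \<noteq> b" using insert.hyps b by auto
    then obtain i where i: "lookup a i \<noteq> lookup b i" by (metis poly_mapping_eqI)
    then have "i \<in> keys a \<or> i \<in> keys b" by (auto simp: in_keys_iff)
    then have ik: "i < k" using insert.prems(1) b by auto
    \<comment> \<open>A point that tells the characters of \<open>a\<close> and \<open>b\<close>
      apart: its one entry 2 stands at a variable with different exponents in \<open>a\<close> and
      \<open>b\<close>.\<close>
    define t :: "int list" where "t = (replicate k 1)[i := 2]"
    have t: "t \<in> tuples \<Z> k" "nonzero k t"
      using ik by (auto simp: t_def tuples_def nonzero_def nth_list_update)
    have val_t: "mon_val k t m = 2 powi lookup m i" for m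
    proof -
      have "mon_val k t m = (\<Prod>j<k. if j = i then 2 powi lookup m i else 1)"
        unfolding mon_val_def by (rule prod.cong) (auto simp: t_def nth_list_update)
      then show ?thesis using ik by simp
    qed
    \<comment> \<open>Coefficients of the relation at the product of \<open>t\<close> and
      \<open>s\<close>, minus \<open>mon_val k t a\<close> times the relation at \<open>s\<close>:
      the term of \<open>a\<close> cancels, and the induction hypothesis applies to the
      rest.\<close>
    define c' where "c' m = c m * (mon_val k t m - mon_val k t a)" for m
    have "(\<Sum>m\<in>A. c' m * mon_val k s m) = 0" if s: "s \<in> tuples \<Z> k" "nonzero k s" for s
    proof -
      define ts where "ts = map2 (*) t s"
      have len: "length t = k" "length s = k" using t s by (auto simp: tuples_def)
      have ts_nth: "ts ! j = t ! j * s ! j" if "j < k" for j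
        using that len by (simp add: ts_def)
      have "ts \<in> tuples \<Z> k" "nonzero k ts"
        using t s len ts_nth by (auto simp: tuples_def nonzero_def ts_def)
      moreover have "mon_val k ts m = mon_val k t m * mon_val k s m" for m
        by (simp add: mon_val_def ts_nth power_int_mult_distrib flip: prod.distrib)
      ultimately have "(\<Sum>m\<in>insert a A. c m * (mon_val k t m * mon_val k s m)) = 0"
        using insert.prems(2)[of ts] by simp
      moreover have "(\<Sum>m\<in>insert a A. c m * mon_val k s m) = 0" using insert.prems(2) s by blast
      moreover have "(\<Sum>m\<in>insert a A. c' m * mon_val k s m) =
          (\<Sum>m\<in>insert a A. c m * (mon_val k t m * mon_val k s m) - mon_val k t a * (c m * mon_val k s m))"
        by (rule sum.cong) (simp_all only: c'_def algebra_simps)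
      ultimately have "(\<Sum>m\<in>insert a A. c' m * mon_val k s m) = 0"
        unfolding sum_subtractf sum_distrib_left[symmetric] by simp
      then show ?thesis using insert.hyps by (simp add: c'_def)
    qed
    then have "\<forall>m\<in>A. c' m = 0" using insert.IH[of c'] insert.prems(1) by blast
    then have "c b * (2 powi lookup b i - 2 powi lookup a i) = 0" using b by (simp add: c'_def val_t)
    moreover have "(2 :: rat) powi lookup b i \<noteq> 2 powi lookup a i"
      using i power_int_strict_increasing[of "lookup a i" "lookup b i" "2 :: rat"]
        power_int_strict_increasing[of "lookup b i" "lookup a i" "2 :: rat"]
      by (cases "lookup a i" "lookup b i" rule: linorder_cases) auto
    ultimately show ?thesis by simp
  qed
  \<comment> \<open>Only the term of \<open>a\<close> is left; evaluating it at the point with all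
    coordinates 1 gives its coefficient.\<close>
  define e :: "int list" where "e = replicate k 1"
  have "e \<in> tuples \<Z> k" "nonzero k e" by (auto simp: e_def tuples_def nonzero_def)
  then have "(\<Sum>m\<in>insert a A. c m * mon_val k e m) = 0" using insert.prems(2) by blast
  moreover have "mon_val k e a = 1" by (simp add: mon_val_def e_def)
  ultimately have "c a = 0" using insert.hyps zero by simp
  then show ?case using zero by simp
qed simp

context laurent
begin

definition ev :: "int list \<Rightarrow> lpoly \<Rightarrow> rat" where
  "ev s = lin (mon_val k s)"

lemma ev_add: "ev s (f + g) = ev s f + ev s g"
  by (simp add: ev_def lin_add)

lemma ev_diff: "ev s (f - g) = ev s f - ev s g"
  by (simp add: ev_def lin_diff)

lemma ev_mult: "nonzero k s \<Longrightarrow> ev s (f * g) = ev s f * ev s g"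
  unfolding ev_def by (rule lin_mult) (rule mon_val_add)

lemma ev_of_int: "ev s (of_int n) = of_int n"
proof -
  have "(of_int n :: lpoly) = single 0 n" by (simp flip: single_of_int)
  then show ?thesis by (simp add: ev_def)
qed

lemma ev_0 [simp]: "ev s 0 = 0" and ev_1 [simp]: "ev s 1 = 1"
  using ev_of_int[of s 0] ev_of_int[of s 1] by simp_all

lemma ev_sum: "ev s (\<Sum>i\<in>I. f i) = (\<Sum>i\<in>I. ev s (f i))"
  by (induction I rule: infinite_finite_induct) (auto simp: ev_add)

lemma ev_separates:
  assumes "f \<in> carrier L" "g \<in> carrier L"
    and "\<And>s. s \<in> tuples \<Z> k \<Longrightarrow> nonzero k s \<Longrightarrow> ev s f = ev s g"
  shows "f = g"
proof -
  have "f - g \<in> carrier L" using assms carrier_diff by blast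
  then have "\<forall>m\<in>keys (f - g). (of_int (lookup (f - g) m) :: rat) = 0"
    using assms(3) by (intro mon_val_independent[of _ k]) (auto simp: carrier_iff ev_diff simp flip: lin_def ev_def)
  then have "lookup (f - g) m = 0" for m
    by (cases "m \<in> keys (f - g)") (simp_all add: in_keys_iff)
  then have "f - g = 0" by (intro poly_mapping_eqI) simp
  then show ?thesis by simp
qed

definition X :: "nat \<Rightarrow> lpoly" where "X i = single (single i 1) 1"
definition Xi :: "nat \<Rightarrow> lpoly" where "Xi i = single (single i (-1)) 1"

lemma X_Xi: "X i * Xi i = 1"
  by (simp add: X_def Xi_def mult_single flip: single_add)

lemma X_carrier: "i < k \<Longrightarrow> X i \<in> carrier L" "i < k \<Longrightarrow> Xi i \<in> carrier L"
  unfolding X_def Xi_def by (auto intro!: carrier_single)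

lemma ev_X: "i < k \<Longrightarrow> ev s (X i) = of_int (s ! i)" "i < k \<Longrightarrow> ev s (Xi i) = inverse (of_int (s ! i))"
  by (simp_all add: ev_def X_def Xi_def mon_val_single)

section \<open>Codes of Laurent polynomials\<close>

text \<open>A Laurent polynomial is built from \<open>0\<close> by a Horner scheme, a sequence of operations with
  numbers \<open>0, \<dots>, 2k + 1\<close>: multiply by \<open>x\<^sub>i\<close> or by its inverse, or change the constant term by 1.\<close>

definition op :: "int \<Rightarrow> lpoly \<Rightarrow> lpoly" where
  "op z v = (if 0 \<le> z \<and> z < int k then X (nat z) * v
    else if int k \<le> z \<and> z < int (2 * k) then Xi (nat z - k) * v
    else if z = int (2 * k) then v + 1 else v - 1)"

primrec run :: "(nat \<Rightarrow> int) \<Rightarrow> nat \<Rightarrow> lpoly" where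
  "run z 0 = 0"
| "run z (Suc n) = op (z n) (run z n)"

lemma op_X: "i < k \<Longrightarrow> op (int i) v = X i * v"
  by (simp add: op_def)

lemma op_Xi: "i < k \<Longrightarrow> op (int (k + i)) v = Xi i * v"
  by (simp add: op_def nat_add_distrib)

lemma op_add: "op (int (2 * k)) v = v + 1"
  by (simp add: op_def)

text \<open>All numbers outside 0, ..., 2k subtract 1, so that every sequence of integers is a
  Horner scheme and decoding is total.\<close>

lemma op_diff: "(\<forall>i<2*k+1. z \<noteq> int i) \<Longrightarrow> op z v = v - 1"
proof -
  assume *: "\<forall>i<2*k+1. z \<noteq> int i"
  have "z < 0 \<or> z > int (2 * k)"
  proof (rule ccontr)
    assume "\<not> (z < 0 \<or> z > int (2 * k))"
    then have "nat z < 2 * k + 1" "z = int (nat z)" by auto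
    then show False using * by blast
  qed
  then show ?thesis by (auto simp: op_def)
qed

lemma op_cases:
  obtains (X) i where "i < k" "z = int i" | (Xi) i where "i < k" "z = int (k + i)"
  | (add) "z = int (2 * k)" | (diff) "\<forall>i<2*k+1. z \<noteq> int i"
proof -
  consider "\<exists>i<2*k+1. z = int i" | "\<forall>i<2*k+1. z \<noteq> int i" by blast
  then show ?thesis
  proof cases
    case 1
    then obtain i where i: "i < 2 * k + 1" "z = int i" by blast
    consider "i < k" | "k \<le> i" "i < 2 * k" | "i = 2 * k" using i by linarith
    then show ?thesis
    proof cases
      case 2
      then show ?thesis using Xi[of "i - k"] i by simp
    qed (use X add i in auto)
  qed (rule diff)
qed

lemma op_carrier: "v \<in> carrier L \<Longrightarrow> op z v \<in> carrier L"
  by (cases z rule: op_cases)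
    (simp_all add: op_X op_Xi op_add op_diff X_carrier carrier_mult carrier_add carrier_diff del: of_nat_add of_nat_mult)

lemma run_carrier: "run z n \<in> carrier L"
  by (induction n) (auto intro: op_carrier)

lemma run_cong: "(\<And>j. j < n \<Longrightarrow> z j = z' j) \<Longrightarrow> run z n = run z' n"
  by (induction n) auto

inductive_set reach :: "lpoly set" where
  reach_0: "0 \<in> reach"
| reach_op: "v \<in> reach \<Longrightarrow> op z v \<in> reach"

lemma reach_run: "v \<in> reach \<Longrightarrow> \<exists>z n. (\<forall>j. 0 \<le> z j) \<and> run z n = v"
proof (induction rule: reach.induct)
  case reach_0
  then show ?case by (intro exI[of _ "\<lambda>j. 0"] exI[of _ 0]) simp
next
  case (reach_op v y)
  then obtain z n where z: "\<forall>j. 0 \<le> z j" "run z n = v" by blast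
  \<comment> \<open>Nonnegative numbers are wanted because \<open>beta\<close> with shift 0 reaches
    nonnegative sequences; a negative number acts like 2k + 1.\<close>
  define y' where "y' = (if 0 \<le> y then y else int (2 * k) + 1)"
  have "op y' v = op y v" by (auto simp: y'_def op_def)
  moreover have "run (z(n := y')) n = v" using z(2) run_cong[of n "z(n := y')" z] by simp
  ultimately have "run (z(n := y')) (Suc n) = op y v" by simp
  moreover have "\<forall>j. 0 \<le> (z(n := y')) j" using z(1) by (simp add: y'_def)
  ultimately show ?case by blast
qed

lemma reach_add_int: "v \<in> reach \<Longrightarrow> v + of_int c \<in> reach"
proof (induction c rule: int_induct_0)
  case (2 c)
  then show ?case using reach_op[of "v + of_int c" "int (2 * k)"] op_add[of "v + of_int c"]
    by (simp add: algebra_simps)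
next
  case (3 c)
  then show ?case using reach_op[of "v + of_int c" "-1"] op_diff[of "-1" "v + of_int c"]
    by (simp add: algebra_simps)
qed simp

lemma reach_mult_X_power: "i < k \<Longrightarrow> v \<in> reach \<Longrightarrow> single (single i c) 1 * v \<in> reach"
proof (induction c rule: int_induct_0)
  case (2 c)
  then show ?case
    using reach_op[of "single (single i c) 1 * v" "int i"]
    by (simp add: op_X X_def mult.assoc[symmetric] mult_single single_add[symmetric] add.commute)
next
  case (3 c)
  then show ?case
    using reach_op[of "single (single i c) 1 * v" "int (k + i)"]
    by (simp add: op_Xi Xi_def mult.assoc[symmetric] mult_single single_add[symmetric] del: of_nat_add)
qed simp

lemma reach_mult_monomial:
  assumes "keys m \<subseteq> {..<k}" "v \<in> reach"
  shows "single m 1 * v \<in> reach"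
proof (induction m rule: poly_mapping_single_induct)
  case zero
  then show ?case using assms(2) by simp
next
  case (add i n)
  have "single (single i (lookup m i) + n) 1 * v = single (single i (lookup m i)) 1 * (single n 1 * v)"
    by (simp only: mult.assoc[symmetric] mult_single) simp
  moreover have "i < k" using add(1) assms(1) by auto
  ultimately show ?case using add(2) reach_mult_X_power[of i "single n 1 * v"] by metis
qed

text \<open>A term c x^m is added by multiplying with x^(-m), adding the constant c and multiplying
  with x^m.\<close>

lemma reach_carrier:
  assumes "f \<in> carrier L"
  shows "f \<in> reach"
proof (induction f rule: poly_mapping_single_induct)
  case zero
  show ?case by (rule reach_0)
next
  case (add m g)
  have m: "keys m \<subseteq> {..<k}" "keys (- m) \<subseteq> {..<k}"
    using add(1) assms by (auto simp: carrier_iff in_keys_iff)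
  let ?c = "lookup f m"
  have "single m 1 * (single (- m) 1 * g + of_int ?c) = single m ?c + g"
    by (simp add: distrib_left mult_single flip: mult.assoc single_of_int)
  moreover have "single m 1 * (single (- m) 1 * g + of_int ?c) \<in> reach"
    using add m by (intro reach_mult_monomial reach_add_int)
  ultimately show ?case by simp
qed

text \<open>The entries of \<open>u\<close> are the length of the scheme and the two numbers of its
  beta code. A negative length would decode to 0, but \<open>Ev\<close> would then not describe the
  value, whence the condition \<open>0 \<le> u ! 0\<close> on codes.\<close>

definition dec :: "int list \<Rightarrow> lpoly" where
  "dec u = run (\<lambda>j. beta (u ! 1) (u ! 2) 0 (int j)) (nat (u ! 0))"

lemma dec_carrier: "dec u \<in> carrier L"
  unfolding dec_def by (rule run_carrier)

lemma dec_surj: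
  assumes "f \<in> carrier L"
  shows "\<exists>u\<in>tuples \<Z> 3. 0 \<le> u ! 0 \<and> dec u = f"
proof -
  obtain z n where z: "\<forall>j. 0 \<le> z j" "run z n = f"
    using reach_run[OF reach_carrier[OF assms]] by blast
  obtain c d where cd: "\<forall>j\<le>n. beta c d 0 (int j) = z j"
    using beta_surj_nonneg[of n z] z(1) by blast
  have "dec [int n, c, d] = f"
    using cd z(2) run_cong[of n "\<lambda>j. beta c d 0 (int j)" z] by (simp add: dec_def)
  then show ?thesis by (intro bexI[of _ "[int n, c, d]"]) (auto simp: tuples_def)
qed

text \<open>\<open>step s C z b b'\<close> transfers \<open>v' = op z v\<close> to the scaled values \<open>b = C v(s)\<close> and
  \<open>b' = C v'(s)\<close>; the factor \<open>C\<close> keeps them integral.\<close>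

definition step :: "int list \<Rightarrow> int \<Rightarrow> int \<Rightarrow> int \<Rightarrow> int \<Rightarrow> bool" where
  "step s C z b b' \<longleftrightarrow>
     (\<forall>i<k. z = int i \<longrightarrow> b' = s ! i * b) \<and> (\<forall>i<k. z = int (k + i) \<longrightarrow> b = s ! i * b') \<and>
     (z = int (2 * k) \<longrightarrow> b' = b + C) \<and> ((\<forall>i<2 * k + 1. z \<noteq> int i) \<longrightarrow> b = b' + C)"

text \<open>The existence of a computation: a beta-coded sequence that starts at 0, follows the
  scheme and ends in \<open>b\<close>. The shift \<open>M\<close> admits negative values. The values
  of \<open>beta\<close> are named by variables \<open>z\<close>, \<open>x\<close>,
  \<open>y\<close>, because \<open>beta\<close> is a definable relation and not a term.\<close>

definition Ev :: "int list \<Rightarrow> int list \<Rightarrow> int \<Rightarrow> int \<Rightarrow> bool" where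
  "Ev u s C b \<longleftrightarrow> nonzero k s \<and> C \<noteq> 0 \<and>
     (\<exists>c d M. beta c d M 0 = 0 \<and>
       (\<forall>j. 0 \<le> j \<and> j < u ! 0 \<longrightarrow>
         (\<forall>z x y. beta (u ! 1) (u ! 2) 0 j = z \<longrightarrow> beta c d M j = x \<longrightarrow> beta c d M (j + 1) = y \<longrightarrow>
            step s C z x y)) \<and>
       beta c d M (u ! 0) = b)"

text \<open>The step for an inverse variable is stated without division as
  \<open>b = s ! i * b'\<close>; this determines \<open>b'\<close> because the coordinates of
  \<open>s\<close> are nonzero.\<close>

lemma step_iff:
  assumes "nonzero k s" "of_int b = of_int C * ev s v"
  shows "step s C z b b' \<longleftrightarrow> of_int b' = of_int C * ev s (op z v)"
proof (cases z rule: op_cases)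
  case (X i)
  have "\<not> (\<forall>j<2 * k + 1. z \<noteq> int j)" using X by (auto intro!: exI[of _ "i"])
  then have "step s C z b b' \<longleftrightarrow> (\<forall>i<k. z = int i \<longrightarrow> b' = s ! i * b) \<and>
      (\<forall>i<k. z = int (k + i) \<longrightarrow> b = s ! i * b') \<and> (z = int (2 * k) \<longrightarrow> b' = b + C)"
    unfolding step_def by blast
  also have "\<dots> \<longleftrightarrow> b' = s ! i * b" using X by auto
  also have "\<dots> \<longleftrightarrow> (of_int b' :: rat) = of_int (s ! i) * of_int b"
    by (simp flip: of_int_mult)
  finally show ?thesis using X assms by (simp add: op_X ev_mult ev_X mult_ac)
next
  case (Xi i)
  have si: "s ! i \<noteq> 0" using assms Xi by (auto simp: nonzero_def)
  have "\<not> (\<forall>j<2 * k + 1. z \<noteq> int j)" using Xi by (auto intro!: exI[of _ "k + i"])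
  then have "step s C z b b' \<longleftrightarrow> (\<forall>i<k. z = int i \<longrightarrow> b' = s ! i * b) \<and>
      (\<forall>i<k. z = int (k + i) \<longrightarrow> b = s ! i * b') \<and> (z = int (2 * k) \<longrightarrow> b' = b + C)"
    unfolding step_def by blast
  also have "\<dots> \<longleftrightarrow> b = s ! i * b'" using Xi by auto
  also have "\<dots> \<longleftrightarrow> (of_int b :: rat) = of_int (s ! i) * of_int b'"
    by (simp flip: of_int_mult)
  also have "\<dots> \<longleftrightarrow> (of_int b' :: rat) = inverse (of_int (s ! i)) * of_int b"
    using si by (auto simp: field_simps)
  finally show ?thesis using Xi assms by (simp add: op_Xi ev_mult ev_X mult_ac del: of_nat_add)
next
  case add
  have "step s C z b b' \<longleftrightarrow> b' = b + C" using add by (auto simp: step_def)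
  also have "\<dots> \<longleftrightarrow> (of_int b' :: rat) = of_int b + of_int C" by (simp flip: of_int_add)
  finally show ?thesis using assms unfolding add op_add by (simp add: ev_add algebra_simps)
next
  case diff
  have "z \<noteq> int i" "z \<noteq> int (k + i)" if "i < k" for i
    using diff[rule_format, of i] diff[rule_format, of "k + i"] that by simp_all
  moreover have "z \<noteq> int (2 * k)" using diff[rule_format, of "2 * k"] by simp
  ultimately have "step s C z b b' \<longleftrightarrow> b = b' + C" using diff unfolding step_def by blast
  also have "\<dots> \<longleftrightarrow> (of_int b :: rat) = of_int b' + of_int C" by (simp flip: of_int_add)
  finally show ?thesis using assms by (auto simp: op_diff[OF diff] ev_diff algebra_simps)
qed

section \<open>Scaled values of coded polynomials\<close>

lemma Ev_nonzero: "Ev u s C b \<Longrightarrow> nonzero k s \<and> C \<noteq> 0"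
  by (simp add: Ev_def)

text \<open>Invariants of the computation in \<open>Ev\<close>. One application computes the value
  \<open>b\<close>, another the congruence between the decoded polynomial and \<open>b\<close> in
  the Laurent ring.\<close>

lemma Ev_induct:
  assumes "Ev u s C b" "0 \<le> u ! 0"
    and "P 0 0"
    and "\<And>v x y z. P v x \<Longrightarrow> v \<in> carrier L \<Longrightarrow> step s C z x y \<Longrightarrow> P (op z v) y"
  shows "P (dec u) b"
proof -
  let ?z = "\<lambda>j. beta (u ! 1) (u ! 2) 0 (int j)"
  obtain c d M where cdM: "beta c d M 0 = 0" "beta c d M (u ! 0) = b"
    "\<And>j. 0 \<le> j \<Longrightarrow> j < u ! 0 \<Longrightarrow> step s C (beta (u ! 1) (u ! 2) 0 j) (beta c d M j) (beta c d M (j + 1))"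
    using assms(1) unfolding Ev_def by blast
  have "P (run ?z n) (beta c d M (int n))" if "int n \<le> u ! 0" for n
    using that
  proof (induction n)
    case 0
    then show ?case using assms(3) cdM(1) by simp
  next
    case (Suc n)
    then have "step s C (?z n) (beta c d M (int n)) (beta c d M (int n + 1))" by (intro cdM(3)) auto
    then show ?case using Suc assms(4) run_carrier by (simp add: add.commute)
  qed
  from this[of "nat (u ! 0)"] show ?thesis using assms(2) cdM(2) by (simp add: dec_def)
qed

lemma Ev_value: "Ev u s C b \<Longrightarrow> 0 \<le> u ! 0 \<Longrightarrow> of_int b = of_int C * ev s (dec u)"
proof -
  assume E: "Ev u s C b" and u: "0 \<le> u ! 0"
  show ?thesis
  proof (rule Ev_induct[where P = "\<lambda>v x. of_int x = of_int C * ev s v", OF E u])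
    fix v x y z
    assume "of_int x = of_int C * ev s v" "step s C z x y"
    then show "of_int y = of_int C * ev s (op z v)"
      using step_iff Ev_nonzero[OF E] by blast
  qed simp
qed

lemma common_denominator:
  fixes q :: "nat \<Rightarrow> rat"
  shows "\<exists>C>0. \<forall>C'. C dvd C' \<longrightarrow> (\<forall>j\<le>n. of_int C' * q j \<in> \<int>)"
proof (induction n)
  case 0
  obtain a b where "quotient_of (q 0) = (a, b)" by (cases "quotient_of (q 0)")
  then have ab: "q 0 = of_int a / of_int b" "b > 0"
    using quotient_of_div quotient_of_denom_pos by auto
  show ?case by (rule exI[of _ b]) (use ab in \<open>auto elim!: dvdE\<close>)
next
  case (Suc n)
  then obtain C where C: "C > 0" "\<forall>C'. C dvd C' \<longrightarrow> (\<forall>j\<le>n. of_int C' * q j \<in> \<int>)" by blast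
  obtain a b where "quotient_of (q (Suc n)) = (a, b)" by (cases "quotient_of (q (Suc n))")
  then have ab: "q (Suc n) = of_int a / of_int b" "b > 0"
    using quotient_of_div quotient_of_denom_pos by auto
  have "of_int C' * q (Suc n) \<in> \<int>" if "C * b dvd C'" for C'
    using that ab C(1) by (auto elim!: dvdE)
  moreover have "C dvd C'" if "C * b dvd C'" for C' using that by (rule dvd_mult_left)
  ultimately show ?case using C ab by (intro exI[of _ "C * b"]) (auto simp: le_Suc_eq)
qed

text \<open>A common denominator of all intermediate values makes the scaled sequence integral, and
  the beta function encodes it.\<close>

lemma Ev_exists:
  assumes s: "nonzero k s" and u: "0 \<le> u ! 0"
  shows "\<exists>C0>0. \<forall>C. C0 dvd C \<longrightarrow> C \<noteq> 0 \<longrightarrow> (\<exists>b. Ev u s C b)"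
proof -
  let ?z = "\<lambda>j. beta (u ! 1) (u ! 2) 0 (int j)"
  let ?n = "nat (u ! 0)"
  obtain C0 where C0: "C0 > 0" "\<And>C j. C0 dvd C \<Longrightarrow> j \<le> ?n \<Longrightarrow> of_int C * ev s (run ?z j) \<in> \<int>"
    using common_denominator[of ?n "\<lambda>j. ev s (run ?z j)"] by blast
  have "\<exists>b. Ev u s C b" if C: "C0 dvd C" "C \<noteq> 0" for C
  proof -
    have "\<forall>j. \<exists>b. j \<le> ?n \<longrightarrow> of_int b = of_int C * ev s (run ?z j)"
      using C0(2)[OF C(1)] by (metis Ints_cases)
    then obtain b where b: "\<And>j. j \<le> ?n \<Longrightarrow> of_int (b j) = of_int C * ev s (run ?z j)" by metis
    obtain c d M where cdM: "\<And>j. j \<le> ?n \<Longrightarrow> beta c d M (int j) = b j"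
      using beta_surj[of ?n b] by blast
    have "beta c d M 0 = 0" using cdM[of 0] b[of 0] by simp
    moreover have "step s C (beta (u ! 1) (u ! 2) 0 j) (beta c d M j) (beta c d M (j + 1))"
      if j: "0 \<le> j" "j < u ! 0" for j
    proof -
      obtain i where i: "j = int i" using j(1) by (metis nonneg_int_cases)
      have le: "i \<le> ?n" "Suc i \<le> ?n" using j i by auto
      have "beta c d M (int i + 1) = b (Suc i)" using cdM[OF le(2)] by (simp add: add.commute)
      then show ?thesis unfolding i cdM[OF le(1)]
        using step_iff[OF s b[OF le(1)], of "?z i" "b (Suc i)"] b[OF le(2)] by simp
    qed
    ultimately show ?thesis
      unfolding Ev_def using s C(2) by (intro exI[of _ "beta c d M (u ! 0)"]) blast
  qed
  then show ?thesis using C0(1) by blast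
qed

end

section \<open>First-order description of coordinate maps\<close>

lemma vdef_slice: "i + m \<le> n \<Longrightarrow> vdef R n m (\<lambda>e. take m (drop i e))"
  unfolding vdef_def
proof (intro conjI ballI allI impI)
  fix j assume "i + m \<le> n" "j < m"
  then show "tdef R n (\<lambda>e. take m (drop i e) ! j)"
    by (subst tdef_cong[where G = "\<lambda>e. e ! (i + j)"]) (auto simp: tuples_length intro: tdef_nth)
qed (auto simp: tuples_length)

text \<open>The condition \<open>codes\<close> speaks of a map, over which a formula cannot
  quantify. With the map replaced by a definable graph \<open>T\<close>, only quantifiers over
  elements and tuples remain.\<close>

definition graph_codes ::
  "rcode \<Rightarrow> ('a, 'm) ring_scheme \<Rightarrow> 'a list \<Rightarrow> ('a list \<Rightarrow> 'a \<Rightarrow> bool) \<Rightarrow> bool" where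
  "graph_codes \<Gamma> R p T \<longleftrightarrow>
     (\<forall>u\<in>tuples R (cdim \<Gamma>). \<forall>f\<in>carrier R. \<forall>g\<in>carrier R. T u f \<longrightarrow> T u g \<longrightarrow> f = g) \<and>
     (\<forall>u\<in>tuples R (cdim \<Gamma>). sat R (u @ p) (cdom \<Gamma>) \<longrightarrow> (\<exists>f\<in>carrier R. T u f)) \<and>
     (\<forall>u\<in>tuples R (cdim \<Gamma>). \<forall>f\<in>carrier R. T u f \<longrightarrow> sat R (u @ p) (cdom \<Gamma>)) \<and>
     (\<forall>f\<in>carrier R. \<exists>u\<in>tuples R (cdim \<Gamma>). T u f) \<and>
     (\<forall>u\<in>tuples R (cdim \<Gamma>). \<forall>f\<in>carrier R. T u f \<longrightarrow> (sat R (u @ p) (czero \<Gamma>) \<longleftrightarrow> f = \<zero>\<^bsub>R\<^esub>)) \<and>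
     (\<forall>u\<in>tuples R (cdim \<Gamma>). \<forall>f\<in>carrier R. T u f \<longrightarrow> (sat R (u @ p) (cone \<Gamma>) \<longleftrightarrow> f = \<one>\<^bsub>R\<^esub>)) \<and>
     (\<forall>u\<in>tuples R (cdim \<Gamma>). \<forall>v\<in>tuples R (cdim \<Gamma>). \<forall>f\<in>carrier R. \<forall>g\<in>carrier R.
        T u f \<longrightarrow> T v g \<longrightarrow> (sat R (u @ v @ p) (ceq \<Gamma>) \<longleftrightarrow> f = g)) \<and>
     (\<forall>u\<in>tuples R (cdim \<Gamma>). \<forall>v\<in>tuples R (cdim \<Gamma>). \<forall>w\<in>tuples R (cdim \<Gamma>).
        \<forall>f\<in>carrier R. \<forall>g\<in>carrier R. \<forall>h\<in>carrier R. T u f \<longrightarrow> T v g \<longrightarrow> T w h \<longrightarrow>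
          (sat R (u @ v @ w @ p) (cadd \<Gamma>) \<longleftrightarrow> f \<oplus>\<^bsub>R\<^esub> g = h)) \<and>
     (\<forall>u\<in>tuples R (cdim \<Gamma>). \<forall>v\<in>tuples R (cdim \<Gamma>). \<forall>w\<in>tuples R (cdim \<Gamma>).
        \<forall>f\<in>carrier R. \<forall>g\<in>carrier R. \<forall>h\<in>carrier R. T u f \<longrightarrow> T v g \<longrightarrow> T w h \<longrightarrow>
          (sat R (u @ v @ w @ p) (cmul \<Gamma>) \<longleftrightarrow> f \<otimes>\<^bsub>R\<^esub> g = h))"

lemma graph_codesI:
  assumes c: "codes \<Gamma> R p R \<mu>"
    and T: "\<And>u f. u \<in> tuples R (cdim \<Gamma>) \<Longrightarrow> f \<in> carrier R \<Longrightarrow> T u f \<longleftrightarrow> u \<in> code_dom \<Gamma> R p \<and> f = \<mu> u"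
  shows "graph_codes \<Gamma> R p T"
proof -
  have d: "sat R (u @ p) (cdom \<Gamma>) \<longleftrightarrow> u \<in> code_dom \<Gamma> R p" if "u \<in> tuples R (cdim \<Gamma>)" for u
    using that by (simp add: code_dom_def)
  have surj: "\<exists>u\<in>tuples R (cdim \<Gamma>). u \<in> code_dom \<Gamma> R p \<and> f = \<mu> u" if f: "f \<in> carrier R" for f
  proof -
    have "f \<in> \<mu> ` code_dom \<Gamma> R p" using codesD(1)[OF c] f by simp
    then obtain u where u: "u \<in> code_dom \<Gamma> R p" "f = \<mu> u" by blast
    then have "u \<in> tuples R (cdim \<Gamma>)" by (simp add: code_dom_def)
    then show ?thesis using u by blast
  qed
  show ?thesis
    unfolding graph_codes_def
    using codes_mem[OF c] surj by (simp add: T d codesD(2-6)[OF c])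
qed

text \<open>The first three conditions make \<open>T\<close> the graph of a function on the code
  domain, which is recovered by choice; the others are those of \<open>codes\<close>.\<close>

lemma graph_codesD:
  assumes g: "graph_codes \<Gamma> R p T"
  shows "\<exists>\<mu>. codes \<Gamma> R p R \<mu> \<and>
    (\<forall>u\<in>tuples R (cdim \<Gamma>). \<forall>f\<in>carrier R. T u f \<longleftrightarrow> u \<in> code_dom \<Gamma> R p \<and> f = \<mu> u)"
proof -
  define \<mu> where "\<mu> u = (SOME f. f \<in> carrier R \<and> T u f)" for u
  let ?U = "tuples R (cdim \<Gamma>)"
  note G = g[unfolded graph_codes_def]
  note fn = G[THEN conjunct1] and G = G[THEN conjunct2]
  note tot = G[THEN conjunct1] and G = G[THEN conjunct2]
  note dm = G[THEN conjunct1] and G = G[THEN conjunct2]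
  note surj = G[THEN conjunct1] and G = G[THEN conjunct2]
  have dom: "u \<in> code_dom \<Gamma> R p \<longleftrightarrow> u \<in> ?U \<and> sat R (u @ p) (cdom \<Gamma>)" for u
    by (simp add: code_dom_def)
  have \<mu>: "\<mu> u \<in> carrier R \<and> T u (\<mu> u)" if "u \<in> code_dom \<Gamma> R p" for u
  proof -
    have "\<exists>f. f \<in> carrier R \<and> T u f" using tot that dom by blast
    then show ?thesis unfolding \<mu>_def by (rule someI_ex)
  qed
  have T: "T u f \<longleftrightarrow> u \<in> code_dom \<Gamma> R p \<and> f = \<mu> u" if "u \<in> ?U" "f \<in> carrier R" for u f
  proof
    assume "T u f"
    then have "u \<in> code_dom \<Gamma> R p" using dm that dom by blast
    then show "u \<in> code_dom \<Gamma> R p \<and> f = \<mu> u" using \<mu> fn that \<open>T u f\<close> by blast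
  qed (use \<mu> in blast)
  have im: "\<mu> ` code_dom \<Gamma> R p = carrier R"
  proof (intro equalityI subsetI)
    fix f assume f: "f \<in> carrier R"
    then obtain u where "u \<in> ?U" "T u f" using surj by blast
    then show "f \<in> \<mu> ` code_dom \<Gamma> R p" using T f by blast
  qed (use \<mu> in blast)
  have "codes \<Gamma> R p R \<mu>"
    unfolding codes_def
  proof (intro conjI ballI)
    show "\<mu> ` code_dom \<Gamma> R p = carrier R" by (rule im)
  next
    fix a assume a: "a \<in> code_dom \<Gamma> R p"
    then have 1: "a \<in> ?U" "\<mu> a \<in> carrier R" "T a (\<mu> a)" using \<mu> dom by blast+
    show "sat R (a @ p) (czero \<Gamma>) \<longleftrightarrow> \<mu> a = \<zero>\<^bsub>R\<^esub>" "sat R (a @ p) (cone \<Gamma>) \<longleftrightarrow> \<mu> a = \<one>\<^bsub>R\<^esub>"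
      using G 1 by blast+
    fix b assume "b \<in> code_dom \<Gamma> R p"
    then have 2: "b \<in> ?U" "\<mu> b \<in> carrier R" "T b (\<mu> b)" using \<mu> dom by blast+
    note G = G[THEN conjunct2, THEN conjunct2]
    show "sat R (a @ b @ p) (ceq \<Gamma>) \<longleftrightarrow> \<mu> a = \<mu> b"
      using G[THEN conjunct1, rule_format, OF 1(1) 2(1) 1(2) 2(2) 1(3) 2(3)] .
    fix c assume "c \<in> code_dom \<Gamma> R p"
    then have 3: "c \<in> ?U" "\<mu> c \<in> carrier R" "T c (\<mu> c)" using \<mu> dom by blast+
    note G = G[THEN conjunct2]
    show "sat R (a @ b @ c @ p) (cadd \<Gamma>) \<longleftrightarrow> \<mu> a \<oplus>\<^bsub>R\<^esub> \<mu> b = \<mu> c"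
      using G[THEN conjunct1, rule_format, OF 1(1) 2(1) 3(1) 1(2) 2(2) 3(2) 1(3) 2(3) 3(3)] .
    show "sat R (a @ b @ c @ p) (cmul \<Gamma>) \<longleftrightarrow> \<mu> a \<otimes>\<^bsub>R\<^esub> \<mu> b = \<mu> c"
      using G[THEN conjunct2, rule_format, OF 1(1) 2(1) 3(1) 1(2) 2(2) 3(2) 1(3) 2(3) 3(3)] .
  qed
  then show ?thesis using T by blast
qed

text \<open>Definability of \<open>T\<close> is assumed for environments of every length, since it
  is applied below varying numbers of quantifiers.\<close>

lemma rdef_graph_codes:
  assumes wf: "wf_rcode \<Gamma>" and P: "vdef R m (cpar \<Gamma>) P"
    and T: "\<And>n U F P. vdef R n (cdim \<Gamma>) U \<Longrightarrow> tdef R n F \<Longrightarrow> vdef R n (cpar \<Gamma>) P \<Longrightarrow>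
      rdef R n (\<lambda>e. T (P e) (U e) (F e))"
  shows "rdef R m (\<lambda>e. graph_codes \<Gamma> R (P e) (T (P e)))"
proof -
  let ?n = "cdim \<Gamma>" and ?l = "cpar \<Gamma>"
  have e: "2 * ?n + ?l = ?n + (?n + ?l)" "3 * ?n + ?l = ?n + (?n + (?n + ?l))" by simp_all
  have v: "vars_below (?n + ?l) (cdom \<Gamma>)" "vars_below (?n + (?n + ?l)) (ceq \<Gamma>)"
    "vars_below (?n + ?l) (czero \<Gamma>)" "vars_below (?n + ?l) (cone \<Gamma>)"
    "vars_below (?n + (?n + (?n + ?l))) (cadd \<Gamma>)" "vars_below (?n + (?n + (?n + ?l))) (cmul \<Gamma>)"
    using wf unfolding wf_rcode_def e by blast+
  note S = v[THEN rdef_sat]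
  show ?thesis
    unfolding graph_codes_def
    by (rule rdef_conj rdef_all_tuple rdef_ex_tuple rdef_all rdef_ex rdef_imp rdef_iff S T
        rdef_eq tdef_zero tdef_one tdef_add tdef_mult tdef_hd tdef_tl tdef_drop
        vdef_append vdef_take vdef_tl vdef_drop P)+
qed

context laurent
begin

section \<open>The interpretation in the integers\<close>

lemma rdefZ_nonzero: "vdef \<Z> n k S \<Longrightarrow> rdef \<Z> n (\<lambda>e. nonzero k (S e))"
  unfolding nonzero_def
  by (intro rdef_ball_lessThan rdef_not rdef_eq tdefZ_zero vdef_nth)

lemma rdefZ_step:
  assumes "vdef \<Z> n k S" "tdef \<Z> n C" "tdef \<Z> n z" "tdef \<Z> n b" "tdef \<Z> n b'"
  shows "rdef \<Z> n (\<lambda>e. step (S e) (C e) (z e) (b e) (b' e))"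
  unfolding step_def
  by (rule rdef_conj rdef_imp rdef_ball_lessThan rdef_not rdef_eq tdefZ_int tdefZ_add tdefZ_mult
      vdef_nth assms | assumption)+

lemma rdefZ_Ev:
  assumes U: "vdef \<Z> n 3 U" and S: "vdef \<Z> n k S" and C: "tdef \<Z> n C" and b: "tdef \<Z> n b"
  shows "rdef \<Z> n (\<lambda>e. Ev (U e) (S e) (C e) (b e))"
proof -
  have u: "tdef \<Z> n (\<lambda>e. U e ! 0)" "tdef \<Z> n (\<lambda>e. U e ! 1)" "tdef \<Z> n (\<lambda>e. U e ! 2)"
    by (rule vdef_nth[OF U]; simp)+
  show ?thesis
    unfolding Ev_def
    by (rule rdefZ_nonzero rdef_conj rdef_not rdefZ_ex rdefZ_all rdef_imp rdefZ_beta rdefZ_le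
        rdefZ_less rdefZ_step rdef_eq tdefZ_intros tdef_tl vdef_tl u S C b)+
qed

text \<open>The product of the three denominators is a common scaling factor.\<close>

lemma Ev_exists3:
  assumes s: "nonzero k s" and u: "0 \<le> u ! 0" "0 \<le> v ! 0" "0 \<le> w ! 0"
  shows "\<exists>C a b c. Ev u s C a \<and> Ev v s C b \<and> Ev w s C c"
proof -
  obtain C1 C2 C3 where C: "C1 > 0" "C2 > 0" "C3 > 0"
    "\<And>C. C1 dvd C \<Longrightarrow> C \<noteq> 0 \<Longrightarrow> \<exists>b. Ev u s C b"
    "\<And>C. C2 dvd C \<Longrightarrow> C \<noteq> 0 \<Longrightarrow> \<exists>b. Ev v s C b"
    "\<And>C. C3 dvd C \<Longrightarrow> C \<noteq> 0 \<Longrightarrow> \<exists>b. Ev w s C b"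
    using Ev_exists[OF s u(1)] Ev_exists[OF s u(2)] Ev_exists[OF s u(3)] by metis
  define C where "C = C1 * C2 * C3"
  have C': "C \<noteq> 0" "C1 dvd C" "C2 dvd C" "C3 dvd C"
    using C(1-3) by (auto simp: C_def)
  obtain a b c where "Ev u s C a" "Ev v s C b" "Ev w s C c"
    using C(4)[OF C'(2,1)] C(5)[OF C'(3,1)] C(6)[OF C'(4,1)] by blast
  then show ?thesis by blast
qed

lemma of_int_eq_rat: "(of_int a :: rat) = of_int b \<Longrightarrow> a = b"
  by simp

text \<open>By \<open>Ev_value\<close> the numbers predicted by equal polynomials agree for every
  scaling factor. Conversely, one common factor at each point suffices: it is nonzero and can be
  cancelled, and values at points without zero coordinates separate polynomials.\<close>

lemma dec_eq_iff:
  assumes u: "0 \<le> u ! 0" "0 \<le> v ! 0"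
  shows "dec u = dec v \<longleftrightarrow> (\<forall>s\<in>tuples \<Z> k. \<forall>C a b. Ev u s C a \<longrightarrow> Ev v s C b \<longrightarrow> a = b)"
proof (intro iffI ballI allI impI)
  fix s C a b assume *: "dec u = dec v" "Ev u s C a" "Ev v s C b"
  then show "a = b" using Ev_value[OF *(2) u(1)] Ev_value[OF *(3) u(2)] by (intro of_int_eq_rat) simp
next
  assume *: "\<forall>s\<in>tuples \<Z> k. \<forall>C a b. Ev u s C a \<longrightarrow> Ev v s C b \<longrightarrow> a = b"
  show "dec u = dec v"
  proof (rule ev_separates[OF dec_carrier dec_carrier])
    fix s assume s: "s \<in> tuples \<Z> k" "nonzero k s"
    obtain C a b where E: "Ev u s C a" "Ev v s C b" using Ev_exists3[OF s(2) u u(1)] by blast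
    then have "a = b" using * s by blast
    then show "ev s (dec u) = ev s (dec v)"
      using Ev_value[OF E(1) u(1)] Ev_value[OF E(2) u(2)] Ev_nonzero[OF E(1)] by simp
  qed
qed

lemma dec_add_iff:
  assumes u: "0 \<le> u ! 0" "0 \<le> v ! 0" "0 \<le> w ! 0"
  shows "dec u + dec v = dec w \<longleftrightarrow>
    (\<forall>s\<in>tuples \<Z> k. \<forall>C a b c. Ev u s C a \<longrightarrow> Ev v s C b \<longrightarrow> Ev w s C c \<longrightarrow> a + b = c)"
proof (intro iffI ballI allI impI)
  fix s C a b c assume *: "dec u + dec v = dec w" "Ev u s C a" "Ev v s C b" "Ev w s C c"
  show "a + b = c"
    using Ev_value[OF *(2) u(1)] Ev_value[OF *(3) u(2)] Ev_value[OF *(4) u(3)]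
    by (intro of_int_eq_rat) (simp add: ev_add distrib_left flip: *(1))
next
  assume *: "\<forall>s\<in>tuples \<Z> k. \<forall>C a b c. Ev u s C a \<longrightarrow> Ev v s C b \<longrightarrow> Ev w s C c \<longrightarrow> a + b = c"
  show "dec u + dec v = dec w"
  proof (rule ev_separates[OF carrier_add[OF dec_carrier dec_carrier] dec_carrier])
    fix s assume s: "s \<in> tuples \<Z> k" "nonzero k s"
    obtain C a b c where E: "Ev u s C a" "Ev v s C b" "Ev w s C c" using Ev_exists3[OF s(2) u] by blast
    then have "(of_int a :: rat) + of_int b = of_int c" using * s by (metis of_int_add)
    then have "of_int C * (ev s (dec u) + ev s (dec v)) = of_int C * ev s (dec w)"
      using Ev_value[OF E(1) u(1)] Ev_value[OF E(2) u(2)] Ev_value[OF E(3) u(3)]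
      by (simp add: distrib_left)
    then show "ev s (dec u + dec v) = ev s (dec w)" using Ev_nonzero[OF E(1)] by (simp add: ev_add)
  qed
qed

text \<open>The product of two scaled values carries the factor C twice, hence \<open>C * c\<close>
  on the right.\<close>

lemma dec_mult_iff:
  assumes u: "0 \<le> u ! 0" "0 \<le> v ! 0" "0 \<le> w ! 0"
  shows "dec u * dec v = dec w \<longleftrightarrow>
    (\<forall>s\<in>tuples \<Z> k. \<forall>C a b c. Ev u s C a \<longrightarrow> Ev v s C b \<longrightarrow> Ev w s C c \<longrightarrow> a * b = C * c)"
proof (intro iffI ballI allI impI)
  fix s C a b c assume *: "dec u * dec v = dec w" "Ev u s C a" "Ev v s C b" "Ev w s C c"
  have "nonzero k s" using Ev_nonzero[OF *(2)] by simp
  then show "a * b = C * c"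
    using Ev_value[OF *(2) u(1)] Ev_value[OF *(3) u(2)] Ev_value[OF *(4) u(3)]
    by (intro of_int_eq_rat) (simp add: ev_mult flip: *(1))
next
  assume *: "\<forall>s\<in>tuples \<Z> k. \<forall>C a b c. Ev u s C a \<longrightarrow> Ev v s C b \<longrightarrow> Ev w s C c \<longrightarrow> a * b = C * c"
  show "dec u * dec v = dec w"
  proof (rule ev_separates[OF carrier_mult[OF dec_carrier dec_carrier] dec_carrier])
    fix s assume s: "s \<in> tuples \<Z> k" "nonzero k s"
    obtain C a b c where E: "Ev u s C a" "Ev v s C b" "Ev w s C c" using Ev_exists3[OF s(2) u] by blast
    then have "(of_int a :: rat) * of_int b = of_int C * of_int c" using * s by (metis of_int_mult)
    then have "of_int C * (of_int C * (ev s (dec u) * ev s (dec v))) = of_int C * (of_int C * ev s (dec w))"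
      using Ev_value[OF E(1) u(1)] Ev_value[OF E(2) u(2)] Ev_value[OF E(3) u(3)]
      by (simp add: mult_ac)
    then show "ev s (dec u * dec v) = ev s (dec w)"
      using Ev_nonzero[OF E(1)] s by (simp add: ev_mult)
  qed
qed

text \<open>Describes the codes of 0 and 1, and later the coordinate map of the composite over the
  integers.\<close>

lemma dec_of_int_iff:
  assumes u: "0 \<le> u ! 0"
  shows "dec u = of_int x \<longleftrightarrow> (\<forall>s\<in>tuples \<Z> k. \<forall>C a. Ev u s C a \<longrightarrow> a = C * x)"
proof (intro iffI ballI allI impI)
  fix s C a assume *: "dec u = of_int x" "Ev u s C a"
  then show "a = C * x" using Ev_value[OF *(2) u(1)] by (intro of_int_eq_rat) (simp add: ev_of_int)
next
  assume *: "\<forall>s\<in>tuples \<Z> k. \<forall>C a. Ev u s C a \<longrightarrow> a = C * x"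
  show "dec u = of_int x"
  proof (rule ev_separates[OF dec_carrier carrier_of_int])
    fix s assume s: "s \<in> tuples \<Z> k" "nonzero k s"
    obtain C a where E: "Ev u s C a" using Ev_exists3[OF s(2) u u u] by blast
    then have "a = C * x" using * s by blast
    then show "ev s (dec u) = ev s (of_int x)"
      using Ev_value[OF E u] Ev_nonzero[OF E] by (simp add: ev_of_int)
  qed
qed

lemmas rdefZ_dec_intros = rdefZ_Ev rdef_all_tuple rdefZ_all rdef_imp rdef_eq tdefZ_intros tdef_tl tdef_drop
  vdef_take vdef_tl vdef_drop

lemma rdefZ_dec_of_int:
  assumes "vdef \<Z> n 3 U" "tdef \<Z> n F"
  shows "rdef \<Z> n (\<lambda>e. \<forall>s\<in>tuples \<Z> k. \<forall>C a. Ev (U e) s C a \<longrightarrow> a = C * F e)"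
  by (rule rdefZ_dec_intros assms)+

definition codeset :: "int list set" where
  "codeset = {u \<in> tuples \<Z> 3. 0 \<le> u ! 0}"

lemma interpretation_in_int:
  "\<exists>\<Gamma>. wf_rcode \<Gamma> \<and> cdim \<Gamma> = 3 \<and> cpar \<Gamma> = 0 \<and> code_dom \<Gamma> \<Z> [] = codeset \<and> codes \<Gamma> \<Z> [] L dec"
proof -
  have U1: "vdef \<Z> 3 3 (\<lambda>e. e)" by (rule vdef_id)
  have U2: "vdef \<Z> 6 3 (take 3)" "vdef \<Z> 6 3 (\<lambda>e. take 3 (drop 3 e))"
    using vdef_slice[of 0 3 6 \<Z>] vdef_slice[of 3 3 6 \<Z>] by simp_all
  have U3: "vdef \<Z> 9 3 (take 3)" "vdef \<Z> 9 3 (\<lambda>e. take 3 (drop 3 e))" "vdef \<Z> 9 3 (\<lambda>e. take 3 (drop 6 e))"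
    using vdef_slice[of 0 3 9 \<Z>] vdef_slice[of 3 3 9 \<Z>] vdef_slice[of 6 3 9 \<Z>] by simp_all
  have "rdef \<Z> 3 (\<lambda>e. 0 \<le> e ! 0)" by (intro rdefZ_nonneg tdef_nth) simp
  then obtain \<phi>d where d: "vars_below 3 \<phi>d" "\<And>e. e \<in> tuples \<Z> 3 \<Longrightarrow> sat \<Z> e \<phi>d \<longleftrightarrow> 0 \<le> e ! 0"
    unfolding rdef_def by blast
  obtain \<phi>0 where z: "vars_below 3 \<phi>0" "\<And>e. e \<in> tuples \<Z> 3 \<Longrightarrow>
      sat \<Z> e \<phi>0 \<longleftrightarrow> (\<forall>s\<in>tuples \<Z> k. \<forall>C a. Ev e s C a \<longrightarrow> a = C * 0)"
    using rdefZ_dec_of_int[OF U1 tdefZ_zero] unfolding rdef_def by blast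
  obtain \<phi>1 where o: "vars_below 3 \<phi>1" "\<And>e. e \<in> tuples \<Z> 3 \<Longrightarrow>
      sat \<Z> e \<phi>1 \<longleftrightarrow> (\<forall>s\<in>tuples \<Z> k. \<forall>C a. Ev e s C a \<longrightarrow> a = C * 1)"
    using rdefZ_dec_of_int[OF U1 tdefZ_one] unfolding rdef_def by blast
  have "rdef \<Z> 6 (\<lambda>e. \<forall>s\<in>tuples \<Z> k. \<forall>C a b.
      Ev (take 3 e) s C a \<longrightarrow> Ev (take 3 (drop 3 e)) s C b \<longrightarrow> a = b)"
    by (rule rdefZ_dec_intros U2)+
  then obtain \<phi>e where e: "vars_below 6 \<phi>e" "\<And>e. e \<in> tuples \<Z> 6 \<Longrightarrow> sat \<Z> e \<phi>e \<longleftrightarrow> (\<forall>s\<in>tuples \<Z> k. \<forall>C a b.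
      Ev (take 3 e) s C a \<longrightarrow> Ev (take 3 (drop 3 e)) s C b \<longrightarrow> a = b)"
    unfolding rdef_def by blast
  have "rdef \<Z> 9 (\<lambda>e. \<forall>s\<in>tuples \<Z> k. \<forall>C a b c.
      Ev (take 3 e) s C a \<longrightarrow> Ev (take 3 (drop 3 e)) s C b \<longrightarrow> Ev (take 3 (drop 6 e)) s C c \<longrightarrow> a + b = c)"
    by (rule rdefZ_dec_intros U3)+
  then obtain \<phi>a where a: "vars_below 9 \<phi>a" "\<And>e. e \<in> tuples \<Z> 9 \<Longrightarrow> sat \<Z> e \<phi>a \<longleftrightarrow> (\<forall>s\<in>tuples \<Z> k. \<forall>C a b c.
      Ev (take 3 e) s C a \<longrightarrow> Ev (take 3 (drop 3 e)) s C b \<longrightarrow> Ev (take 3 (drop 6 e)) s C c \<longrightarrow> a + b = c)"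
    unfolding rdef_def by blast
  have "rdef \<Z> 9 (\<lambda>e. \<forall>s\<in>tuples \<Z> k. \<forall>C a b c.
      Ev (take 3 e) s C a \<longrightarrow> Ev (take 3 (drop 3 e)) s C b \<longrightarrow> Ev (take 3 (drop 6 e)) s C c \<longrightarrow> a * b = C * c)"
    by (rule rdefZ_dec_intros U3)+
  then obtain \<phi>m where m: "vars_below 9 \<phi>m" "\<And>e. e \<in> tuples \<Z> 9 \<Longrightarrow> sat \<Z> e \<phi>m \<longleftrightarrow> (\<forall>s\<in>tuples \<Z> k. \<forall>C a b c.
      Ev (take 3 e) s C a \<longrightarrow> Ev (take 3 (drop 3 e)) s C b \<longrightarrow> Ev (take 3 (drop 6 e)) s C c \<longrightarrow> a * b = C * c)"
    unfolding rdef_def by blast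
  define \<Gamma> where "\<Gamma> = \<lparr>cdim = 3, cpar = 0, cdom = \<phi>d, ceq = \<phi>e, czero = \<phi>0, cone = \<phi>1, cadd = \<phi>a, cmul = \<phi>m\<rparr>"
  have dom: "code_dom \<Gamma> \<Z> [] = codeset"
    by (auto simp: code_dom_def codeset_def \<Gamma>_def d)
  have t: "u \<in> tuples \<Z> 3" "length u = 3" "0 \<le> u ! 0" if "u \<in> codeset" for u
    using that by (auto simp: codeset_def tuples_length)
  have t2: "u @ v \<in> tuples \<Z> 6" if "u \<in> codeset" "v \<in> codeset" for u v
    using tuples_append[OF t(1)[OF that(1)] t(1)[OF that(2)]] by simp
  have t3: "u @ v @ w \<in> tuples \<Z> 9" if "u \<in> codeset" "v \<in> codeset" "w \<in> codeset" for u v w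
    using tuples_append[OF t(1)[OF that(1)] t2[OF that(2,3)]] by simp
  have "codes \<Gamma> \<Z> [] L dec"
    unfolding codes_def dom
  proof (intro conjI ballI)
    show "dec ` codeset = carrier L"
      using dec_surj dec_carrier by (auto simp: codeset_def)
    fix u assume u: "u \<in> codeset"
    show "sat \<Z> (u @ []) (czero \<Gamma>) \<longleftrightarrow> dec u = \<zero>\<^bsub>L\<^esub>" "sat \<Z> (u @ []) (cone \<Gamma>) \<longleftrightarrow> dec u = \<one>\<^bsub>L\<^esub>"
      using dec_of_int_iff[OF t(3)[OF u], of 0] dec_of_int_iff[OF t(3)[OF u], of 1] z(2)[OF t(1)[OF u]] o(2)[OF t(1)[OF u]]
      by (simp_all add: \<Gamma>_def)
    fix v assume v: "v \<in> codeset"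
    show "sat \<Z> (u @ v @ []) (ceq \<Gamma>) \<longleftrightarrow> dec u = dec v"
      using dec_eq_iff[OF t(3)[OF u] t(3)[OF v]] e(2)[OF t2[OF u v]] t(2)[OF u] t(2)[OF v] by (simp add: \<Gamma>_def)
    fix w assume w: "w \<in> codeset"
    show "sat \<Z> (u @ v @ w @ []) (cadd \<Gamma>) \<longleftrightarrow> dec u \<oplus>\<^bsub>L\<^esub> dec v = dec w"
      using dec_add_iff[OF t(3)[OF u] t(3)[OF v] t(3)[OF w]] a(2)[OF t3[OF u v w]] t(2)[OF u] t(2)[OF v] t(2)[OF w]
      by (simp add: \<Gamma>_def)
    show "sat \<Z> (u @ v @ w @ []) (cmul \<Gamma>) \<longleftrightarrow> dec u \<otimes>\<^bsub>L\<^esub> dec v = dec w"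
      using dec_mult_iff[OF t(3)[OF u] t(3)[OF v] t(3)[OF w]] m(2)[OF t3[OF u v w]] t(2)[OF u] t(2)[OF v] t(2)[OF w]
      by (simp add: \<Gamma>_def)
  qed
  moreover have "wf_rcode \<Gamma>" using d z o e a m by (simp add: wf_rcode_def \<Gamma>_def)
  ultimately show ?thesis using dom by (intro exI[of _ \<Gamma>]) (simp add: \<Gamma>_def)
qed

end

lemma tdef_carrier:
  assumes "tdef R n F" "closed_struct R" "e \<in> tuples R n"
  shows "F e \<in> carrier R"
proof -
  obtain t where "tvars_below n t" "tval R e t = F e" using assms by (auto simp: tdef_def)
  then show ?thesis
    using tval_closed[OF assms(2), of e t] assms(3) by (auto simp: tuples_def)
qed

lemma tuplesI: "set xs \<subseteq> carrier R \<Longrightarrow> length xs = n \<Longrightarrow> xs \<in> tuples R n"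
  by (simp add: tuples_def)

lemma add_eq_add_iff_diff: "x + d = y + z \<longleftrightarrow> x - y = z - d" for x y z d :: "'a::ab_group_add"
  by (auto simp: algebra_simps)

context laurent
begin

section \<open>The interpretation of the integers\<close>

definition is_int :: "lpoly \<Rightarrow> bool" where
  "is_int r \<longleftrightarrow> (\<exists>n. r = of_int n)"

definition const :: "lpoly \<Rightarrow> int" where
  "const f = lookup f 0"

lemma const_of_int [simp]: "const (of_int n) = n"
  by (simp add: const_def lookup_of_int)

text \<open>The expanded form of w - 1 - r (v - 1) = g (v - 1)^2, with all negative terms moved
  across because the language has no subtraction.\<close>

lemma is_int_iff:
  assumes "k \<ge> 1" "r \<in> carrier L"
  shows "is_int r \<longleftrightarrow> (\<forall>v\<in>carrier L. \<forall>v'\<in>carrier L. v * v' = 1 \<longrightarrow>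
    (\<exists>w\<in>carrier L. \<exists>w'\<in>carrier L. \<exists>g\<in>carrier L. w * w' = 1 \<and>
      w + r + (g * v + g * v) = 1 + r * v + (g * (v * v) + g)))"
proof -
  have e: "w + r + (g * v + g * v) = 1 + r * v + (g * (v * v) + g) \<longleftrightarrow>
      w - 1 - r * (v - 1) = g * ((v - 1) * (v - 1))" for w g v :: lpoly
  proof -
    have "w + r + (g * v + g * v) = 1 + r * v + (g * (v * v) + g) \<longleftrightarrow>
      (w + r + (g * v + g * v)) - (1 + r * v + (g * (v * v) + g)) = 0" by simp
    also have "(w + r + (g * v + g * v)) - (1 + r * v + (g * (v * v) + g)) =
      (w - 1 - r * (v - 1)) - g * ((v - 1) * (v - 1))" by (simp add: algebra_simps)
    finally show ?thesis by simp
  qed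
  show ?thesis
    unfolding e is_int_def using integer_if_unit_condition[OF assms] unit_powers by blast
qed

lemma tdefL_zero: "tdef L n (\<lambda>e. 0)"
  using tdef_zero[of L n] by simp

lemma tdefL_one: "tdef L n (\<lambda>e. 1)"
  using tdef_one[of L n] by simp

lemma tdefL_add: "tdef L n F \<Longrightarrow> tdef L n G \<Longrightarrow> tdef L n (\<lambda>e. F e + G e)"
  using tdef_add[of L n F G] by simp

lemma tdefL_mult: "tdef L n F \<Longrightarrow> tdef L n G \<Longrightarrow> tdef L n (\<lambda>e. F e * G e)"
  using tdef_mult[of L n F G] by simp

lemma tdefL_sum:
  fixes m :: nat
  shows "(\<And>i. i < m \<Longrightarrow> tdef L n (F i)) \<Longrightarrow> tdef L n (\<lambda>e. \<Sum>i<m. F i e)"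
  by (induction m) (simp_all add: tdefL_zero tdefL_add)

lemmas tdefL_intros = tdef_hd tdefL_zero tdefL_one tdefL_add tdefL_mult

lemma rdefL_is_int:
  assumes k: "k \<ge> 1" and F: "tdef L n F"
  shows "rdef L n (\<lambda>e. is_int (F e))"
proof (subst rdef_cong)
  show "is_int (F e) \<longleftrightarrow> (\<forall>v\<in>carrier L. \<forall>v'\<in>carrier L. v * v' = 1 \<longrightarrow>
    (\<exists>w\<in>carrier L. \<exists>w'\<in>carrier L. \<exists>g\<in>carrier L. w * w' = 1 \<and>
      w + F e + (g * v + g * v) = 1 + F e * v + (g * (v * v) + g)))" if "e \<in> tuples L n" for e
    by (rule is_int_iff[OF k tdef_carrier[OF F closed_L that]])
  show "rdef L n (\<lambda>e. \<forall>v\<in>carrier L. \<forall>v'\<in>carrier L. v * v' = 1 \<longrightarrow>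
    (\<exists>w\<in>carrier L. \<exists>w'\<in>carrier L. \<exists>g\<in>carrier L. w * w' = 1 \<and>
      w + F e + (g * v + g * v) = 1 + F e * v + (g * (v * v) + g)))"
    by (rule rdef_all rdef_ex rdef_imp rdef_conj rdef_eq tdefL_intros tdef_tl F)+
qed

text \<open>The code defines the integers at every tuple of \<open>k\<close> parameters, so the
  admissibility formula can still be chosen freely. The parameters are declared so that the
  composite code receives them, to be used as the variables of the Laurent ring.\<close>

lemma interpretation_of_int:
  assumes k: "k \<ge> 1"
  shows "\<exists>\<Delta>. wf_rcode \<Delta> \<and> cdim \<Delta> = 1 \<and> cpar \<Delta> = k \<and>
    (\<forall>p\<in>tuples L k. code_dom \<Delta> L p = range (\<lambda>n. [of_int n]) \<and> codes \<Delta> L p \<Z> (\<lambda>a. const (hd a)))"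
proof -
  have "rdef L (1 + k) (\<lambda>e. is_int (e ! 0))"
    by (rule rdefL_is_int[OF k tdef_nth]) simp
  then obtain \<delta> where \<delta>: "vars_below (1 + k) \<delta>"
    "\<And>e. e \<in> tuples L (1 + k) \<Longrightarrow> sat L e \<delta> \<longleftrightarrow> is_int (e ! 0)"
    unfolding rdef_def by blast
  define \<Delta> where "\<Delta> = \<lparr>cdim = 1, cpar = k, cdom = \<delta>, ceq = FEq (TVar 0) (TVar 1),
    czero = FEq (TVar 0) TZero, cone = FEq (TVar 0) TOne,
    cadd = FEq (TAdd (TVar 0) (TVar 1)) (TVar 2), cmul = FEq (TMul (TVar 0) (TVar 1)) (TVar 2)\<rparr>"
  have dom: "code_dom \<Delta> L p = range (\<lambda>n. [of_int n])" if p: "p \<in> tuples L k" for p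
  proof -
    have "sat L ([a] @ p) \<delta> \<longleftrightarrow> is_int a" if "a \<in> carrier L" for a
      using \<delta>(2)[OF tuples_append[of "[a]" L 1 p k]] that p by (simp add: tuples_def)
    then show ?thesis
      by (auto simp: code_dom_def \<Delta>_def tuples_Suc is_int_def)
  qed
  have "codes \<Delta> L p \<Z> (\<lambda>a. const (hd a))" if p: "p \<in> tuples L k" for p
    unfolding codes_def dom[OF p]
    by (auto simp: \<Delta>_def image_image simp flip: of_int_add of_int_mult)
  moreover have "wf_rcode \<Delta>" using \<delta>(1) by (simp add: wf_rcode_def \<Delta>_def)
  ultimately show ?thesis using dom by (intro exI[of _ \<Delta>]) (simp add: \<Delta>_def)
qed

section \<open>The coordinate map of the composite over the Laurent polynomials\<close>

definition Xs :: "lpoly list" where "Xs = map X [0..<k]"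

lemma Xs_tuple: "Xs \<in> tuples L k"
  by (auto simp: Xs_def tuples_def X_carrier)

text \<open>The ideal generated by the x_i - s_i. One tuple of \<open>k\<close> cofactors witnesses
  membership, which keeps the condition first-order.\<close>

definition idl :: "int list \<Rightarrow> lpoly set" where
  "idl s = {g. \<exists>t\<in>tuples L k. g = (\<Sum>i<k. (X i - of_int (s ! i)) * t ! i)}"

lemma idlI:
  assumes "\<And>i. i < k \<Longrightarrow> t i \<in> carrier L"
  shows "(\<Sum>i<k. (X i - of_int (s ! i)) * t i) \<in> idl s"
proof -
  have "map t [0..<k] \<in> tuples L k" by (intro tuplesI) (use assms in auto)
  moreover have "(\<Sum>i<k. (X i - of_int (s ! i)) * t i) = (\<Sum>i<k. (X i - of_int (s ! i)) * map t [0..<k] ! i)"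
    by simp
  ultimately show ?thesis unfolding idl_def by blast
qed

lemma idlE:
  assumes "f \<in> idl s"
  obtains t where "f = (\<Sum>i<k. (X i - of_int (s ! i)) * t i)" "\<And>i. i < k \<Longrightarrow> t i \<in> carrier L"
proof -
  obtain t where "t \<in> tuples L k" "f = (\<Sum>i<k. (X i - of_int (s ! i)) * t ! i)"
    using assms by (auto simp: idl_def)
  then show ?thesis using that tuples_nth by blast
qed

lemma idl_0: "0 \<in> idl s"
  using idlI[of "\<lambda>i. 0" s] by simp

lemma idl_add:
  assumes "f \<in> idl s" "g \<in> idl s"
  shows "f + g \<in> idl s"
proof -
  obtain t where t: "f = (\<Sum>i<k. (X i - of_int (s ! i)) * t i)" "\<And>i. i < k \<Longrightarrow> t i \<in> carrier L"
    using idlE[OF assms(1)] by blast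
  obtain t' where t': "g = (\<Sum>i<k. (X i - of_int (s ! i)) * t' i)" "\<And>i. i < k \<Longrightarrow> t' i \<in> carrier L"
    using idlE[OF assms(2)] by blast
  have "f + g = (\<Sum>i<k. (X i - of_int (s ! i)) * (t i + t' i))"
    by (simp add: t t' distrib_left sum.distrib)
  then show ?thesis using idlI[of "\<lambda>i. t i + t' i" s] t t' carrier_add by simp
qed

lemma idl_mult:
  assumes "f \<in> idl s" "c \<in> carrier L"
  shows "c * f \<in> idl s"
proof -
  obtain t where t: "f = (\<Sum>i<k. (X i - of_int (s ! i)) * t i)" "\<And>i. i < k \<Longrightarrow> t i \<in> carrier L"
    using idlE[OF assms(1)] by blast
  have "c * f = (\<Sum>i<k. (X i - of_int (s ! i)) * (c * t i))"
    by (simp add: t sum_distrib_left mult_ac)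
  then show ?thesis using idlI[of "\<lambda>i. c * t i" s] t assms(2) carrier_mult by simp
qed

lemma idl_gen:
  assumes i: "i < k" and g: "g \<in> carrier L"
  shows "(X i - of_int (s ! i)) * g \<in> idl s"
proof -
  have "(\<Sum>j<k. (X j - of_int (s ! j)) * (if j = i then g else 0)) =
      (\<Sum>j<k. if j = i then (X i - of_int (s ! i)) * g else 0)"
    by (rule sum.cong) auto
  then show ?thesis using idlI[of "\<lambda>j. if j = i then g else 0" s] i g by simp
qed

lemma ev_idl: "nonzero k s \<Longrightarrow> f \<in> idl s \<Longrightarrow> ev s f = 0"
  by (auto simp: idl_def ev_sum ev_mult ev_diff ev_X ev_of_int)

text \<open>Each operation preserves the congruence between C v and its scaled value, since x_i is
  congruent to s_i modulo the ideal.\<close>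

lemma Ev_idl:
  assumes E: "Ev u s C b" and u: "0 \<le> u ! 0"
  shows "of_int C * dec u - of_int b \<in> idl s"
proof (rule Ev_induct[where P = "\<lambda>v x. of_int C * v - of_int x \<in> idl s", OF E u])
  show "of_int C * 0 - of_int 0 \<in> idl s" by (simp add: idl_0)
next
  fix v :: lpoly and x y z :: int
  assume I: "of_int C * v - of_int x \<in> idl s" and st: "step s C z x y"
  show "of_int C * op z v - of_int y \<in> idl s"
  proof (cases z rule: op_cases)
    case (X i)
    have y: "y = s ! i * x" using st X by (auto simp: step_def)
    have "of_int C * (X i * v) - of_int y =
        X i * (of_int C * v - of_int x) + (X i - of_int (s ! i)) * of_int x"
      by (simp add: y algebra_simps)
    then show ?thesis using X I by (simp add: op_X idl_add idl_mult idl_gen X_carrier)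
  next
    case (Xi i)
    have x: "x = s ! i * y" using st Xi by (auto simp: step_def)
    \<comment> \<open>From x = s_i y: the inverse of x_i times x is congruent to the inverse of x_i
      times x_i y, which is y. So no division by s_i takes place in the ring.\<close>
    have "of_int C * (Xi i * v) - of_int y =
        Xi i * (of_int C * v - of_int x) + (X i - of_int (s ! i)) * (- (Xi i * of_int y)) + (X i * Xi i - 1) * of_int y"
      by (simp add: x algebra_simps)
    then have "of_int C * (Xi i * v) - of_int y =
        Xi i * (of_int C * v - of_int x) + (X i - of_int (s ! i)) * (- (Xi i * of_int y))"
      by (simp add: X_Xi)
    moreover have "- (Xi i * of_int y) \<in> carrier L"
      using Xi by (intro carrier_uminus carrier_mult X_carrier carrier_of_int)
    ultimately show ?thesis using Xi I
      by (simp add: op_Xi idl_add idl_mult idl_gen X_carrier del: of_nat_add mult_minus_right)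
  next
    case add
    have "y = x + C" using st add by (auto simp: step_def)
    then show ?thesis using I unfolding add op_add by (simp add: algebra_simps)
  next
    case diff
    have "x = y + C" using st diff unfolding step_def by blast
    then show ?thesis using I unfolding op_diff[OF diff] by (simp add: algebra_simps)
  qed
qed

text \<open>The graph of the coordinate map at the parameters \<open>p\<close> (intended: the variables), for the
  formulas \<open>\<delta>\<close> (\<open>u\<close> is a code) and \<open>\<tau>\<close> (the relation \<^const>\<open>Ev\<close> for constants): all
  congruences \<open>C f \<equiv> b\<close> modulo \<open>p\<^sub>0 - s\<^sub>0, \<dots>\<close> that the code predicts hold.\<close>

definition coord_graph :: "rform \<Rightarrow> rform \<Rightarrow> lpoly list \<Rightarrow> lpoly list \<Rightarrow> lpoly \<Rightarrow> bool" where
  "coord_graph \<delta> \<tau> p u f \<longleftrightarrow> sat L (u @ p) \<delta> \<and>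
     (\<forall>s\<in>tuples L k. \<forall>C\<in>carrier L. \<forall>b\<in>carrier L.
       (\<forall>i<k. is_int (s ! i)) \<longrightarrow> is_int C \<longrightarrow> is_int b \<longrightarrow> sat L (u @ s @ C # b # p) \<tau> \<longrightarrow>
       (\<exists>t\<in>tuples L k. C * f + (\<Sum>i<k. s ! i * t ! i) = b + (\<Sum>i<k. p ! i * t ! i)))"

lemma rdef_coord_graph:
  assumes k: "k \<ge> 1" and \<delta>: "vars_below (3 + k) \<delta>" and \<tau>: "vars_below (3 + (k + Suc (Suc k))) \<tau>"
    and U: "vdef L n 3 U" and F: "tdef L n F" and P: "vdef L n k P"
  shows "rdef L n (\<lambda>e. coord_graph \<delta> \<tau> (P e) (U e) (F e))"
  unfolding coord_graph_def
  by (rule rdef_conj rdef_all_tuple rdef_ex_tuple rdef_all rdef_ex rdef_imp rdef_ball_lessThan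
      rdefL_is_int[OF k] rdef_sat[OF \<delta>] rdef_sat[OF \<tau>] rdef_eq tdef_hd tdefL_add tdefL_mult tdefL_sum
      vdef_nth tdef_tl tdef_drop vdef_append vdef_Cons vdef_take vdef_tl vdef_drop U F P | assumption)+

text \<open>The decoded polynomial satisfies all predicted congruences by \<open>Ev_idl\<close>.
  Conversely, evaluation at s kills the ideal of s, so a single congruence at each s fixes the value
  of f there, and these values determine f.\<close>

lemma coord_graph_Xs:
  assumes \<delta>: "sat L (map of_int u @ Xs) \<delta>" and u: "0 \<le> u ! 0"
    and \<tau>: "\<And>s C b. length s = k \<Longrightarrow>
      sat L (map of_int u @ map of_int s @ of_int C # of_int b # Xs) \<tau> \<longleftrightarrow> Ev u s C b"
    and f: "f \<in> carrier L"
  shows "coord_graph \<delta> \<tau> Xs (map of_int u) f \<longleftrightarrow> f = dec u"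
proof -
  \<comment> \<open>The equation in \<open>coord_graph\<close> is ideal membership with the
    subtractions moved across.\<close>
  have idl_iff: "(\<exists>t\<in>tuples L k. of_int C * f + (\<Sum>i<k. map of_int s ! i * t ! i) =
      of_int b + (\<Sum>i<k. Xs ! i * t ! i)) \<longleftrightarrow> of_int C * f - of_int b \<in> idl s"
    if s: "length s = k" for s C b and f :: lpoly
  proof -
    have "of_int C * f + (\<Sum>i<k. map of_int s ! i * t ! i) = of_int b + (\<Sum>i<k. Xs ! i * t ! i) \<longleftrightarrow>
        of_int C * f - of_int b = (\<Sum>i<k. (X i - of_int (s ! i)) * t ! i)" for t
    proof -
      have e: "(\<Sum>i<k. (X i - of_int (s ! i)) * t ! i) =
          (\<Sum>i<k. Xs ! i * t ! i) - (\<Sum>i<k. map of_int s ! i * t ! i)"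
        using s by (simp add: Xs_def left_diff_distrib sum_subtractf)
      show ?thesis unfolding e by (rule add_eq_add_iff_diff)
    qed
    then show ?thesis by (simp add: idl_def)
  qed
  have "coord_graph \<delta> \<tau> Xs (map of_int u) f \<longleftrightarrow>
      (\<forall>s C b. length s = k \<longrightarrow> Ev u s C b \<longrightarrow> of_int C * f - of_int b \<in> idl s)"
  proof
    assume T: "coord_graph \<delta> \<tau> Xs (map of_int u) f"
    show "\<forall>s C b. length s = k \<longrightarrow> Ev u s C b \<longrightarrow> of_int C * f - of_int b \<in> idl s"
    proof (intro allI impI)
      fix s C b assume s: "length s = k" "Ev u s C b"
      have "set (map of_int s) \<subseteq> carrier L" by auto
      then have "map of_int s \<in> tuples L k" by (rule tuplesI) (simp add: s(1))
      moreover have "is_int (map of_int s ! i)" if "i < k" for i using s(1) that by (auto simp: is_int_def)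
      moreover have "is_int (of_int n)" for n by (auto simp: is_int_def)
      moreover have "sat L (map of_int u @ map of_int s @ of_int C # of_int b # Xs) \<tau>"
        using \<tau>[OF s(1)] s(2) by blast
      ultimately have "\<exists>t\<in>tuples L k. of_int C * f + (\<Sum>i<k. map of_int s ! i * t ! i) =
          of_int b + (\<Sum>i<k. Xs ! i * t ! i)"
        using T[unfolded coord_graph_def, THEN conjunct2, rule_format, of "map of_int s" "of_int C" "of_int b"]
          carrier_of_int by blast
      then show "of_int C * f - of_int b \<in> idl s" using idl_iff[OF s(1)] by blast
    qed
  next
    assume R: "\<forall>s C b. length s = k \<longrightarrow> Ev u s C b \<longrightarrow> of_int C * f - of_int b \<in> idl s"
    show "coord_graph \<delta> \<tau> Xs (map of_int u) f"
      unfolding coord_graph_def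
    proof (intro conjI ballI impI)
      fix s C b
      assume s: "s \<in> tuples L k" "\<forall>i<k. is_int (s ! i)" and Cb: "is_int C" "is_int b"
        and sat: "sat L (map of_int u @ s @ C # b # Xs) \<tau>"
      obtain C' b' where Cb': "C = of_int C'" "b = of_int b'" using Cb by (auto simp: is_int_def)
      define s' where "s' = map const s"
      have s': "length s' = k" "s = map of_int s'"
        using s by (auto simp: s'_def tuples_length is_int_def intro!: nth_equalityI)
      have "Ev u s' C' b'" using sat \<tau>[OF s'(1)] unfolding Cb' s'(2)[symmetric] by simp
      then have "of_int C' * f - of_int b' \<in> idl s'" using R s'(1) by blast
      then show "\<exists>t\<in>tuples L k. C * f + (\<Sum>i<k. s ! i * t ! i) = b + (\<Sum>i<k. Xs ! i * t ! i)"
        using idl_iff[OF s'(1), of C' f b'] unfolding Cb' s'(2)[symmetric] by simp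
    qed (rule \<delta>)
  qed
  also have "\<dots> \<longleftrightarrow> f = dec u"
  proof
    assume R: "\<forall>s C b. length s = k \<longrightarrow> Ev u s C b \<longrightarrow> of_int C * f - of_int b \<in> idl s"
    show "f = dec u"
    proof (rule ev_separates[OF f dec_carrier])
      fix s assume s: "s \<in> tuples \<Z> k" "nonzero k s"
      obtain C b where E: "Ev u s C b" using Ev_exists3[OF s(2) u u u] by blast
      then have "of_int C * f - of_int b \<in> idl s" using R s(1) by (simp add: tuples_length)
      then have "ev s (of_int C * f - of_int b) = 0" by (rule ev_idl[OF s(2)])
      then have "of_int C * ev s f = of_int b" by (simp add: ev_diff ev_mult[OF s(2)] ev_of_int)
      then show "ev s f = ev s (dec u)" using Ev_value[OF E u] Ev_nonzero[OF E] by simp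
    qed
  qed (use Ev_idl u in blast)
  finally show ?thesis .
qed

section \<open>Assembly of the bi-interpretation\<close>

lemma concat_singletons: "concat (map (\<lambda>x. [x]) xs) = xs"
  by (induction xs) auto

lemma singleton_blocks:
  "(set bs \<subseteq> range (\<lambda>n. [of_int n])) \<longleftrightarrow> (\<exists>zs. bs = map (\<lambda>z. [of_int z :: lpoly]) zs)"
proof (induction bs)
  case (Cons b bs)
  show ?case
  proof
    assume "set (b # bs) \<subseteq> range (\<lambda>n. [of_int n])"
    then obtain z zs where "b = [of_int z]" "bs = map (\<lambda>z. [of_int z]) zs" using Cons by auto
    then show "\<exists>zs. b # bs = map (\<lambda>z. [of_int z]) zs" by (intro exI[of _ "z # zs"]) simp
  qed auto
qed simp

lemma regularly_bi_interpretable_laurent_int: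
  assumes k: "k \<ge> 1"
  shows "regularly_bi_interpretable L \<Z>"
proof -
  obtain \<Gamma> where \<Gamma>: "wf_rcode \<Gamma>" "cdim \<Gamma> = 3" "cpar \<Gamma> = 0" "code_dom \<Gamma> \<Z> [] = codeset"
    "codes \<Gamma> \<Z> [] L dec"
    using interpretation_in_int by blast
  obtain \<Delta> where \<Delta>: "wf_rcode \<Delta>" "cdim \<Delta> = 1" "cpar \<Delta> = k"
    "\<And>p. p \<in> tuples L k \<Longrightarrow> code_dom \<Delta> L p = range (\<lambda>n. [of_int n])"
    "\<And>p. p \<in> tuples L k \<Longrightarrow> codes \<Delta> L p \<Z> (\<lambda>a. const (hd a))"
    using interpretation_of_int[OF k] by blast
  have closed_Z: "closed_struct \<Z>" by (simp add: closed_struct_def)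
  \<comment> \<open>A true sentence: the interpretation in the integers has the empty tuple as its
    only parameter tuple.\<close>
  define \<phi> where "\<phi> = FEq TOne TOne"
  let ?GD = "code_comp \<Gamma> \<Delta>" and ?DG = "code_comp \<Delta> \<Gamma>"
  have dims: "cdim ?GD = 3" "cpar ?GD = k" "cdim ?DG = 3" "cpar ?DG = k * 3"
    using \<Gamma> \<Delta> by (simp_all add: code_comp_def Let_def)
  have wf: "wf_rcode ?GD" "wf_rcode ?DG" using \<Gamma> \<Delta> wf_code_comp by blast+

  have "rdef \<Z> (3 + (k + 2)) (\<lambda>e. Ev (take 3 e) (take k (drop 3 e)) (e ! (3 + k)) (e ! (4 + k)))"
    using vdef_slice[of 0 3 "3 + (k + 2)" \<Z>] vdef_slice[of 3 k "3 + (k + 2)" \<Z>]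
    by (intro rdefZ_Ev tdef_nth) simp_all
  then obtain \<eta> where \<eta>: "vars_below (3 + (k + 2)) \<eta>" "\<And>e. e \<in> tuples \<Z> (3 + (k + 2)) \<Longrightarrow>
      sat \<Z> e \<eta> \<longleftrightarrow> Ev (take 3 e) (take k (drop 3 e)) (e ! (3 + k)) (e ! (4 + k))"
    unfolding rdef_def by blast
  \<comment> \<open>The relation \<open>Ev\<close> restricted to integer constants, as a formula
    about the Laurent ring.\<close>
  define \<tau> where "\<tau> = translate \<Delta> (3 + (k + 2)) \<eta>"
  have \<tau>_vars: "vars_below (3 + (k + Suc (Suc k))) \<tau>"
  proof -
    have e: "1 * (3 + (k + 2)) + k = 3 + (k + Suc (Suc k))" by simp
    show ?thesis using vars_below_translate[OF \<Delta>(1) \<eta>(1)] unfolding \<Delta>(2,3) e \<tau>_def .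
  qed
  define \<delta> where "\<delta> = cdom ?GD"
  have \<delta>_vars: "vars_below (3 + k) \<delta>" using wf(1) dims by (simp add: \<delta>_def wf_rcode_def)

  have coded\<Delta>: "coded \<Delta> L p \<Z> (\<lambda>a. const (hd a))" if "p \<in> tuples L k" for p
    using that \<Delta> closed_Z by (simp add: coded_def tuples_length)
  have coded\<Gamma>: "coded \<Gamma> \<Z> [] L dec"
    using \<Gamma> closed_L by (simp add: coded_def)

  have GD_dom: "code_dom ?GD L p = map of_int ` codeset" if p: "p \<in> tuples L k" for p
  proof -
    have "code_dom ?GD L p = concat ` {bs. set bs \<subseteq> range (\<lambda>n. [of_int n]) \<and> map (\<lambda>a. const (hd a)) bs \<in> codeset}"
      using coded.code_dom_code_comp[OF coded\<Delta>[OF p] \<Gamma>(1), of "[]" "[]"] \<Gamma>(3,4) \<Delta>(4)[OF p] by simp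
    also have "\<dots> = concat ` (\<lambda>zs. map (\<lambda>z. [of_int z]) zs) ` codeset"
      unfolding singleton_blocks by (rule arg_cong) (auto simp: comp_def)
    also have "\<dots> = map of_int ` codeset"
      unfolding image_image
      by (intro image_cong) (simp_all add: concat_singletons[of "map of_int _", unfolded map_map comp_def])
    finally show ?thesis .
  qed
  have GD_codes: "codes ?GD L p L (\<lambda>a. dec (map const a))" if p: "p \<in> tuples L k" for p
  proof -
    have c: "codes ?GD L p L (\<lambda>a. dec (map (\<lambda>a. const (hd a)) (chunks 1 3 a)))"
      using coded.codes_code_comp[OF coded\<Delta>[OF p] \<Gamma>(5) \<Gamma>(1), of "[]"] \<Gamma>(2,3) \<Delta>(2) by simp
    have "map (\<lambda>a. const (hd a)) (chunks 1 3 a) = map const a" if "a \<in> code_dom ?GD L p" for a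
    proof -
      have "length a = 3" using that by (auto simp: code_dom_def dims tuples_length)
      then have "chunks 1 3 (concat (map (\<lambda>x. [x]) a)) = map (\<lambda>x. [x]) a" by (intro chunks_concat) auto
      then show ?thesis by (simp add: concat_singletons comp_def)
    qed
    then show ?thesis using c unfolding codes_def by (simp cong: image_cong)
  qed
  have \<tau>: "sat L (map of_int u @ map of_int s @ of_int C # of_int b # p) \<tau> \<longleftrightarrow> Ev u s C b"
    if p: "p \<in> tuples L k" and u: "length u = 3" and s: "length s = k" for p u s C b
  proof -
    let ?zs = "u @ s @ [C, b]"
    let ?bs = "map (\<lambda>z. [of_int z :: lpoly]) ?zs"
    have "concat ?bs = map of_int u @ map of_int s @ [of_int C, of_int b]"
      using concat_singletons[of "map of_int ?zs"] by (simp add: comp_def)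
    then have "sat L (map of_int u @ map of_int s @ of_int C # of_int b # p) \<tau> = sat L (concat ?bs @ p) \<tau>"
      by simp
    also have "\<dots> = sat \<Z> (map (\<lambda>a. const (hd a)) ?bs) \<eta>"
      unfolding \<tau>_def
      by (rule coded.sat_translate[OF coded\<Delta>[OF p]]) (use u s \<eta>(1) \<Delta>(4)[OF p] in auto)
    also have "map (\<lambda>a. const (hd a)) ?bs = ?zs" by (simp add: comp_def)
    also have "sat \<Z> ?zs \<eta> = Ev u s C b"
      using \<eta>(2)[of ?zs] u s by (simp add: tuples_def nth_append)
    finally show ?thesis .
  qed

  \<comment> \<open>Admissibility of \<open>p\<close>: the congruences with \<open>p\<close> in
    place of the variables define the graph of a coordinate map of the composite. This is exactly
    what \<theta>A will have to satisfy at \<open>p\<close>.\<close>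
  define G where "G p \<longleftrightarrow> graph_codes ?GD L p (coord_graph \<delta> \<tau> p)" for p
  have "rdef L k G"
    unfolding G_def
    using rdef_graph_codes[OF wf(1), of L k "\<lambda>e. e" "coord_graph \<delta> \<tau>"] rdef_coord_graph[OF k \<delta>_vars \<tau>_vars] vdef_id[of L k]
    by (simp add: dims)
  then obtain \<psi> where \<psi>: "vars_below k \<psi>" "\<And>p. p \<in> tuples L k \<Longrightarrow> sat L p \<psi> \<longleftrightarrow> G p"
    unfolding rdef_def by blast
  have "rdef L (3 + 1 + k) (\<lambda>e. coord_graph \<delta> \<tau> (drop 4 e) (take 3 e) (e ! 3))"
    using vdef_slice[of 0 3 "3 + 1 + k" L] vdef_slice[of 4 k "3 + 1 + k" L] vdef_drop[OF vdef_id[of L k], of 4]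
    by (intro rdef_coord_graph[OF k \<delta>_vars \<tau>_vars] tdef_nth) simp_all
  then obtain \<theta>A where \<theta>A: "vars_below (3 + 1 + k) \<theta>A" "\<And>e. e \<in> tuples L (3 + 1 + k) \<Longrightarrow>
      sat L e \<theta>A \<longleftrightarrow> coord_graph \<delta> \<tau> (drop 4 e) (take 3 e) (e ! 3)"
    unfolding rdef_def by blast
  \<comment> \<open>In the composite over the integers an element is a code \<open>u\<close> of a
    constant polynomial; the relation says that this constant is \<open>e ! 3\<close>.\<close>
  have "rdef \<Z> (3 + 1 + k * 3) (\<lambda>e. 0 \<le> e ! 0 \<and> (\<forall>s\<in>tuples \<Z> k. \<forall>C a. Ev (take 3 e) s C a \<longrightarrow> a = C * e ! 3))"
    using vdef_slice[of 0 3 "3 + 1 + k * 3" \<Z>]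
    by (intro rdef_conj rdefZ_nonneg rdefZ_dec_of_int tdef_nth) simp_all
  then obtain \<theta>B where \<theta>B: "vars_below (3 + 1 + k * 3) \<theta>B" "\<And>e. e \<in> tuples \<Z> (3 + 1 + k * 3) \<Longrightarrow>
      sat \<Z> e \<theta>B \<longleftrightarrow> 0 \<le> e ! 0 \<and> (\<forall>s\<in>tuples \<Z> k. \<forall>C a. Ev (take 3 e) s C a \<longrightarrow> a = C * e ! 3)"
    unfolding rdef_def by blast

  have "regular_interpretation \<Gamma> \<phi> L \<Z>"
    using codes_coordinate_map[OF \<Gamma>(5) closed_L] \<Gamma>(1,3)
    by (auto simp: regular_interpretation_def \<phi>_def solutions_def coordinate_map_def)
  moreover have "regular_interpretation \<Delta> \<psi> \<Z> L"
  proof -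
    have T: "coord_graph \<delta> \<tau> Xs u f \<longleftrightarrow> u \<in> code_dom ?GD L Xs \<and> f = dec (map const u)"
      if u: "u \<in> tuples L (cdim ?GD)" and f: "f \<in> carrier L" for u f
    proof (cases "u \<in> code_dom ?GD L Xs")
      case True
      then obtain z where z: "z \<in> codeset" "u = map of_int z" using GD_dom[OF Xs_tuple] by auto
      have "sat L (map of_int z @ Xs) \<delta>" using True by (simp add: code_dom_def \<delta>_def z)
      moreover have "length z = 3" "0 \<le> z ! 0" using z by (auto simp: codeset_def tuples_length)
      ultimately have "coord_graph \<delta> \<tau> Xs (map of_int z) f \<longleftrightarrow> f = dec z"
        using \<tau>[OF Xs_tuple] f by (intro coord_graph_Xs) auto
      then show ?thesis using True by (simp add: z comp_def)
    next
      case False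
      then show ?thesis using u by (simp add: coord_graph_def \<delta>_def code_dom_def)
    qed
    \<comment> \<open>The tuple of variables shows that the admissibility formula has a solution;
      the graph there is that of the composed decoding.\<close>
    have "G Xs" unfolding G_def by (rule graph_codesI[OF GD_codes[OF Xs_tuple] T])
    then have "Xs \<in> solutions L k \<psi>" using \<psi>(2) Xs_tuple by (simp add: solutions_def)
    moreover have "code_defined \<Delta> L p \<and> struct_iso (interp \<Delta> L p) \<Z> \<noteq> {}" if "p \<in> tuples L k" for p
      using codes_coordinate_map[OF \<Delta>(5)[OF that] closed_Z] by (auto simp: coordinate_map_def)
    ultimately show ?thesis
      using \<Delta>(1,3) \<psi>(1) by (auto simp: regular_interpretation_def solutions_def)
  qed
  moreover have "defines_coordinate_map \<theta>A ?GD L r" if r: "r \<in> solutions L k (par_comp \<Gamma> \<phi> \<Delta> \<psi>)" for r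
  proof -
    have rt: "r \<in> tuples L k" using r by (simp add: solutions_def)
    \<comment> \<open>As \<Gamma> has no parameters, there are no blocks, and admissibility for the
      composite is \<psi> itself.\<close>
    have "sat L r \<psi>"
      using r \<Gamma>(3) by (simp add: solutions_def par_comp_def blocks_in_dom_def at_blocks_def rename_id)
    then have "graph_codes ?GD L r (coord_graph \<delta> \<tau> r)" using \<psi>(2)[OF rt] by (simp add: G_def)
    then obtain \<mu> where \<mu>: "codes ?GD L r L \<mu>" "\<And>u f. u \<in> tuples L 3 \<Longrightarrow> f \<in> carrier L \<Longrightarrow>
        coord_graph \<delta> \<tau> r u f \<longleftrightarrow> u \<in> code_dom ?GD L r \<and> f = \<mu> u"
      using graph_codesD[of ?GD L r "coord_graph \<delta> \<tau> r"] by (auto simp: dims)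
    have "sat L (u @ [x] @ r) \<theta>A \<longleftrightarrow> u \<in> code_dom ?GD L r \<and> x = \<mu> u"
      if u: "u \<in> tuples L 3" "x \<in> carrier L" for u x
    proof -
      have len: "length u = 3" using u by (simp add: tuples_length)
      have "u @ [x] @ r \<in> tuples L (3 + 1 + k)"
        using u rt by (auto simp: tuples_def)
      then have "sat L (u @ [x] @ r) \<theta>A \<longleftrightarrow> coord_graph \<delta> \<tau> r u x" using \<theta>A(2)[of "u @ [x] @ r"] len by (simp add: nth_append)
      then show ?thesis using \<mu>(2) u by simp
    qed
    then show ?thesis
      unfolding defines_coordinate_map_def dims
      using codes_coordinate_map[OF \<mu>(1) closed_L] by blast
  qed
  moreover have "defines_coordinate_map \<theta>B ?DG \<Z> r"
    if r: "r \<in> solutions \<Z> (k * 3) (par_comp \<Delta> \<psi> \<Gamma> \<phi>)" for r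
  proof -
    have rt: "r \<in> tuples \<Z> (3 * k)" using r by (simp add: solutions_def mult.commute)
    define rs where "rs = chunks 3 k r"
    have rs: "concat rs = r" "length rs = k" "set rs \<subseteq> tuples \<Z> 3"
      using concat_chunks[of r 3 k] set_chunks[OF rt] rt by (simp_all add: rs_def tuples_length)
    have "sat \<Z> (concat rs @ []) (blocks_in_dom \<Gamma> k k (FAnd (translate \<Gamma> k \<psi>) (at_blocks 3 k [] \<phi>)))"
      using r by (simp add: solutions_def par_comp_def \<Gamma>(2) \<Delta>(3) rs(1))
    then have "\<forall>i<k. rs ! i \<in> codeset"
      using coded.sat_blocks_in_dom[OF coded\<Gamma>, of rs k k] rs \<Gamma>(2,4) by simp
    \<comment> \<open>The blocks of \<open>r\<close> are codes of the parameters \<open>q\<close> at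
      which the code of the integers is used.\<close>
    then have rsd: "set rs \<subseteq> codeset" using rs(2) by (auto simp: in_set_conv_nth)
    define q where "q = map dec rs"
    have q: "q \<in> tuples L k" using rs(2) dec_carrier by (auto simp: q_def tuples_def)
    have dom: "code_dom ?DG \<Z> r = {u \<in> codeset. is_int (dec u)}"
    proof -
      have "code_dom ?DG \<Z> r = concat ` {bs. set bs \<subseteq> codeset \<and> map dec bs \<in> range (\<lambda>n. [of_int n])}"
        using coded.code_dom_code_comp[OF coded\<Gamma> \<Delta>(1), of rs q] \<Gamma>(4) \<Delta>(3) \<Delta>(4)[OF q] rsd rs q_def by simp
      also have "{bs. set bs \<subseteq> codeset \<and> map dec bs \<in> range (\<lambda>n. [of_int n])} =
          (\<lambda>u. [u]) ` {u \<in> codeset. is_int (dec u)}"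
        by (auto simp: is_int_def)
      finally show ?thesis by (simp add: image_image)
    qed
    define \<mu> where "\<mu> u = const (hd (map dec (chunks 3 1 u)))" for u
    have \<mu>: "\<mu> u = const (dec u)" if "u \<in> tuples \<Z> 3" for u
      using chunks_concat[of "[u]" 3 1] tuples_length[OF that] by (simp add: \<mu>_def)
    have c: "codes ?DG \<Z> r \<Z> \<mu>"
      using coded.codes_code_comp[OF coded\<Gamma> \<Delta>(5)[OF q] \<Delta>(1), of rs] \<Gamma>(2,4) \<Delta>(2,3) rsd rs
      by (simp add: \<mu>_def[abs_def] q_def)
    have "sat \<Z> (u @ [x] @ r) \<theta>B \<longleftrightarrow> u \<in> code_dom ?DG \<Z> r \<and> x = \<mu> u" if u: "u \<in> tuples \<Z> 3" for u x
    proof -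
      have len: "length u = 3" using u by (simp add: tuples_length)
      have "u @ [x] @ r \<in> tuples \<Z> (3 + 1 + k * 3)"
        using u rt by (auto simp: tuples_def)
      then have "sat \<Z> (u @ [x] @ r) \<theta>B \<longleftrightarrow>
          0 \<le> u ! 0 \<and> (\<forall>s\<in>tuples \<Z> k. \<forall>C a. Ev u s C a \<longrightarrow> a = C * x)"
        using \<theta>B(2)[of "u @ [x] @ r"] len by (simp add: nth_append)
      also have "\<dots> \<longleftrightarrow> 0 \<le> u ! 0 \<and> dec u = of_int x" using dec_of_int_iff by blast
      also have "\<dots> \<longleftrightarrow> u \<in> code_dom ?DG \<Z> r \<and> x = \<mu> u"
        using u by (auto simp: dom codeset_def is_int_def \<mu>)
      finally show ?thesis .
    qed
    then show ?thesis
      unfolding defines_coordinate_map_def dims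
      using codes_coordinate_map[OF c closed_Z] by blast
  qed
  ultimately show ?thesis
    unfolding regularly_bi_interpretable_def
    using \<theta>A(1) \<theta>B(1) by (intro exI[of _ \<Gamma>] exI[of _ \<phi>] exI[of _ \<Delta>] exI[of _ \<psi>] exI[of _ \<theta>A] exI[of _ \<theta>B])
      (simp add: dims)
qed

end

theorem theorem6p6:
  fixes k :: nat
  assumes "k \<ge> 1"
  shows "regularly_bi_interpretable (laurent_ring k) \<Z>"
  using laurent.regularly_bi_interpretable_laurent_int[OF assms] .

end
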